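(* Let $\mathbf{k}$ be a field, let $S=\mathbf{k}[x_1,\dots,x_n]$ and $S'=\mathbf{k}[y_1,\dots,y_{n'}]$, let $I\subset S$ and $I'\subset S'$ be homogeneous ideals of codimensions $c$ and $c'$ (the quotients are not assumed Cohen-Macaulay), and let $\mathcal{F}$ and $\mathcal{F}'$ be graded free resolutions of $S/I$ and $S'/I'$ over $S$ and $S'$ respectively. If $S/I$ satisfies the lower bound (resp. upper bound) inequality of the $\mathcal{F}$-multiplicity conjecture and $S'/I'$ satisfies the lower bound (resp. upper bound) inequality of the $\mathcal{F}'$-multiplicity conjecture, then $(S/I)\otimes_{\mathbf{k}}(S'/I')$ satisfies the lower bound (resp. upper bound) inequality of the $(\mathcal{F}\otimes_{\mathbf{k}}\mathcal{F}')$-multiplicity conjecture.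
   Context: Polynomial rings are standard graded, and all ideals are proper. A graded free resolution $\mathcal{F}$ of $S/I$ (not necessarily minimal) has the form $\cdots\to\bigoplus_j S(-j)^{\beta_{2,j}(\mathcal{F})}\to\bigoplus_j S(-j)^{\beta_{1,j}(\mathcal{F})}\to S\to S/I\to 0$ with each free module of finite rank and with all shifts $j$ occurring in homological degrees $i\ge 1$ positive. For $i\ge1$ with nonzero $i$-th module, set $m_i(\mathcal{F})=\min\{j:\beta_{i,j}(\mathcal{F})\ne0\}$ and $M_i(\mathcal{F})=\max\{j:\beta_{i,j}(\mathcal{F})\ne0\}$. Let $e(S/I)$ denote the multiplicity of $S/I$ and let $c$ be the codimension of $I$. The lower bound inequality of the $\mathcal{F}$-multiplicity conjecture for $S/I$ is $e(S/I)\ge \frac{1}{c!}\prod_{i=1}^c m_i(\mathcal{F})$; the upper bound inequality is $e(S/I)\le\frac1{c!}\prod_{i=1}^c M_i(\mathcal{F})$. The complex $\mathcal{F}\otimes_{\mathbf{k}}\mathcal{F}'$ is a graded free resolution of $(S/I)\otimes_{\mathbf{k}}(S'/I')$ over the polynomial ring $S\otimes_{\mathbf{k}}S'$, and $(S/I)\otimes_{\mathbf{k}}(S'/I')=(S\otimes_{\mathbf{k}} S')/J$ with $J$ the ideal generated by $I$ and $I'$. *)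

theory Defs
  imports
    Complex_Main
    "HOL-Algebra.QuotRing"
    "HOL-Library.Poly_Mapping"
    "HOL-Library.Extended_Real"
    "HOL-Computational_Algebra.Polynomial"
begin

section \<open>Polynomial rings\<close>

type_synonym ('x, 'k) mpoly = "('x \<Rightarrow>\<^sub>0 nat) \<Rightarrow>\<^sub>0 'k"

text \<open>
  The polynomial ring \<open>k[X]\<close> on a set \<open>X\<close> of variables, where \<open>k\<close> is the field given by the
  type \<open>'k\<close>. The variables are a set rather than a whole type so that every number
  of variables (including \<open>0\<close>) is covered.
\<close>

definition poly_ring :: "'x set \<Rightarrow> ('x, 'k::field) mpoly ring" where
  "poly_ring X =
    \<lparr>carrier = {f. \<forall>m\<in>Poly_Mapping.keys f. Poly_Mapping.keys m \<subseteq> X},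
     monoid.mult = (*), one = 1, zero = 0, add = (+)\<rparr>"

definition mon_deg :: "('x \<Rightarrow>\<^sub>0 nat) \<Rightarrow> nat" where
  "mon_deg m = (\<Sum>x\<in>Poly_Mapping.keys m. Poly_Mapping.lookup m x)"

text \<open>As usual, \<open>0\<close> is homogeneous of every degree.\<close>

definition homogeneous :: "nat \<Rightarrow> ('x, 'k::field) mpoly \<Rightarrow> bool" where
  "homogeneous t f \<longleftrightarrow> (\<forall>m\<in>Poly_Mapping.keys f. mon_deg m = t)"

definition homogeneous_ideal :: "'x set \<Rightarrow> ('x, 'k::field) mpoly set \<Rightarrow> bool" where
  "homogeneous_ideal X I \<longleftrightarrow>
    (\<exists>A \<subseteq> carrier (poly_ring X). (\<forall>a\<in>A. \<exists>t. homogeneous t a) \<and> I = genideal (poly_ring X) A)"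

definition proper_ideal :: "'x set \<Rightarrow> ('x, 'k::field) mpoly set \<Rightarrow> bool" where
  "proper_ideal X I \<longleftrightarrow> ideal I (poly_ring X) \<and> I \<noteq> carrier (poly_ring X)"

definition rename_mon :: "('x \<Rightarrow> 'y) \<Rightarrow> ('x \<Rightarrow>\<^sub>0 nat) \<Rightarrow> ('y \<Rightarrow>\<^sub>0 nat)" where
  "rename_mon g m =
    (\<Sum>x\<in>Poly_Mapping.keys m. Poly_Mapping.single (g x) (Poly_Mapping.lookup m x))"

definition rename :: "('x \<Rightarrow> 'y) \<Rightarrow> ('x, 'k::field) mpoly \<Rightarrow> ('y, 'k) mpoly" where
  "rename g f =
    (\<Sum>m\<in>Poly_Mapping.keys f. Poly_Mapping.single (rename_mon g m) (Poly_Mapping.lookup f m))"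

text \<open>
  The tensor product \<open>k[X] \<otimes> k[Y]\<close> is the polynomial ring on the disjoint union \<open>X <+> Y\<close>, with
  \<open>f \<otimes> 1\<close> and \<open>1 \<otimes> g\<close> being \<open>rename Inl f\<close> and \<open>rename Inr g\<close>. Then \<open>(k[X]/I) \<otimes> (k[Y]/I')\<close> is
  \<open>k[X <+> Y]/J\<close>, where \<open>J\<close> is the following ideal.
\<close>

definition tensor_ideal ::
  "'x set \<Rightarrow> 'y set \<Rightarrow> ('x, 'k::field) mpoly set \<Rightarrow> ('y, 'k) mpoly set \<Rightarrow> ('x + 'y, 'k) mpoly set" where
  "tensor_ideal X Y I I' = genideal (poly_ring (X <+> Y)) (rename Inl ` I \<union> rename Inr ` I')"


section \<open>Dimension, codimension and multiplicity\<close>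

definition krull_dim :: "('a, 'm) ring_scheme \<Rightarrow> enat" where
  "krull_dim R = Sup {enat r | r. \<exists>P :: nat \<Rightarrow> 'a set.
     (\<forall>i\<le>r. primeideal (P i) R) \<and> (\<forall>i<r. P i \<subset> P (Suc i))}"

text \<open>
  The Krull dimensions below are finite when \<open>X\<close> is finite, so \<open>the_enat\<close> is harmless.
\<close>

definition dim_quot :: "'x set \<Rightarrow> ('x, 'k::field) mpoly set \<Rightarrow> nat" where
  "dim_quot X I = the_enat (krull_dim (poly_ring X Quot I))"

definition codim :: "'x set \<Rightarrow> ('x, 'k::field) mpoly set \<Rightarrow> nat" where
  "codim X I = the_enat (krull_dim (poly_ring X :: ('x, 'k) mpoly ring)) - dim_quot X I"

definition scale :: "'k::field \<Rightarrow> ('x, 'k) mpoly \<Rightarrow> ('x, 'k) mpoly" where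
  "scale c f = Poly_Mapping.single 0 c * f"

interpretation mpoly_vs: vector_space scale
  by unfold_locales
    (simp_all add: scale_def algebra_simps single_add mult_single flip: mult.assoc)

definition graded_part :: "'x set \<Rightarrow> nat \<Rightarrow> ('x, 'k::field) mpoly set" where
  "graded_part X t = {f \<in> carrier (poly_ring X). homogeneous t f}"

text \<open>
  \<open>dim\<^sub>k (S/I)\<^sub>t\<close> for a homogeneous ideal \<open>I\<close>; here \<open>(S/I)\<^sub>t = S\<^sub>t / (I \<inter> S\<^sub>t)\<close> and \<open>S\<^sub>t\<close> is finite
  dimensional.
\<close>

definition hilbert_fun :: "'x set \<Rightarrow> ('x, 'k::field) mpoly set \<Rightarrow> nat \<Rightarrow> nat" where
  "hilbert_fun X I t =
    mpoly_vs.dim (graded_part X t :: ('x, 'k) mpoly set) - mpoly_vs.dim (I \<inter> graded_part X t)"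

definition hilbert_poly :: "'x set \<Rightarrow> ('x, 'k::field) mpoly set \<Rightarrow> real poly" where
  "hilbert_poly X I =
    (THE p. \<forall>\<^sub>F t in sequentially. poly p (real t) = real (hilbert_fun X I t))"

text \<open>
  \<open>(d - 1)!\<close> times the leading coefficient of the Hilbert polynomial if \<open>d = dim S/I\<close> is positive,
  and \<open>dim\<^sub>k S/I\<close> if \<open>d = 0\<close>; in the latter case only finitely many graded parts are nonzero.
\<close>

definition multiplicity :: "'x set \<Rightarrow> ('x, 'k::field) mpoly set \<Rightarrow> real" where
  "multiplicity X I =
    (if dim_quot X I = 0 then real (\<Sum>t | hilbert_fun X I t \<noteq> 0. hilbert_fun X I t)
     else fact (dim_quot X I - 1) * lead_coeff (hilbert_poly X I))"


section \<open>Graded free resolutions\<close>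

text \<open>
  A complex \<open>F\<close> of graded free modules with chosen homogeneous bases: the \<open>i\<close>-th module is
  the direct sum of the \<open>S(- shift F i b)\<close> over \<open>b \<in> basis F i\<close>, and \<open>diff F i a b\<close> is the matrix entry
  of \<open>F\<^sub>i \<rightarrow> F\<^sub>i\<^sub>-\<^sub>1\<close> at the row \<open>a \<in> basis F (i - 1)\<close> and the column \<open>b \<in> basis F i\<close>. The values
  of \<open>diff F 0\<close> are irrelevant.
\<close>

record (overloaded) ('x, 'k, 'b) graded_complex =
  basis :: "nat \<Rightarrow> 'b set"
  shift :: "nat \<Rightarrow> 'b \<Rightarrow> nat"
  diff :: "nat \<Rightarrow> 'b \<Rightarrow> 'b \<Rightarrow> ('x, 'k) mpoly"

definition chain_module ::
  "'x set \<Rightarrow> ('x, 'k::field, 'b) graded_complex \<Rightarrow> nat \<Rightarrow> ('b \<Rightarrow> ('x, 'k) mpoly) set" where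
  "chain_module X F i =
    {v. (\<forall>b\<in>basis F i. v b \<in> carrier (poly_ring X)) \<and> (\<forall>b. b \<notin> basis F i \<longrightarrow> v b = 0)}"

definition boundary ::
  "('x, 'k::field, 'b) graded_complex \<Rightarrow> nat \<Rightarrow> ('b \<Rightarrow> ('x, 'k) mpoly) \<Rightarrow> 'b \<Rightarrow> ('x, 'k) mpoly" where
  "boundary F i v =
    (\<lambda>a. if a \<in> basis F (i - 1) then \<Sum>b\<in>basis F i. diff F i a b * v b else 0)"

text \<open>
  \<open>F\<close> is a graded free resolution of \<open>S/I\<close> with \<open>F\<^sub>0 = S\<close>. The condition on \<open>diff\<close> says that the
  differentials are homogeneous of degree \<open>0\<close>; it forces an entry to vanish whenever the required
  degree would be negative.
\<close>

definition graded_free_resolution ::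
  "'x set \<Rightarrow> ('x, 'k::field) mpoly set \<Rightarrow> ('x, 'k, 'b) graded_complex \<Rightarrow> bool" where
  "graded_free_resolution X I F \<longleftrightarrow>
    (\<forall>i. finite (basis F i)) \<and>
    (\<forall>i\<ge>1. \<forall>b\<in>basis F i. shift F i b > 0) \<and>
    (\<forall>i\<ge>1. \<forall>a\<in>basis F (i - 1). \<forall>b\<in>basis F i.
       diff F i a b \<in> carrier (poly_ring X) \<and>
       (\<forall>m\<in>Poly_Mapping.keys (diff F i a b). mon_deg m + shift F (i - 1) a = shift F i b)) \<and>
    (\<exists>b0. basis F 0 = {b0} \<and> shift F 0 b0 = 0 \<and>
       boundary F 1 ` chain_module X F 1 = {v \<in> chain_module X F 0. v b0 \<in> I}) \<and>
    (\<forall>i\<ge>1. boundary F (i + 1) ` chain_module X F (i + 1) =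
       {v \<in> chain_module X F i. boundary F i v = (\<lambda>_. 0)})"

definition betti :: "('x, 'k, 'b) graded_complex \<Rightarrow> nat \<Rightarrow> nat \<Rightarrow> nat" where
  "betti F i j = card {b \<in> basis F i. shift F i b = j}"

text \<open>
  \<open>m\<^sub>i\<close> and \<open>M\<^sub>i\<close> are a minimum and a maximum whenever the \<open>i\<close>-th module is nonzero. Otherwise they
  have the values \<open>\<infinity>\<close> and \<open>0\<close> of the infimum and the supremum of the empty set in \<open>enat\<close>; this does
  not occur for a resolution of \<open>S/I\<close> and \<open>1 \<le> i \<le> codim I\<close>.
\<close>

definition min_shift :: "('x, 'k, 'b) graded_complex \<Rightarrow> nat \<Rightarrow> enat" where
  "min_shift F i = (INF j\<in>{j. betti F i j \<noteq> 0}. enat j)"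

definition max_shift :: "('x, 'k, 'b) graded_complex \<Rightarrow> nat \<Rightarrow> enat" where
  "max_shift F i = (SUP j\<in>{j. betti F i j \<noteq> 0}. enat j)"

text \<open>
  The tensor product over \<open>k\<close>: the basis element \<open>(p, b, b')\<close> in degree \<open>i\<close> stands for \<open>b \<otimes> b'\<close> with
  \<open>b\<close> in degree \<open>p\<close> and \<open>b'\<close> in degree \<open>i - p\<close>, and the differential is
  \<open>b \<otimes> b' \<mapsto> d b \<otimes> b' + (-1)\<^sup>p b \<otimes> d b'\<close>.
\<close>

definition tensor_complex ::
  "('x, 'k::field, 'b) graded_complex \<Rightarrow> ('y, 'k, 'c) graded_complex \<Rightarrow>
    ('x + 'y, 'k, nat \<times> 'b \<times> 'c) graded_complex" where
  "tensor_complex F G =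
    \<lparr>basis = (\<lambda>i. {(p, b, b'). p \<le> i \<and> b \<in> basis F p \<and> b' \<in> basis G (i - p)}),
     shift = (\<lambda>i (p, b, b'). shift F p b + shift G (i - p) b'),
     diff = (\<lambda>i (q, a, a') (p, b, b').
       (if p = Suc q \<and> a' = b' then rename Inl (diff F p a b) else 0) +
       (if p = q \<and> a = b then (- 1) ^ p * rename Inr (diff G (i - p) a' b') else 0))\<rparr>"


section \<open>The inequalities of the multiplicity conjecture\<close>

definition lower_bound_inequality ::
  "'x set \<Rightarrow> ('x, 'k::field) mpoly set \<Rightarrow> ('x, 'k, 'b) graded_complex \<Rightarrow> bool" where
  "lower_bound_inequality X I F \<longleftrightarrow>
    ereal (multiplicity X I) \<ge>
      ereal (1 / fact (codim X I)) * ereal_of_enat (\<Prod>i=1..codim X I. min_shift F i)"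

definition upper_bound_inequality ::
  "'x set \<Rightarrow> ('x, 'k::field) mpoly set \<Rightarrow> ('x, 'k, 'b) graded_complex \<Rightarrow> bool" where
  "upper_bound_inequality X I F \<longleftrightarrow>
    ereal (multiplicity X I) \<le>
      ereal (1 / fact (codim X I)) * ereal_of_enat (\<Prod>i=1..codim X I. max_shift F i)"

end

theory Submission
  imports Defs "HOL-Computational_Algebra.Primes" "HOL-Computational_Algebra.Polynomial_FPS"
begin

text \<open>
  Write the Hilbert series of a proper homogeneous ideal \<open>I\<close> as \<open>Q / (1 - X)\<^sup>d\<close> with \<open>Q(1) \<noteq> 0\<close>. Then
  \<open>d\<close> is the Krull dimension of \<open>S/I\<close> and \<open>Q(1)\<close> is its multiplicity. Since Hilbert series multiply
  under tensor products, codimensions add and multiplicities multiply.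

  For the Krull dimension, an ideal that is maximal among the homogeneous ideals with a pole of order at
  least \<open>n\<close> is prime, and adjoining a variable outside it lowers the order by exactly one; this gives a
  chain of length \<open>d\<close>. Conversely, the affine Hilbert function of the first prime in a chain of length
  \<open>r\<close> grows at least like \<open>t\<^sup>r\<close>.

  What remains is an inequality between shifts. With \<open>L p q = (p + q choose p) * (\<Prod>i=1..p. m i) * (\<Prod>j=1..q. m' j)\<close>,
  Pascal's rule reads \<open>L p q = L (p - 1) q * m p + L p (q - 1) * m' q\<close>, and by induction \<open>L p q\<close> lies on the
  required side of the product of the first \<open>p + q\<close> extremal shifts of the tensor product. In the upper
  bound the \<open>i\<close>-th modules with \<open>1 \<le> i \<le> c\<close> are nonzero because the multiplicity is positive.
\<close>

text \<open>Krull dimension quantifies over all primes, while a Hilbert series exists only for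
  homogeneous ideals. Bounding it from below needs just one chain, and a homogeneous one is built.
  Bounding it from above must cope with arbitrary primes, whose graded parts carry too little
  information, so there polynomials are filtered by degree. The ascending chain condition, obtained
  from Dickson's lemma, serves twice: for the rationality of the Hilbert series and for the maximal
  ideals that turn out to be prime.

  Codimension is a difference of two dimensions. Both are read off as pole orders, that of the ring
  from its zero ideal, so additivity of pole orders settles both.

  The two bounds meet a zero module differently: its largest shift is \<open>0\<close>, its smallest
  is \<open>\<infinity>\<close>. For the lower bound, positivity of the shifts keeps an infinite
  factor from being multiplied by \<open>0\<close>, and an infinite product cannot lie below a real
  multiplicity; so the hypothesis itself makes the relevant smallest shifts finite.\<close>

section \<open>Linear algebra: comparing dimensions of subspaces\<close>

context vector_space
begin

text \<open>\<open>dim\<close> is the cardinality of a basis and hence \<open>0\<close> in infinite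
  dimension, so monotonicity depends on a finite spanning set.\<close>

lemma dim_mono_finite:
  assumes "A \<subseteq> V" and "V \<subseteq> span T" and "finite T"
  shows "dim A \<le> dim V"
proof -
  obtain B where B: "B \<subseteq> V" "independent B" "V \<subseteq> span B" "card B = dim V"
    using basis_exists by blast
  have "finite B"
    using independent_span_bound[OF assms(3) B(2)] B(1) assms(2) by blast
  then show ?thesis
    using dim_le_card[of A B] B assms(1) by auto
qed

text \<open>Rank-nullity for the map that \<open>\<phi>\<close> induces from \<open>V\<close> to the
  quotient by \<open>J\<close>. A basis of its kernel is extended to a basis of \<open>V\<close>;
  the images of the added vectors together with a basis of \<open>J\<close> form a basis of
  \<open>J + \<phi>(V)\<close>. Working inside the ambient space avoids quotient spaces.\<close>

lemma dim_sum_image_vimage: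
  assumes V: "subspace V" and J: "subspace J"
    and lin: "Vector_Spaces.linear scale scale \<phi>"
    and fV: "V \<subseteq> span T" "finite T" and fJ: "J \<subseteq> span T'" "finite T'"
  shows "dim {j + \<phi> v |j v. j \<in> J \<and> v \<in> V} + dim {v \<in> V. \<phi> v \<in> J} = dim J + dim V"
proof -
  interpret phi: Vector_Spaces.linear scale scale \<phi> by (rule lin)
  define K where "K = {v \<in> V. \<phi> v \<in> J}"
  obtain B where B: "B \<subseteq> K" "independent B" "K \<subseteq> span B" "card B = dim K"
    using basis_exists by blast
  have "B \<subseteq> V" using B(1) K_def by auto
  then obtain E where E: "B \<subseteq> E" "E \<subseteq> V" "independent E" "V \<subseteq> span E"
    using maximal_independent_subset_extend[OF _ B(2), of V] by blast
  have finE: "finite E"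
    using independent_span_bound[OF fV(2) E(3)] E(2) fV(1) by blast
  have cardE: "card E = dim V" using basis_card_eq_dim E by blast
  obtain BJ where BJ: "BJ \<subseteq> J" "independent BJ" "J \<subseteq> span BJ" "card BJ = dim J"
    using basis_exists by blast
  have finBJ: "finite BJ"
    using independent_span_bound[OF fJ(2) BJ(2)] BJ(1) fJ(1) by blast
  \<comment> \<open>Adding one vector at a time yields independence, injectivity and disjointness
    together, and the last two are what the later count of elements needs. If
    \<open>\<phi> d\<close> depended on the earlier vectors, then \<open>d - w\<close> would lie in
    the kernel for some \<open>w\<close> in the span of \<open>D\<close>, contradicting the
    independence of \<open>E\<close>.\<close>
  have *: "independent (BJ \<union> \<phi> ` D) \<and> inj_on \<phi> D \<and> BJ \<inter> \<phi> ` D = {}" if "finite D" "D \<subseteq> E - B" for D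
    using that
  proof (induction D rule: finite_induct)
    case empty
    then show ?case using BJ(2) by simp
  next
    case (insert d D)
    have "\<phi> d \<notin> span (BJ \<union> \<phi> ` D)"
    proof
      assume "\<phi> d \<in> span (BJ \<union> \<phi> ` D)"
      then obtain j y where jy: "\<phi> d = j + y" "j \<in> span BJ" "y \<in> span (\<phi> ` D)"
        unfolding span_Un by auto
      have jJ: "j \<in> J" using jy(2) BJ(1) J span_minimal by blast
      obtain w where w: "w \<in> span D" "y = \<phi> w"
        using jy(3) phi.span_image by auto
      have "w \<in> V" using w(1) insert.prems E(2) V span_minimal[of D V] by blast
      moreover have "d \<in> V" using insert.prems E(2) by blast
      moreover have "\<phi> (d - w) = j" using jy(1) w(2) phi.diff by simp
      ultimately have "d - w \<in> K" using jJ V subspace_diff unfolding K_def by simp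
      then have "d - w \<in> span B" using B(3) by auto
      then have "(d - w) + w \<in> span (B \<union> D)"
        using w(1) span_mono[of B "B \<union> D"] span_mono[of D "B \<union> D"] by (intro span_add) auto
      then have "d \<in> span (B \<union> D)" by simp
      moreover have "B \<union> D \<subseteq> E - {d}" using insert E(1) by auto
      ultimately have "d \<in> span (E - {d})" using span_mono by blast
      then show False using E(3) insert.prems unfolding dependent_def by blast
    qed
    note nsp = this
    have IH: "independent (BJ \<union> \<phi> ` D)" "inj_on \<phi> D" "BJ \<inter> \<phi> ` D = {}"
      using insert.IH insert.prems by simp_all
    have nin: "\<phi> d \<notin> BJ \<union> \<phi> ` D"
      using nsp by (rule contrapos_nn) (rule span_base)
    have "independent (insert (\<phi> d) (BJ \<union> \<phi> ` D))"
      using nsp IH(1) by (rule independent_insertI)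
    then show ?case
      using IH nin insert.hyps(2) by simp
  qed
  have ind: "independent (BJ \<union> \<phi> ` (E - B))" "inj_on \<phi> (E - B)" "BJ \<inter> \<phi> ` (E - B) = {}"
    using *[of "E - B"] finE by auto
  define U where "U = {j + \<phi> v |j v. j \<in> J \<and> v \<in> V}"
  have "BJ \<union> \<phi> ` (E - B) \<subseteq> U"
  proof -
    have "j \<in> U" if "j \<in> BJ" for j
      unfolding U_def using that BJ(1) subspace_0[OF V] phi.zero
      by (intro CollectI exI[of _ j] exI[of _ 0]) auto
    moreover have "\<phi> e \<in> U" if "e \<in> E" for e
      unfolding U_def using that E(2) subspace_0[OF J]
      by (intro CollectI exI[of _ 0] exI[of _ e]) auto
    ultimately show ?thesis by auto
  qed
  moreover have "U \<subseteq> span (BJ \<union> \<phi> ` (E - B))"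
  proof
    fix u assume "u \<in> U"
    then obtain j v where u: "u = j + \<phi> v" "j \<in> J" "v \<in> V" unfolding U_def by auto
    have "v \<in> span (B \<union> (E - B))" using u(3) E by (auto simp: Un_absorb1)
    then obtain b c where v: "v = b + c" "b \<in> span B" "c \<in> span (E - B)"
      unfolding span_Un by auto
    have sK: "subspace K" unfolding K_def
      using V J by (auto simp: subspace_def phi.add phi.scale phi.zero)
    have "b \<in> K" using v(2) B(1) span_minimal[OF B(1) sK] by auto
    then have "j + \<phi> b \<in> span BJ" using u(2) BJ(3) subspace_add[OF J] unfolding K_def by auto
    moreover have "\<phi> c \<in> span (\<phi> ` (E - B))" using v(3) phi.span_image by auto
    ultimately have "(j + \<phi> b) + \<phi> c \<in> span (BJ \<union> \<phi> ` (E - B))"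
      using span_mono[of BJ "BJ \<union> \<phi> ` (E - B)"] span_mono[of "\<phi> ` (E - B)" "BJ \<union> \<phi> ` (E - B)"]
      by (intro span_add[of "j + \<phi> b"]) auto
    then show "u \<in> span (BJ \<union> \<phi> ` (E - B))"
      using u v by (simp add: phi.add add.assoc)
  qed
  ultimately have "dim U = card (BJ \<union> \<phi> ` (E - B))"
    using dim_unique[OF _ _ ind(1)] by blast
  also have "\<dots> = card BJ + card (E - B)"
    using ind finBJ finE by (subst card_Un_disjoint) (auto simp: card_image)
  also have "card (E - B) = card E - card B"
    using finE E(1) finite_subset by (intro card_Diff_subset) auto
  finally have "dim U = dim J + (dim V - dim K)" using BJ(4) cardE B(4) by simp
  moreover have "dim K \<le> dim V" using B(4) cardE E(1) finE card_mono by metis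
  ultimately show ?thesis unfolding U_def K_def by simp
qed

end

section \<open>Polynomials as vectors\<close>

lemma linear_scaleI:
  assumes "\<And>x y. \<phi> (x + y) = \<phi> x + \<phi> y" and "\<And>c x. \<phi> (scale c x) = scale c (\<phi> x)"
  shows "Vector_Spaces.linear scale scale \<phi>"
  using assms by (simp add: Vector_Spaces.linear_iff mpoly_vs.vector_space_axioms)

lemma mult_scale_right: "(a :: ('x, 'k::field) mpoly) * scale c f = scale c (a * f)"
  by (simp add: scale_def ac_simps)

lemma mult_scale_left: "scale c f * (a :: ('x, 'k::field) mpoly) = scale c (f * a)"
  by (simp add: scale_def ac_simps)

lemma lookup_scale: "Poly_Mapping.lookup (scale c f) m = c * Poly_Mapping.lookup f m"
proof -
  have "scale c f = Poly_Mapping.map ((*) c) f"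
    by (simp add: scale_def mult_map_scale_conv_mult)
  then show ?thesis by (simp add: Poly_Mapping.map.rep_eq when_def)
qed

lemma linear_mult: "Vector_Spaces.linear scale scale (\<lambda>f :: ('x, 'k::field) mpoly. a * f)"
  by (rule linear_scaleI) (simp_all add: algebra_simps mult_scale_right)

lemma sum_monomials: "(\<Sum>m\<in>Poly_Mapping.keys f. Poly_Mapping.single m (Poly_Mapping.lookup f m)) = f"
  by (rule poly_mapping_eqI)
    (simp add: lookup_sum lookup_single when_def sum.delta' in_keys_iff sum.delta)

lemma scale_single: "scale c (Poly_Mapping.single m d) = Poly_Mapping.single m (c * d)"
  by (simp add: scale_def mult_single)

section \<open>Monomials and degrees\<close>

lemma mon_deg_sum: "finite A \<Longrightarrow> Poly_Mapping.keys m \<subseteq> A \<Longrightarrow> mon_deg m = (\<Sum>x\<in>A. Poly_Mapping.lookup m x)"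
  unfolding mon_deg_def by (rule sum.mono_neutral_left) (auto simp: in_keys_iff)

lemma mon_deg_add: "mon_deg (m + n) = mon_deg m + mon_deg n"
proof -
  let ?A = "Poly_Mapping.keys m \<union> Poly_Mapping.keys n"
  have "mon_deg (m + n) = (\<Sum>x\<in>?A. Poly_Mapping.lookup (m + n) x)"
    using keys_add[of m n] by (intro mon_deg_sum) auto
  also have "\<dots> = (\<Sum>x\<in>?A. Poly_Mapping.lookup m x) + (\<Sum>x\<in>?A. Poly_Mapping.lookup n x)"
    by (simp add: lookup_add sum.distrib)
  also have "\<dots> = mon_deg m + mon_deg n"
    using mon_deg_sum[of ?A m] mon_deg_sum[of ?A n] by simp
  finally show ?thesis .
qed

lemma mon_deg_zero [simp]: "mon_deg 0 = 0"
  by (simp add: mon_deg_def)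

lemma mon_deg_single [simp]: "mon_deg (Poly_Mapping.single x n) = n"
  by (simp add: mon_deg_def)

lemma keys_add_nat: "Poly_Mapping.keys (m + n :: 'x \<Rightarrow>\<^sub>0 nat) = Poly_Mapping.keys m \<union> Poly_Mapping.keys n"
  by (auto simp: in_keys_iff lookup_add)

definition monomials_le :: "'x set \<Rightarrow> nat \<Rightarrow> ('x \<Rightarrow>\<^sub>0 nat) set" where
  "monomials_le X t = {m. Poly_Mapping.keys m \<subseteq> X \<and> mon_deg m \<le> t}"

definition monomials :: "'x set \<Rightarrow> nat \<Rightarrow> ('x \<Rightarrow>\<^sub>0 nat) set" where
  "monomials X t = {m. Poly_Mapping.keys m \<subseteq> X \<and> mon_deg m = t}"

lemma lookup_le_mon_deg: "Poly_Mapping.lookup m x \<le> mon_deg m"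
proof (cases "x \<in> Poly_Mapping.keys m")
  case True
  then show ?thesis unfolding mon_deg_def by (intro member_le_sum) auto
qed (simp add: in_keys_iff)

lemma finite_monomials_le:
  assumes "finite X"
  shows "finite (monomials_le X t)"
proof (rule finite_imageD)
  let ?F = "PiE X (\<lambda>_. {..t})"
  show "finite ((\<lambda>m. restrict (Poly_Mapping.lookup m) X) ` monomials_le X t)"
  proof (rule finite_subset)
    show "(\<lambda>m. restrict (Poly_Mapping.lookup m) X) ` monomials_le X t \<subseteq> ?F"
      using lookup_le_mon_deg le_trans by (fastforce simp: monomials_le_def)
  qed (use assms in \<open>simp add: finite_PiE\<close>)
  show "inj_on (\<lambda>m. restrict (Poly_Mapping.lookup m) X) (monomials_le X t)"
  proof (rule inj_onI, rule poly_mapping_eqI)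
    fix m n x
    assume mn: "m \<in> monomials_le X t" "n \<in> monomials_le X t"
      "restrict (Poly_Mapping.lookup m) X = restrict (Poly_Mapping.lookup n) X"
    show "Poly_Mapping.lookup m x = Poly_Mapping.lookup n x"
    proof (cases "x \<in> X")
      case True
      then show ?thesis using fun_cong[OF mn(3), of x] by simp
    next
      case False
      then have "x \<notin> Poly_Mapping.keys m" "x \<notin> Poly_Mapping.keys n"
        using mn by (auto simp: monomials_le_def)
      then show ?thesis by (simp add: in_keys_iff)
    qed
  qed
qed

lemma finite_monomials: "finite X \<Longrightarrow> finite (monomials X t)"
  by (rule finite_subset[OF _ finite_monomials_le[of X t]]) (auto simp: monomials_def monomials_le_def)

section \<open>The polynomial ring\<close>

abbreviation polys :: "'x set \<Rightarrow> ('x, 'k::field) mpoly set" where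
  "polys X \<equiv> carrier (poly_ring X)"

lemma polys_def: "polys X = {f. \<forall>m\<in>Poly_Mapping.keys f. Poly_Mapping.keys m \<subseteq> X}"
  by (simp add: poly_ring_def)

lemma poly_ring_simps [simp]:
  "monoid.mult (poly_ring X) = (*)" "one (poly_ring X) = 1" "zero (poly_ring X) = 0"
  "add (poly_ring X) = (+)"
  by (simp_all add: poly_ring_def)

lemma polys_0 [simp]: "0 \<in> polys X"
  and polys_1 [simp]: "1 \<in> polys X"
  by (auto simp: polys_def)

lemma polys_add [simp]: "f \<in> polys X \<Longrightarrow> g \<in> polys X \<Longrightarrow> f + g \<in> polys X"
  using keys_add by (fastforce simp: polys_def)

lemma polys_uminus [simp]: "f \<in> polys X \<Longrightarrow> - f \<in> polys X"
  by (auto simp: polys_def in_keys_iff)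

lemma polys_diff [simp]: "f \<in> polys X \<Longrightarrow> g \<in> polys X \<Longrightarrow> f - g \<in> polys X"
  using polys_add[of f X "- g"] by simp

lemma polys_mult [simp]: "f \<in> polys X \<Longrightarrow> g \<in> polys X \<Longrightarrow> f * g \<in> polys X"
  using keys_mult[of f g] by (fastforce simp: polys_def keys_add_nat)

lemma polys_single [simp]: "Poly_Mapping.keys m \<subseteq> X \<Longrightarrow> Poly_Mapping.single m c \<in> polys X"
  by (auto simp: polys_def)

lemma polys_scale [simp]: "f \<in> polys X \<Longrightarrow> scale c f \<in> polys X"
  by (simp add: scale_def)

lemma cring_poly_ring: "cring (poly_ring X :: ('x, 'k::field) mpoly ring)"
proof (rule cringI)
  show "abelian_group (poly_ring X :: ('x, 'k) mpoly ring)"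
  proof (rule abelian_groupI)
    fix f :: "('x, 'k) mpoly" assume "f \<in> polys X"
    then show "\<exists>g\<in>polys X. g \<oplus>\<^bsub>poly_ring X\<^esub> f = \<zero>\<^bsub>poly_ring X\<^esub>"
      by (intro bexI[of _ "- f"]) auto
  qed (auto simp: algebra_simps)
  show "comm_monoid (poly_ring X :: ('x, 'k) mpoly ring)"
    by (rule comm_monoidI) (auto simp: algebra_simps)
qed (auto simp: algebra_simps)

lemma a_inv_poly_ring:
  assumes "f \<in> polys X"
  shows "a_inv (poly_ring X) f = - f"
proof -
  interpret cring "poly_ring X" by (rule cring_poly_ring)
  show ?thesis using assms by (intro sum_zero_eq_neg[symmetric]) auto
qed

lemma ideal_poly_ringI:
  assumes "I \<subseteq> polys X" "0 \<in> I" "\<And>f g. f \<in> I \<Longrightarrow> g \<in> I \<Longrightarrow> f + g \<in> I"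
    "\<And>f g. f \<in> I \<Longrightarrow> g \<in> polys X \<Longrightarrow> g * f \<in> I"
  shows "ideal I (poly_ring X)"
proof -
  interpret cring "poly_ring X" by (rule cring_poly_ring)
  show ?thesis
  proof (rule idealI)
    show "subgroup I (add_monoid (poly_ring X))"
    proof (rule add.subgroupI)
      fix f assume f: "f \<in> I"
      have "(- 1) * f \<in> I" using assms(4)[OF f, of "- 1"] by simp
      then show "a_inv (poly_ring X) f \<in> I"
        using a_inv_poly_ring[of f X] f assms(1) by auto
    qed (use assms(1-3) in auto)
  qed (use assms ring_axioms in \<open>auto simp: mult.commute\<close>)
qed

lemma
  assumes "ideal I (poly_ring X)"
  shows ideal_subset_polys: "I \<subseteq> polys X"
    and ideal_0: "0 \<in> I"
    and ideal_add: "f \<in> I \<Longrightarrow> g \<in> I \<Longrightarrow> f + g \<in> I"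
    and ideal_mult: "f \<in> I \<Longrightarrow> g \<in> polys X \<Longrightarrow> g * f \<in> I"
proof -
  interpret ideal I "poly_ring X" by (rule assms)
  show "I \<subseteq> polys X" using a_subset by simp
  show "0 \<in> I" using additive_subgroup.zero_closed[OF ideal.axioms(1)[OF assms]] by simp
  show "f \<in> I \<Longrightarrow> g \<in> I \<Longrightarrow> f + g \<in> I" using additive_subgroup.a_closed[OF ideal.axioms(1)[OF assms], of f g] by simp
  show "f \<in> I \<Longrightarrow> g \<in> polys X \<Longrightarrow> g * f \<in> I" using I_l_closed[of f g] by simp
qed

lemma ideal_mult_right: "ideal I (poly_ring X) \<Longrightarrow> f \<in> I \<Longrightarrow> g \<in> polys X \<Longrightarrow> f * g \<in> I"
  using ideal_mult[of I X f g] by (simp add: mult.commute)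

lemma ideal_uminus: "ideal I (poly_ring X) \<Longrightarrow> f \<in> I \<Longrightarrow> - f \<in> I"
  using ideal_mult[of I X f "- 1"] by simp

lemma ideal_diff: "ideal I (poly_ring X) \<Longrightarrow> f \<in> I \<Longrightarrow> g \<in> I \<Longrightarrow> f - g \<in> I"
  using ideal_add[of I X f "- g"] ideal_uminus[of I X g] by simp

lemma ideal_scale: "ideal I (poly_ring X) \<Longrightarrow> f \<in> I \<Longrightarrow> scale c f \<in> I"
  unfolding scale_def by (rule ideal_mult) auto

lemma ideal_sum: "ideal I (poly_ring X) \<Longrightarrow> (\<And>a. a \<in> A \<Longrightarrow> f a \<in> I) \<Longrightarrow> sum f A \<in> I"
  by (induction A rule: infinite_finite_induct) (auto simp: ideal_0 ideal_add)

lemma subspace_ideal: "ideal I (poly_ring X) \<Longrightarrow> mpoly_vs.subspace I"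
  by (auto simp: mpoly_vs.subspace_def ideal_0 ideal_add ideal_scale)

lemma ideal_eq_polys_iff: "ideal I (poly_ring X) \<Longrightarrow> I = polys X \<longleftrightarrow> 1 \<in> I"
  using ideal_mult[of I X 1] ideal_subset_polys[of I X] by auto

lemma subspace_polys: "mpoly_vs.subspace (polys X)"
  by (auto simp: mpoly_vs.subspace_def)

section \<open>Homogeneous components\<close>

definition hcomp :: "nat \<Rightarrow> ('x, 'k::field) mpoly \<Rightarrow> ('x, 'k) mpoly" where
  "hcomp t f = Poly_Mapping.mapp (\<lambda>m c. c when mon_deg m = t) f"

lemma lookup_hcomp: "Poly_Mapping.lookup (hcomp t f) m = (Poly_Mapping.lookup f m when mon_deg m = t)"
  by (auto simp: hcomp_def lookup_mapp when_def in_keys_iff)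

lemma keys_hcomp: "Poly_Mapping.keys (hcomp t f) = {m \<in> Poly_Mapping.keys f. mon_deg m = t}"
  by (auto simp: in_keys_iff lookup_hcomp)

lemma hcomp_add: "hcomp t (f + g) = hcomp t f + hcomp t g"
  by (rule poly_mapping_eqI) (simp add: lookup_hcomp lookup_add when_def)

lemma hcomp_scale: "hcomp t (scale c f) = scale c (hcomp t f)"
  by (rule poly_mapping_eqI) (simp add: lookup_hcomp lookup_scale when_def)

lemma linear_hcomp: "Vector_Spaces.linear scale scale (hcomp t)"
  by (rule linear_scaleI) (simp_all add: hcomp_add hcomp_scale)

lemma hcomp_0 [simp]: "hcomp t 0 = 0"
  by (rule poly_mapping_eqI) (simp add: lookup_hcomp)

lemma hcomp_sum: "hcomp t (sum f A) = (\<Sum>a\<in>A. hcomp t (f a))"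
  by (induction A rule: infinite_finite_induct) (auto simp: hcomp_add)

lemma homogeneous_0 [simp]: "homogeneous t 0"
  by (simp add: homogeneous_def)

lemma homogeneous_hcomp: "homogeneous t (hcomp t f)"
  by (simp add: homogeneous_def keys_hcomp)

lemma homogeneous_mult:
  "homogeneous s f \<Longrightarrow> homogeneous t g \<Longrightarrow> homogeneous (s + t) (f * g)"
  using keys_mult[of f g] by (fastforce simp: homogeneous_def mon_deg_add)

lemma hcomp_homogeneous: "homogeneous s f \<Longrightarrow> hcomp t f = (if s = t then f else 0)"
  by (intro poly_mapping_eqI) (auto simp: homogeneous_def lookup_hcomp when_def in_keys_iff)

lemma hcomp_polys [simp]: "f \<in> polys X \<Longrightarrow> hcomp t f \<in> polys X"
  by (auto simp: polys_def keys_hcomp)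

definition deg_le :: "nat \<Rightarrow> ('x, 'k::field) mpoly \<Rightarrow> bool" where
  "deg_le t f \<longleftrightarrow> (\<forall>m\<in>Poly_Mapping.keys f. mon_deg m \<le> t)"

lemma ex_deg_le: "\<exists>t. deg_le t f"
  by (rule exI[of _ "\<Sum>m\<in>Poly_Mapping.keys f. mon_deg m"])
    (auto simp: deg_le_def intro: member_le_sum)

lemma deg_le_mono: "deg_le s f \<Longrightarrow> s \<le> t \<Longrightarrow> deg_le t f"
  by (auto simp: deg_le_def)

lemma deg_le_0 [simp]: "deg_le t 0"
  by (simp add: deg_le_def)

lemma deg_le_add: "deg_le t f \<Longrightarrow> deg_le t g \<Longrightarrow> deg_le t (f + g)"
  using keys_add by (fastforce simp: deg_le_def)

lemma deg_le_mult: "deg_le s f \<Longrightarrow> deg_le t g \<Longrightarrow> deg_le (s + t) (f * g)"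
  using keys_mult[of f g] by (fastforce simp: deg_le_def mon_deg_add add_mono)

lemma deg_le_scale: "deg_le t f \<Longrightarrow> deg_le t (scale c f)"
  by (auto simp: deg_le_def in_keys_iff lookup_scale)

lemma sum_hcomp: "deg_le n f \<Longrightarrow> (\<Sum>i\<le>n. hcomp i f) = f"
  by (rule poly_mapping_eqI)
    (auto simp: lookup_sum lookup_hcomp when_def deg_le_def in_keys_iff sum.delta)

lemma hcomp_mult: "hcomp n (f * g) = (\<Sum>i\<le>n. hcomp i f * hcomp (n - i) g)"
proof -
  obtain s t where "deg_le s f" "deg_le t g" using ex_deg_le by metis
  then obtain N where N: "deg_le N f" "deg_le N g" "n \<le> N"
    using deg_le_mono[of s f "max n (max s t)"] deg_le_mono[of t g "max n (max s t)"] by force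
  have hom: "hcomp n (hcomp i f * hcomp j g) = (if i + j = n then hcomp i f * hcomp j g else 0)" for i j
    by (rule hcomp_homogeneous[OF homogeneous_mult[OF homogeneous_hcomp homogeneous_hcomp]])
  have "hcomp n (f * g) = hcomp n ((\<Sum>i\<le>N. hcomp i f) * (\<Sum>j\<le>N. hcomp j g))"
    using N by (simp add: sum_hcomp)
  also have "\<dots> = (\<Sum>i\<le>N. \<Sum>j\<le>N. if i + j = n then hcomp i f * hcomp j g else 0)"
    by (simp add: sum_product hcomp_sum hom)
  also have "\<dots> = (\<Sum>i\<le>N. if i \<le> n then hcomp i f * hcomp (n - i) g else 0)"
  proof (rule sum.cong[OF refl])
    fix i
    have "(\<Sum>j\<le>N. if i + j = n then hcomp i f * hcomp j g else 0)
      = (\<Sum>j\<le>N. if j = n - i then (if i \<le> n then hcomp i f * hcomp (n - i) g else 0) else 0)"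
      by (rule sum.cong) auto
    also have "\<dots> = (if i \<le> n then hcomp i f * hcomp (n - i) g else 0)"
      using N(3) by (subst sum.delta) auto
    finally show "(\<Sum>j\<le>N. if i + j = n then hcomp i f * hcomp j g else 0)
      = (if i \<le> n then hcomp i f * hcomp (n - i) g else 0)" .
  qed
  also have "\<dots> = (\<Sum>i\<le>n. hcomp i f * hcomp (n - i) g)"
    using N(3) by (intro sum.mono_neutral_cong_right) auto
  finally show ?thesis .
qed

lemma hcomp_homogeneous_mult:
  assumes "homogeneous e a"
  shows "hcomp t (a * g) = (if e \<le> t then a * hcomp (t - e) g else 0)"
proof -
  have "hcomp t (a * g) = (\<Sum>i\<le>t. if e = i then a * hcomp (t - i) g else 0)"
    unfolding hcomp_mult using assms by (intro sum.cong) (auto simp: hcomp_homogeneous)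
  then show ?thesis by (auto simp: sum.delta)
qed

text \<open>The intrinsic form of homogeneity. It passes to \<open>colon\<close>,
  \<open>adjoin\<close> and \<open>tensor_ideal\<close> without exhibiting homogeneous
  generators.\<close>

definition hom_ideal :: "'x set \<Rightarrow> ('x, 'k::field) mpoly set \<Rightarrow> bool" where
  "hom_ideal X I \<longleftrightarrow> ideal I (poly_ring X) \<and> (\<forall>f\<in>I. \<forall>t. hcomp t f \<in> I)"

lemma hom_ideal_zero: "hom_ideal X {0}"
  by (auto simp: hom_ideal_def intro: ideal_poly_ringI)

text \<open>The polynomials all of whose components lie in \<open>I\<close> form an ideal, by the
  Cauchy product for components, and this ideal contains the homogeneous generators.\<close>

lemma hom_ideal_if_homogeneous_ideal:
  fixes I :: "('x, 'k::field) mpoly set"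
  assumes "homogeneous_ideal X I"
  shows "hom_ideal X I"
proof -
  interpret cring "poly_ring X :: ('x, 'k) mpoly ring" by (rule cring_poly_ring)
  obtain A where A: "A \<subseteq> polys X" "\<And>a. a \<in> A \<Longrightarrow> \<exists>t. homogeneous t a" "I = genideal (poly_ring X) A"
    using assms unfolding homogeneous_ideal_def by blast
  have I: "ideal I (poly_ring X)" unfolding A(3) using A(1) by (rule genideal_ideal)
  define L where "L = {f \<in> polys X. \<forall>t. hcomp t f \<in> I}"
  have "ideal L (poly_ring X)"
  proof (rule ideal_poly_ringI)
    fix f g :: "('x, 'k) mpoly" assume f: "f \<in> L" and g: "g \<in> polys X"
    have "hcomp t (g * f) \<in> I" for t
      unfolding hcomp_mult using f g by (intro ideal_sum[OF I] ideal_mult[OF I]) (auto simp: L_def)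
    then show "g * f \<in> L" using f g by (simp add: L_def)
  qed (auto simp: L_def hcomp_add ideal_0[OF I] intro: ideal_add[OF I])
  moreover have "A \<subseteq> L"
  proof
    fix a assume a: "a \<in> A"
    then obtain s where "homogeneous s a" using A(2) by blast
    moreover have "a \<in> I" unfolding A(3) using a genideal_self[OF A(1)] by auto
    ultimately have "hcomp t a \<in> I" for t
      using hcomp_homogeneous[of s a t] ideal_0[OF I] by auto
    then show "a \<in> L" using a A(1) by (auto simp: L_def)
  qed
  ultimately have "I \<subseteq> L" unfolding A(3) by (rule genideal_minimal)
  then show ?thesis using I by (auto simp: hom_ideal_def L_def)
qed

section \<open>Graded parts\<close>

lemma subspace_graded_part: "mpoly_vs.subspace (graded_part X t)"
  unfolding mpoly_vs.subspace_def graded_part_def homogeneous_def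
  by (auto simp: in_keys_iff lookup_add lookup_scale)

lemma inj_on_single_1: "inj_on (\<lambda>m. Poly_Mapping.single m (1 :: 'k::zero_neq_one)) M"
proof (rule inj_onI)
  fix m n assume "Poly_Mapping.single m (1 :: 'k) = Poly_Mapping.single n 1"
  then have "Poly_Mapping.lookup (Poly_Mapping.single m (1 :: 'k)) n = 1" by simp
  then show "m = n" by (simp add: lookup_single when_def split: if_splits)
qed

lemma in_span_monomials:
  assumes "\<And>m. m \<in> Poly_Mapping.keys f \<Longrightarrow> m \<in> M"
  shows "f \<in> mpoly_vs.span ((\<lambda>m. Poly_Mapping.single m 1) ` M)"
proof -
  have "(\<Sum>m\<in>Poly_Mapping.keys f. scale (Poly_Mapping.lookup f m) (Poly_Mapping.single m 1)) \<in>
    mpoly_vs.span ((\<lambda>m. Poly_Mapping.single m 1) ` M)"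
    using assms by (intro mpoly_vs.span_sum mpoly_vs.span_scale mpoly_vs.span_base) auto
  then show ?thesis by (simp add: scale_single sum_monomials)
qed

lemma independent_monomials:
  "mpoly_vs.independent ((\<lambda>m. Poly_Mapping.single m 1 :: ('x, 'k::field) mpoly) ` M)"
proof -
  have "(\<Sum>v\<in>A. scale (u v) v) = 0 \<Longrightarrow> \<forall>v\<in>A. u v = 0"
    if A: "finite A" "A \<subseteq> (\<lambda>m. Poly_Mapping.single m 1 :: ('x, 'k) mpoly) ` M" for A u
  proof
    fix v assume 0: "(\<Sum>v\<in>A. scale (u v) v) = 0" and v: "v \<in> A"
    obtain m where m: "v = Poly_Mapping.single m 1" using v A(2) by auto
    have "Poly_Mapping.lookup w m = (if w = v then 1 else 0)" if w: "w \<in> A" for w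
    proof -
      obtain n where "w = Poly_Mapping.single n 1" using w A(2) by auto
      then show ?thesis using m by (auto simp: lookup_single when_def dest: inj_onD[OF inj_on_single_1[where M = UNIV]])
    qed
    then have "Poly_Mapping.lookup (\<Sum>v\<in>A. scale (u v) v) m = (\<Sum>w\<in>A. if w = v then u v else 0)"
      unfolding lookup_sum lookup_scale
      by (intro sum.cong) auto
    then show "u v = 0" using 0 A v by (simp add: sum.delta)
  qed
  then show ?thesis unfolding mpoly_vs.independent_explicit_finite_subsets by blast
qed

lemma graded_part_span: "graded_part X t \<subseteq> mpoly_vs.span ((\<lambda>m. Poly_Mapping.single m 1) ` monomials X t)"
  by (auto simp: graded_part_def polys_def homogeneous_def monomials_def intro!: in_span_monomials)

lemma dim_graded_part:
  "mpoly_vs.dim (graded_part X t :: ('x, 'k::field) mpoly set) = card (monomials X t)"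
proof (rule mpoly_vs.dim_unique)
  show "(\<lambda>m. Poly_Mapping.single m 1) ` monomials X t \<subseteq> (graded_part X t :: ('x, 'k) mpoly set)"
    by (auto simp: graded_part_def polys_def homogeneous_def monomials_def)
  show "card ((\<lambda>m. Poly_Mapping.single m 1 :: ('x, 'k) mpoly) ` monomials X t) = card (monomials X t)"
    by (rule card_image) (rule inj_on_single_1)
qed (rule graded_part_span independent_monomials)+

definition filtered_part :: "'x set \<Rightarrow> nat \<Rightarrow> ('x, 'k::field) mpoly set" where
  "filtered_part X t = {f \<in> polys X. deg_le t f}"

lemma subspace_filtered_part: "mpoly_vs.subspace (filtered_part X t)"
  by (auto simp: mpoly_vs.subspace_def filtered_part_def deg_le_add deg_le_scale)

lemma filtered_part_span: "filtered_part X t \<subseteq> mpoly_vs.span ((\<lambda>m. Poly_Mapping.single m 1) ` monomials_le X t)"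
  by (auto simp: filtered_part_def polys_def deg_le_def monomials_le_def intro!: in_span_monomials)

section \<open>The ascending chain condition\<close>

text \<open>
  Sending the variables to distinct primes embeds the monomials into the positive integers under
  multiplication. The order of the integers thereby becomes a monomial order.
\<close>

definition mon_code :: "('x \<Rightarrow> nat) \<Rightarrow> ('x \<Rightarrow>\<^sub>0 nat) \<Rightarrow> nat" where
  "mon_code \<pi> m = (\<Prod>x\<in>Poly_Mapping.keys m. \<pi> x ^ Poly_Mapping.lookup m x)"

lemma mon_code_prod:
  "finite A \<Longrightarrow> Poly_Mapping.keys m \<subseteq> A \<Longrightarrow> mon_code \<pi> m = (\<Prod>x\<in>A. \<pi> x ^ Poly_Mapping.lookup m x)"
  unfolding mon_code_def by (rule prod.mono_neutral_left) (auto simp: in_keys_iff)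

lemma mon_code_add: "mon_code \<pi> (m + n) = mon_code \<pi> m * mon_code \<pi> n"
proof -
  let ?A = "Poly_Mapping.keys m \<union> Poly_Mapping.keys n"
  have "mon_code \<pi> (m + n) = (\<Prod>x\<in>?A. \<pi> x ^ Poly_Mapping.lookup (m + n) x)"
    by (rule mon_code_prod) (auto simp: keys_add_nat)
  also have "\<dots> = (\<Prod>x\<in>?A. \<pi> x ^ Poly_Mapping.lookup m x) * (\<Prod>x\<in>?A. \<pi> x ^ Poly_Mapping.lookup n x)"
    by (simp add: lookup_add power_add prod.distrib)
  also have "\<dots> = mon_code \<pi> m * mon_code \<pi> n"
    using mon_code_prod[of ?A m] mon_code_prod[of ?A n] by simp
  finally show ?thesis .
qed

text \<open>Unique factorization: the exponent of \<open>x\<close> is the multiplicity of the prime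
  \<open>\<pi> x\<close> in the code.\<close>

lemma mon_code_inj:
  assumes "finite X" and "inj_on \<pi> X" and "\<And>x. x \<in> X \<Longrightarrow> prime (\<pi> x)"
    and "Poly_Mapping.keys m \<subseteq> X" and "Poly_Mapping.keys n \<subseteq> X" and "mon_code \<pi> m = mon_code \<pi> n"
  shows "m = n"
proof (rule poly_mapping_eqI)
  have mult: "Poly_Mapping.lookup k x = Factorial_Ring.multiplicity (\<pi> x) (mon_code \<pi> k)"
    if k: "Poly_Mapping.keys k \<subseteq> X" and x: "x \<in> X" for k x
  proof -
    have "mon_code \<pi> k = (\<Prod>p\<in>\<pi> ` X. p ^ Poly_Mapping.lookup k (inv_into X \<pi> p))"
      using assms(2) by (simp add: mon_code_prod[OF assms(1) k] prod.reindex)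
    also have "Factorial_Ring.multiplicity (\<pi> x) \<dots> = Poly_Mapping.lookup k x"
      using assms(1-3) x by (subst multiplicity_prod_prime_powers) auto
    finally show ?thesis by simp
  qed
  fix x
  show "Poly_Mapping.lookup m x = Poly_Mapping.lookup n x"
  proof (cases "x \<in> X")
    case True
    then show ?thesis using mult assms by metis
  next
    case False
    then have "x \<notin> Poly_Mapping.keys m" "x \<notin> Poly_Mapping.keys n" using assms by auto
    then show ?thesis by (simp add: in_keys_iff)
  qed
qed

lemma ex_prime_labelling:
  assumes "finite X"
  obtains \<pi> :: "'x \<Rightarrow> nat" where "inj_on \<pi> X" and "\<And>x. x \<in> X \<Longrightarrow> prime (\<pi> x)"
proof -
  obtain B where B: "finite B" "card B = card X" "B \<subseteq> {p :: nat. prime p}"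
    using infinite_arbitrarily_large[OF primes_infinite] by blast
  then obtain \<pi> where "bij_betw \<pi> X B" using assms finite_same_card_bij by metis
  then show thesis using that[of \<pi>] B(3) by (auto simp: bij_betw_def)
qed

lemma lookup_single_mult:
  "Poly_Mapping.lookup (Poly_Mapping.single d c * f) (d + m) = c * Poly_Mapping.lookup (f :: ('x, 'k::field) mpoly) m"
proof -
  have "Poly_Mapping.single d c * f = (\<Sum>n\<in>Poly_Mapping.keys f. Poly_Mapping.single (d + n) (c * Poly_Mapping.lookup f n))"
    by (subst (1) sum_monomials[symmetric]) (simp add: sum_distrib_left mult_single)
  then have "Poly_Mapping.lookup (Poly_Mapping.single d c * f) (d + m)
    = (\<Sum>n\<in>Poly_Mapping.keys f. if n = m then c * Poly_Mapping.lookup f m else 0)"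
    by (auto simp: lookup_sum lookup_single when_def intro!: sum.cong)
  then show ?thesis by (simp add: in_keys_iff sum.delta)
qed

lemma nat_seq_mono_subseq:
  fixes f :: "nat \<Rightarrow> nat"
  shows "\<exists>r :: nat \<Rightarrow> nat. strict_mono r \<and> mono (f \<circ> r)"
proof -
  obtain r :: "nat \<Rightarrow> nat" where r: "strict_mono r" "monoseq (f \<circ> r)"
    using seq_monosub[of f] by (auto simp: o_def)
  show ?thesis
  proof (cases "incseq (f \<circ> r)")
    case True
    then show ?thesis using r by auto
  next
    case False
    then have dec: "decseq (f \<circ> r)" using r(2) by (simp add: monoseq_iff)
    \<comment> \<open>A decreasing sequence of natural numbers is constant from any index at which
      it attains its least value.\<close>
    obtain N where N: "\<And>n. (f \<circ> r) N \<le> (f \<circ> r) n"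
      using ex_has_least_nat[of "\<lambda>_. True" undefined "f \<circ> r"] by auto
    have "(f \<circ> (\<lambda>n. r (N + n))) n = (f \<circ> r) N" for n
      using N[of "N + n"] decseqD[OF dec, of N "N + n"] by simp
    then have "mono (f \<circ> (\<lambda>n. r (N + n)))" by (auto intro: monoI)
    moreover have "strict_mono (\<lambda>n. r (N + n))" using r(1) by (auto simp: strict_mono_def)
    ultimately show ?thesis by blast
  qed
qed

lemma dickson_subseq:
  fixes s :: "nat \<Rightarrow> 'x \<Rightarrow> nat"
  assumes "finite X"
  shows "\<exists>r :: nat \<Rightarrow> nat. strict_mono r \<and> (\<forall>x\<in>X. mono (\<lambda>i. s (r i) x))"
  using assms
proof (induction X rule: finite_induct)
  case empty
  show ?case by (intro exI[of _ id]) (auto simp: strict_mono_def)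
next
  case (insert x X)
  then obtain r :: "nat \<Rightarrow> nat" where r: "strict_mono r" "\<And>y. y \<in> X \<Longrightarrow> mono (\<lambda>i. s (r i) y)" by blast
  obtain q :: "nat \<Rightarrow> nat" where q: "strict_mono q" "mono ((\<lambda>i. s (r i) x) \<circ> q)"
    using nat_seq_mono_subseq by blast
  have "mono (\<lambda>i. s (r (q i)) y)" if "y \<in> X" for y
    using r(2)[OF that] q(1) by (auto simp: mono_def strict_mono_less_eq)
  then show ?case
    using r(1) q by (intro exI[of _ "r \<circ> q"]) (auto simp: strict_mono_def o_def)
qed

text \<open>Dickson's lemma: some monomial of the sequence divides a later one. The first two terms
  of a subsequence that is monotone in every exponent will do.\<close>

lemma dickson:
  fixes s :: "nat \<Rightarrow> 'x \<Rightarrow>\<^sub>0 nat"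
  assumes "finite X" and "\<And>i. Poly_Mapping.keys (s i) \<subseteq> X"
  obtains i j d where "i < j" and "s j = s i + d" and "Poly_Mapping.keys d \<subseteq> X"
proof -
  obtain r :: "nat \<Rightarrow> nat" where r: "strict_mono r" "\<And>x. x \<in> X \<Longrightarrow> mono (\<lambda>i. Poly_Mapping.lookup (s (r i)) x)"
    using dickson_subseq[OF assms(1), of "\<lambda>i. Poly_Mapping.lookup (s i)"] by blast
  let ?i = "r 0" and ?j = "r 1"
  have le: "Poly_Mapping.lookup (s ?i) x \<le> Poly_Mapping.lookup (s ?j) x" for x
  proof (cases "x \<in> X")
    case True
    show ?thesis using monoD[OF r(2)[OF True], of 0 1] by simp
  next
    case False
    then have "x \<notin> Poly_Mapping.keys (s ?i)" using assms(2)[of ?i] by blast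
    then show ?thesis by (simp add: in_keys_iff)
  qed
  have "s ?j = s ?i + (s ?j - s ?i)"
    by (rule poly_mapping_eqI) (use le in \<open>simp add: lookup_add lookup_minus\<close>)
  moreover have "Poly_Mapping.keys (s ?j - s ?i) \<subseteq> X"
    using assms(2)[of ?j] by (auto simp: in_keys_iff lookup_minus)
  moreover have "?i < ?j" using r(1) by (simp add: strict_mono_def)
  ultimately show thesis using that by blast
qed

text \<open>In each \<open>J (Suc i) - J i\<close> take an element whose leading code is least. By
  Dickson's lemma the leading monomial of some \<open>f i\<close> divides that of a later
  \<open>f j\<close>. Cancelling the leading term of \<open>f j\<close> by a multiple of
  \<open>f i\<close> stays outside \<open>J j\<close>, because \<open>f i\<close> lies in
  \<open>J j\<close>, but lowers the leading code. The code is multiplicative, so multiplying by a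
  monomial preserves the order.\<close>

lemma no_ascending_ideal_chain:
  fixes J :: "nat \<Rightarrow> ('x, 'k::field) mpoly set"
  assumes X: "finite X" and J: "\<And>i. ideal (J i) (poly_ring X)" and asc: "\<And>i. J i \<subset> J (Suc i)"
  shows False
proof -
  obtain \<pi> :: "'x \<Rightarrow> nat" where \<pi>: "inj_on \<pi> X" "\<And>x. x \<in> X \<Longrightarrow> prime (\<pi> x)"
    using ex_prime_labelling[OF X] by blast
  define lead where "lead f m \<longleftrightarrow> m \<in> Poly_Mapping.keys f \<and>
    (\<forall>n\<in>Poly_Mapping.keys f. mon_code \<pi> n \<le> mon_code \<pi> m)" for f :: "('x, 'k) mpoly" and m
  have ex_lead: "\<exists>m. lead f m" if "f \<noteq> 0" for f
  proof -
    have "Max (mon_code \<pi> ` Poly_Mapping.keys f) \<in> mon_code \<pi> ` Poly_Mapping.keys f"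
      using that by (intro Max_in) auto
    then obtain m where "m \<in> Poly_Mapping.keys f" "mon_code \<pi> m = Max (mon_code \<pi> ` Poly_Mapping.keys f)"
      by (metis imageE)
    then show ?thesis unfolding lead_def by (intro exI[of _ m]) simp
  qed
  define new where "new i k \<longleftrightarrow> (\<exists>f m. f \<in> J (Suc i) - J i \<and> lead f m \<and> mon_code \<pi> m = k)" for i k
  have "\<exists>k. new i k" for i
  proof -
    obtain f where f: "f \<in> J (Suc i) - J i" using asc by blast
    then have "f \<noteq> 0" using ideal_0[OF J] by auto
    then show ?thesis using f ex_lead unfolding new_def by blast
  qed
  then have least: "new i (LEAST k. new i k)" for i by (rule LeastI_ex)
  then have "\<forall>i. \<exists>f m. f \<in> J (Suc i) - J i \<and> lead f m \<and> mon_code \<pi> m = (LEAST k. new i k)"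
    unfolding new_def by blast
  then obtain f m where fm: "\<And>i. f i \<in> J (Suc i) - J i" "\<And>i. lead (f i) (m i)"
    "\<And>i. mon_code \<pi> (m i) = (LEAST k. new i k)"
    by metis
  have keys: "Poly_Mapping.keys n \<subseteq> X" if "n \<in> Poly_Mapping.keys g" "g \<in> J i" for n g i
    using that ideal_subset_polys[OF J] unfolding polys_def by blast
  have "Poly_Mapping.keys (m i) \<subseteq> X" for i
    using keys[of "m i" "f i" "Suc i"] fm unfolding lead_def by blast
  then obtain i j d where d: "i < j" "m j = m i + d" "Poly_Mapping.keys d \<subseteq> X"
    using dickson[OF X, of m] by blast
  have Jmono: "J a \<subseteq> J b" if "a \<le> b" for a b
    using lift_Suc_mono_le[of J] asc that by blast
  have fij: "f i \<in> J j" using fm(1)[of i] Jmono[of "Suc i" j] d(1) by auto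
  \<comment> \<open>With this coefficient, \<open>h\<close> and \<open>f j\<close> have the same
    coefficient at the leading monomial \<open>m j\<close>.\<close>
  define c where "c = Poly_Mapping.lookup (f j) (m j) / Poly_Mapping.lookup (f i) (m i)"
  define h where "h = Poly_Mapping.single d c * f i"
  have h: "h \<in> J j" unfolding h_def using fij d(3) by (intro ideal_mult[OF J]) auto
  have g1: "f j - h \<in> J (Suc j) - J j"
  proof
    show "f j - h \<in> J (Suc j)" using h Jmono[of j "Suc j"] fm(1)[of j] by (intro ideal_diff[OF J]) auto
    show "f j - h \<notin> J j"
    proof
      assume "f j - h \<in> J j"
      then have "(f j - h) + h \<in> J j" using h by (rule ideal_add[OF J])
      then show False using fm(1)[of j] by simp
    qed
  qed
  then have "f j - h \<noteq> 0" using ideal_0[OF J] by auto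
  then obtain n where n: "lead (f j - h) n" using ex_lead by blast
  have nk: "n \<in> Poly_Mapping.keys (f j - h)" using n unfolding lead_def by blast
  have "Poly_Mapping.lookup (f i) (m i) \<noteq> 0" using fm(2)[of i] by (simp add: lead_def in_keys_iff)
  then have "Poly_Mapping.lookup h (m j) = Poly_Mapping.lookup (f j) (m j)"
    using lookup_single_mult[of d c "f i" "m i"] by (simp add: h_def c_def d(2) add.commute)
  then have "n \<noteq> m j" using nk by (auto simp: in_keys_iff lookup_minus)
  have "mon_code \<pi> n \<le> mon_code \<pi> (m j)"
  proof (cases "n \<in> Poly_Mapping.keys (f j)")
    case True
    then show ?thesis using fm(2)[of j] by (simp add: lead_def)
  next
    case False
    then have "n \<in> Poly_Mapping.keys h" using nk keys_diff[of "f j" h] by (auto simp: in_keys_iff lookup_minus)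
    then obtain l where l: "n = d + l" "l \<in> Poly_Mapping.keys (f i)"
      using keys_mult[of "Poly_Mapping.single d c" "f i"] unfolding h_def by (auto split: if_splits)
    then show ?thesis using fm(2)[of i] d(2) by (simp add: lead_def mon_code_add)
  qed
  moreover have "mon_code \<pi> n \<noteq> mon_code \<pi> (m j)"
    using mon_code_inj[OF X \<pi>] keys[OF nk] g1 \<open>\<And>i. Poly_Mapping.keys (m i) \<subseteq> X\<close> \<open>n \<noteq> m j\<close> by blast
  ultimately have "mon_code \<pi> n < (LEAST k. new j k)" using fm(3)[of j] by simp
  moreover have "new j (mon_code \<pi> n)" unfolding new_def using g1 n by blast
  ultimately show False using not_less_Least by blast
qed

text \<open>Larger ideals come first in this order: induction may assume a claim for all strictly
  larger ideals, and a minimal element of a family is an ideal maximal in it.\<close>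

lemma wf_ideals:
  assumes "finite X"
  shows "wf {(K, J :: ('x, 'k::field) mpoly set). ideal J (poly_ring X) \<and> ideal K (poly_ring X) \<and> J \<subset> K}"
  unfolding wf_iff_no_infinite_down_chain
  using no_ascending_ideal_chain[OF assms] by blast

section \<open>Rational power series with denominator a power of \<open>1 - X\<close>\<close>

abbreviation one_minus_X :: "'a::comm_ring_1 fps" where
  "one_minus_X \<equiv> 1 - fps_X"

lemma one_minus_X_nz: "(one_minus_X :: 'a::comm_ring_1 fps) \<noteq> 0"
proof
  assume "(one_minus_X :: 'a fps) = 0"
  then have "fps_nth (one_minus_X :: 'a fps) 0 = 0" by simp
  then show False by simp
qed

lemma fps_of_poly_one_minus_X: "fps_of_poly [:1, -1:] = (one_minus_X :: 'a::comm_ring_1 fps)"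
  by (simp add: fps_of_poly_pCons)

text \<open>The expansion of \<open>1 / (1 - X) ^ Suc k\<close>.\<close>

definition binom_fps :: "nat \<Rightarrow> real fps" where
  "binom_fps k = Abs_fps (\<lambda>t. real ((t + k) choose k))"

lemma one_minus_X_mult_nth:
  "fps_nth (one_minus_X * h) t = (if t = 0 then fps_nth h 0 else fps_nth h t - fps_nth h (t - 1))"
  for h :: "'a::comm_ring_1 fps"
  by (simp add: left_diff_distrib)

text \<open>Multiplying by \<open>one_minus_X\<close> takes differences of successive coefficients,
  and by Pascal's rule this lowers \<open>k\<close> by one.\<close>

lemma one_minus_X_power_binom_fps: "one_minus_X ^ Suc k * binom_fps k = 1"
proof (induction k)
  case 0
  show ?case by (rule fps_ext) (auto simp: one_minus_X_mult_nth binom_fps_def)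
next
  case (Suc k)
  have "one_minus_X * binom_fps (Suc k) = binom_fps k"
  proof (rule fps_ext)
    fix t show "fps_nth (one_minus_X * binom_fps (Suc k)) t = fps_nth (binom_fps k) t"
      by (cases t) (simp_all add: one_minus_X_mult_nth binom_fps_def)
  qed
  moreover have "one_minus_X ^ Suc (Suc k) * binom_fps (Suc k) =
    one_minus_X ^ Suc k * (one_minus_X * binom_fps (Suc k))"
    by (simp only: power_Suc2 mult.assoc)
  ultimately show ?case using Suc.IH by (simp only:)
qed

text \<open>The binomial coefficient \<open>(t + k) choose k\<close> as a polynomial in
  \<open>t\<close>.\<close>

definition binom_poly :: "nat \<Rightarrow> real poly" where
  "binom_poly k = smult (1 / fact k) (\<Prod>i=1..k. [:real i, 1:])"

lemma poly_binom_poly: "poly (binom_poly k) (real t) = real ((t + k) choose k)"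
proof -
  have "(\<Prod>i=1..k. real i + real t) = pochhammer (real t + 1) k"
    by (simp add: pochhammer_prod atLeast0LessThan prod.atLeast1_atMost_eq algebra_simps)
  also have "\<dots> = fact k * real ((t + k) choose k)"
    by (simp add: binomial_gbinomial gbinomial_pochhammer' algebra_simps)
  finally show ?thesis by (simp add: binom_poly_def poly_prod)
qed

lemma degree_binom_poly: "degree (binom_poly k) = k"
  by (simp add: binom_poly_def degree_prod_eq_sum_degree)

lemma lead_coeff_binom_poly: "coeff (binom_poly k) k = 1 / fact k"
proof -
  have "lead_coeff (binom_poly k) = 1 / fact k"
    by (simp add: binom_poly_def lead_coeff_smult lead_coeff_prod)
  then show ?thesis by (simp only: degree_binom_poly)
qed

text \<open>The series is \<open>Q\<close> times \<open>binom_fps k\<close>, so each coefficient of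
  \<open>Q\<close> contributes a shifted copy of \<open>binom_poly k\<close>, with the right value
  as soon as \<open>t\<close> is at least the degree of \<open>Q\<close>. Every copy has leading
  coefficient \<open>1 / fact k\<close>, so they add up to \<open>poly Q 1 / fact k\<close>. This is
  stated as the coefficient at \<open>k\<close> because it may vanish.\<close>

lemma eventually_poly_if_rational:
  assumes "one_minus_X ^ Suc k * h = fps_of_poly (Q :: real poly)"
  obtains p where "degree p \<le> k" and "coeff p k = poly Q 1 / fact k"
    and "\<forall>\<^sub>F t in sequentially. poly p (real t) = fps_nth h t"
proof -
  have "h = h * (one_minus_X ^ Suc k * binom_fps k)" by (simp only: one_minus_X_power_binom_fps mult_1_right)
  also have "\<dots> = (one_minus_X ^ Suc k * h) * binom_fps k" by (simp only: ac_simps)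
  finally have h: "h = fps_of_poly Q * binom_fps k" by (simp only: assms)
  define S where "S j = pcompose (binom_poly k) [:- real j, 1:]" for j
  define p where "p = (\<Sum>j\<le>degree Q. smult (coeff Q j) (S j))"
  have dS: "degree (S j) = k" for j
    by (simp add: S_def degree_pcompose degree_binom_poly)
  have cS: "coeff (S j) k = 1 / fact k" for j
  proof -
    have "lead_coeff (S j) = lead_coeff (binom_poly k)"
      unfolding S_def by (subst lead_coeff_comp) auto
    then show ?thesis by (simp add: dS degree_binom_poly lead_coeff_binom_poly)
  qed
  have "degree p \<le> k"
    unfolding p_def by (rule degree_sum_le) (use dS degree_smult_le in \<open>auto intro: order_trans\<close>)
  moreover have "coeff p k = poly Q 1 / fact k"
    by (simp add: p_def coeff_sum cS poly_altdef sum_divide_distrib)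
  moreover have "poly p (real t) = fps_nth h t" if t: "t \<ge> degree Q" for t
  proof -
    have "poly p (real t) = (\<Sum>j\<le>degree Q. coeff Q j * fps_nth (binom_fps k) (t - j))"
      unfolding p_def poly_sum
    proof (rule sum.cong[OF refl])
      fix j assume "j \<in> {..degree Q}"
      then have "poly [:- real j, 1:] (real t) = real (t - j)" using t by (simp add: of_nat_diff)
      then have "poly (S j) (real t) = poly (binom_poly k) (real (t - j))"
        by (simp only: S_def poly_pcompose)
      then show "poly (smult (coeff Q j) (S j)) (real t) = coeff Q j * fps_nth (binom_fps k) (t - j)"
        by (simp add: poly_binom_poly binom_fps_def)
    qed
    also have "\<dots> = (\<Sum>j\<le>t. coeff Q j * fps_nth (binom_fps k) (t - j))"
      using t by (intro sum.mono_neutral_left) (auto simp: coeff_eq_0)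
    also have "\<dots> = fps_nth h t"
      by (simp add: h fps_mult_nth atLeast0AtMost)
    finally show ?thesis .
  qed
  then have "\<forall>\<^sub>F t in sequentially. poly p (real t) = fps_nth h t"
    using eventually_sequentially by blast
  ultimately show thesis using that by blast
qed

lemma poly_eq_if_eventually_eq:
  assumes "\<forall>\<^sub>F t in sequentially. poly p (real t) = poly q (real t)"
  shows "p = (q :: real poly)"
proof (rule ccontr)
  assume "p \<noteq> q"
  then have "finite {x. poly (p - q) x = 0}" by (intro poly_roots_finite) auto
  moreover obtain N where N: "\<And>t. t \<ge> N \<Longrightarrow> poly p (real t) = poly q (real t)"
    using assms by (auto simp: eventually_sequentially)
  then have "real ` {N..} \<subseteq> {x. poly (p - q) x = 0}" by auto
  ultimately have "finite (real ` {N..})" by (rule finite_subset[rotated])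
  then have "finite {N..}" by (rule finite_imageD) (auto simp: inj_on_def)
  then show False using infinite_Ici by blast
qed

text \<open>With the least possible exponent, a zero of the numerator at \<open>1\<close> could be
  cancelled as long as the exponent is positive. At exponent \<open>0\<close> nothing is left to
  cancel; there the series is itself a nonzero polynomial, and nonnegative coefficients make its
  value at \<open>1\<close> positive.\<close>

lemma pole_cancel:
  assumes "one_minus_X ^ n * h = fps_of_poly (Q :: real poly)" and "h \<noteq> 0" and "\<And>t. fps_nth h t \<ge> 0"
  obtains d P where "one_minus_X ^ d * h = fps_of_poly P" and "poly P 1 \<noteq> 0"
proof -
  define d where "d = (LEAST n. \<exists>Q. one_minus_X ^ n * h = fps_of_poly Q)"
  have "\<exists>Q. one_minus_X ^ d * h = fps_of_poly Q"
    unfolding d_def by (rule LeastI_ex) (use assms(1) in blast)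
  then obtain P where P: "one_minus_X ^ d * h = fps_of_poly P" by blast
  have "poly P 1 \<noteq> 0"
  proof (cases d)
    case 0
    have c: "coeff P t = fps_nth h t" for t
    proof -
      have "fps_nth h t = fps_nth (fps_of_poly P) t" using P 0 by simp
      then show ?thesis by simp
    qed
    obtain t where t: "fps_nth h t \<noteq> 0" using assms(2) by (auto simp: fps_eq_iff)
    have "t \<le> degree P" using t c le_degree by metis
    then have "coeff P t \<le> (\<Sum>i\<le>degree P. coeff P i)"
      using assms(3) by (intro member_le_sum) (auto simp: c)
    moreover have "coeff P t > 0" using t assms(3)[of t] c by simp
    ultimately show ?thesis by (simp add: poly_altdef)
  next
    case (Suc e)
    show ?thesis
    proof
      assume "poly P 1 = 0"
      then obtain R where "P = [:-1, 1:] * R" by (auto simp: poly_eq_0_iff_dvd)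
      then have "P = [:1, -1:] * (- R)" by simp
      then have "one_minus_X * (one_minus_X ^ e * h) = one_minus_X * fps_of_poly (- R)"
        using P Suc by (simp only: fps_of_poly_mult fps_of_poly_one_minus_X power_Suc mult.assoc)
      then have "one_minus_X ^ e * h = fps_of_poly (- R)"
        using one_minus_X_nz by (simp only: mult_cancel_left) blast
      then have "d \<le> e" unfolding d_def by (intro Least_le) blast
      then show False using Suc by simp
    qed
  qed
  then show thesis using that P by blast
qed

section \<open>The Hilbert series\<close>

definition colon :: "'x set \<Rightarrow> ('x, 'k::field) mpoly set \<Rightarrow> ('x, 'k) mpoly \<Rightarrow> ('x, 'k) mpoly set" where
  "colon X J a = {g \<in> polys X. a * g \<in> J}"

definition adjoin :: "'x set \<Rightarrow> ('x, 'k::field) mpoly set \<Rightarrow> ('x, 'k) mpoly \<Rightarrow> ('x, 'k) mpoly set" where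
  "adjoin X J a = {j + a * g |j g. j \<in> J \<and> g \<in> polys X}"

lemma ideal_colon:
  assumes "ideal J (poly_ring X)"
  shows "ideal (colon X J a) (poly_ring X)"
proof (rule ideal_poly_ringI)
  show "g * f \<in> colon X J a" if "f \<in> colon X J a" "g \<in> polys X" for f g
    using that ideal_mult[OF assms, of "a * f" g] by (simp add: colon_def ac_simps)
qed (auto simp: colon_def distrib_left ideal_0[OF assms] intro: ideal_add[OF assms])

lemma subset_colon:
  assumes "ideal J (poly_ring X)" and "a \<in> polys X"
  shows "J \<subseteq> colon X J a"
  using assms ideal_subset_polys[OF assms(1)] ideal_mult[OF assms(1)] by (auto simp: colon_def)

lemma hom_ideal_colon:
  assumes J: "hom_ideal X J" and a: "homogeneous e a"
  shows "hom_ideal X (colon X J a)"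
proof -
  have "hcomp t g \<in> colon X J a" if "g \<in> colon X J a" for g t
  proof -
    have "hcomp (e + t) (a * g) \<in> J" using that J by (auto simp: colon_def hom_ideal_def)
    then show ?thesis using that by (simp add: colon_def hcomp_homogeneous_mult[OF a])
  qed
  then show ?thesis using J ideal_colon by (auto simp: hom_ideal_def)
qed

lemma ideal_adjoin:
  assumes J: "ideal J (poly_ring X)" and a: "a \<in> polys X"
  shows "ideal (adjoin X J a) (poly_ring X)"
proof (rule ideal_poly_ringI)
  show "adjoin X J a \<subseteq> polys X"
    using a ideal_subset_polys[OF J] by (auto simp: adjoin_def)
  show "0 \<in> adjoin X J a"
    unfolding adjoin_def using ideal_0[OF J] by (intro CollectI exI[of _ 0]) simp
  show "f + g \<in> adjoin X J a" if f: "f \<in> adjoin X J a" and g: "g \<in> adjoin X J a" for f g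
  proof -
    obtain j u i v where "f = j + a * u" "g = i + a * v" "j \<in> J" "u \<in> polys X" "i \<in> J" "v \<in> polys X"
      using f g by (auto simp: adjoin_def)
    then show ?thesis unfolding adjoin_def
      by (intro CollectI exI[of _ "j + i"] exI[of _ "u + v"]) (auto simp: algebra_simps ideal_add[OF J])
  qed
  show "g * f \<in> adjoin X J a" if f: "f \<in> adjoin X J a" and g: "g \<in> polys X" for f g
  proof -
    obtain j u where "f = j + a * u" "j \<in> J" "u \<in> polys X"
      using f by (auto simp: adjoin_def)
    then show ?thesis unfolding adjoin_def using g
      by (intro CollectI exI[of _ "g * j"] exI[of _ "g * u"]) (auto simp: algebra_simps ideal_mult[OF J])
  qed
qed

lemma subset_adjoin: "J \<subseteq> adjoin X J a"
proof
  fix j assume "j \<in> J"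
  then show "j \<in> adjoin X J a"
    unfolding adjoin_def by (intro CollectI exI[of _ j] exI[of _ 0]) simp
qed

lemma in_adjoin: "ideal J (poly_ring X) \<Longrightarrow> a \<in> adjoin X J a"
  unfolding adjoin_def by (intro CollectI exI[of _ 0] exI[of _ 1]) (simp add: ideal_0)

lemma hom_ideal_adjoin:
  assumes J: "hom_ideal X J" and a: "a \<in> polys X" "homogeneous e a"
  shows "hom_ideal X (adjoin X J a)"
proof -
  have I: "ideal J (poly_ring X)" using J by (simp add: hom_ideal_def)
  have "hcomp t f \<in> adjoin X J a" if f: "f \<in> adjoin X J a" for f t
  proof -
    obtain j g where jg: "f = j + a * g" "j \<in> J" "g \<in> polys X"
      using f by (auto simp: adjoin_def)
    have j: "hcomp t j \<in> J" using J jg(2) by (auto simp: hom_ideal_def)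
    show ?thesis
    proof (cases "e \<le> t")
      case True
      then show ?thesis unfolding adjoin_def using jg j
        by (intro CollectI exI[of _ "hcomp t j"] exI[of _ "hcomp (t - e) g"])
          (auto simp: hcomp_add hcomp_homogeneous_mult[OF a(2)])
    next
      case False
      then show ?thesis using j jg subset_adjoin[of J X a]
        by (auto simp: hcomp_add hcomp_homogeneous_mult[OF a(2)])
    qed
  qed
  then show ?thesis using I ideal_adjoin[OF I a(1)] by (auto simp: hom_ideal_def)
qed

lemma graded_part_finite_span:
  assumes "finite X"
  obtains T where "graded_part X t \<subseteq> mpoly_vs.span T" and "finite T"
  using that graded_part_span finite_imageI[OF finite_monomials[OF assms]] by blast

lemma dim_graded_mono:
  assumes "finite X" and "A \<subseteq> B" and "B \<subseteq> graded_part X t"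
  shows "mpoly_vs.dim A \<le> mpoly_vs.dim B"
  using graded_part_finite_span[OF assms(1), of t] assms
  by (metis mpoly_vs.dim_mono_finite order_trans)

text \<open>The rank formula for multiplication by \<open>a\<close>, from degree
  \<open>t - e\<close> into degree \<open>t\<close> modulo \<open>J\<close>: its kernel is the colon
  ideal, and its image together with \<open>J\<close> is the degree \<open>t\<close> part of
  \<open>adjoin X J a\<close>. For the latter, \<open>j + a * g\<close> is replaced by its component
  of degree \<open>t\<close>.\<close>

lemma dim_adjoin_colon:
  fixes J :: "('x, 'k::field) mpoly set"
  assumes X: "finite X" and J: "hom_ideal X J" and a: "a \<in> polys X" "homogeneous e a" and t: "e \<le> t"
  shows "mpoly_vs.dim (adjoin X J a \<inter> graded_part X t) + mpoly_vs.dim (colon X J a \<inter> graded_part X (t - e))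
    = mpoly_vs.dim (J \<inter> graded_part X t) + mpoly_vs.dim (graded_part X (t - e) :: ('x, 'k) mpoly set)"
proof -
  have I: "ideal J (poly_ring X)" using J by (simp add: hom_ideal_def)
  have at: "a * g \<in> graded_part X t" if "g \<in> graded_part X (t - e)" for g
    using that a t homogeneous_mult[OF a(2), of "t - e" g] by (auto simp: graded_part_def)
  obtain T :: "('x, 'k) mpoly set" where T: "graded_part X t \<subseteq> mpoly_vs.span T" "finite T"
    using graded_part_finite_span[OF X] by blast
  obtain T' :: "('x, 'k) mpoly set" where T': "graded_part X (t - e) \<subseteq> mpoly_vs.span T'" "finite T'"
    using graded_part_finite_span[OF X] by blast
  have "mpoly_vs.dim {j + a * v |j v. j \<in> J \<inter> graded_part X t \<and> v \<in> graded_part X (t - e)}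
    + mpoly_vs.dim {v \<in> graded_part X (t - e). a * v \<in> J \<inter> graded_part X t}
    = mpoly_vs.dim (J \<inter> graded_part X t) + mpoly_vs.dim (graded_part X (t - e) :: ('x, 'k) mpoly set)"
  proof (rule mpoly_vs.dim_sum_image_vimage[where T = T' and T' = T])
    show "mpoly_vs.subspace (J \<inter> graded_part X t)"
      using subspace_ideal[OF I] subspace_graded_part by (rule mpoly_vs.subspace_inter)
  qed (use T T' subspace_graded_part linear_mult in auto)
  moreover have "{v \<in> graded_part X (t - e). a * v \<in> J \<inter> graded_part X t} = colon X J a \<inter> graded_part X (t - e)"
    using at by (auto simp: colon_def graded_part_def)
  moreover have "{j + a * v |j v. j \<in> J \<inter> graded_part X t \<and> v \<in> graded_part X (t - e)} = adjoin X J a \<inter> graded_part X t"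
  proof (intro equalityI subsetI)
    fix f assume "f \<in> {j + a * v |j v. j \<in> J \<inter> graded_part X t \<and> v \<in> graded_part X (t - e)}"
    then obtain j v where f: "f = j + a * v" "j \<in> J" "j \<in> graded_part X t" "v \<in> graded_part X (t - e)" by auto
    have "f \<in> graded_part X t"
      unfolding f(1) using f(3) at[OF f(4)] by (rule mpoly_vs.subspace_add[OF subspace_graded_part])
    moreover have "f \<in> adjoin X J a" using f by (auto simp: adjoin_def graded_part_def)
    ultimately show "f \<in> adjoin X J a \<inter> graded_part X t" by simp
  next
    fix f assume f: "f \<in> adjoin X J a \<inter> graded_part X t"
    then obtain j g where jg: "f = j + a * g" "j \<in> J" "g \<in> polys X" by (auto simp: adjoin_def)
    have "f = hcomp t f" using f hcomp_homogeneous[of t f t] by (simp add: graded_part_def)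
    then have "f = hcomp t j + a * hcomp (t - e) g"
      using t by (simp add: jg(1) hcomp_add hcomp_homogeneous_mult[OF a(2)])
    moreover have "hcomp t j \<in> J \<inter> graded_part X t"
      using J jg(2) ideal_subset_polys[OF I] by (auto simp: hom_ideal_def graded_part_def homogeneous_hcomp)
    moreover have "hcomp (t - e) g \<in> graded_part X (t - e)"
      using jg(3) by (simp add: graded_part_def homogeneous_hcomp)
    ultimately show "f \<in> {j + a * v |j v. j \<in> J \<inter> graded_part X t \<and> v \<in> graded_part X (t - e)}" by blast
  qed
  ultimately show ?thesis by simp
qed

definition hilbert_series :: "'x set \<Rightarrow> ('x, 'k::field) mpoly set \<Rightarrow> real fps" where
  "hilbert_series X J = Abs_fps (\<lambda>t. real (hilbert_fun X J t))"

text \<open>Additivity along \<open>0 \<rightarrow> (S/(J : a))(-e) \<rightarrow> S/J \<rightarrow>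
  S/(J + aS) \<rightarrow> 0\<close>. Below degree \<open>e\<close> multiples of \<open>a\<close>
  have no component, so \<open>J\<close> and \<open>adjoin X J a\<close> agree there.\<close>

lemma hilbert_series_exact:
  fixes J :: "('x, 'k::field) mpoly set"
  assumes X: "finite X" and J: "hom_ideal X J" and a: "a \<in> polys X" "homogeneous e a"
  shows "hilbert_series X J = hilbert_series X (adjoin X J a) + fps_X ^ e * hilbert_series X (colon X J a)"
proof (rule fps_ext)
  fix t
  let ?d = "\<lambda>V :: ('x, 'k) mpoly set. mpoly_vs.dim V"
  have I: "ideal J (poly_ring X)" using J by (simp add: hom_ideal_def)
  have le: "?d (A \<inter> graded_part X s) \<le> ?d (graded_part X s)" for A s
    by (rule dim_graded_mono[OF X]) auto
  show "fps_nth (hilbert_series X J) t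
    = fps_nth (hilbert_series X (adjoin X J a) + fps_X ^ e * hilbert_series X (colon X J a)) t"
  proof (cases "e \<le> t")
    case True
    have "hilbert_fun X J t = hilbert_fun X (adjoin X J a) t + hilbert_fun X (colon X J a) (t - e)"
      using dim_adjoin_colon[OF X J a True] le[of "adjoin X J a" t] le[of "colon X J a" "t - e"] le[of J t]
      by (simp add: hilbert_fun_def)
    then show ?thesis using True by (simp add: hilbert_series_def fps_X_power_mult_nth)
  next
    case False
    have "adjoin X J a \<inter> graded_part X t = J \<inter> graded_part X t"
    proof
      show "adjoin X J a \<inter> graded_part X t \<subseteq> J \<inter> graded_part X t"
      proof
        fix f assume f: "f \<in> adjoin X J a \<inter> graded_part X t"
        then obtain j g where jg: "f = j + a * g" "j \<in> J" "g \<in> polys X" by (auto simp: adjoin_def)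
        have "f = hcomp t f" using f hcomp_homogeneous[of t f t] by (simp add: graded_part_def)
        then have "f = hcomp t j"
          using False by (simp add: jg(1) hcomp_add hcomp_homogeneous_mult[OF a(2)])
        then show "f \<in> J \<inter> graded_part X t" using f J jg(2) by (auto simp: hom_ideal_def)
      qed
    qed (use subset_adjoin in blast)
    then show ?thesis using False by (simp add: hilbert_series_def fps_X_power_mult_nth hilbert_fun_def)
  qed
qed

text \<open>
  \<open>pole_lt n h\<close> says that \<open>h\<close> is rational with its only pole at \<open>1\<close>, of order less than \<open>n\<close>. A nonzero
  polynomial counts as having a pole of order \<open>0\<close>.
\<close>

fun pole_lt :: "nat \<Rightarrow> real fps \<Rightarrow> bool" where
  "pole_lt 0 h \<longleftrightarrow> h = 0"
| "pole_lt (Suc n) h \<longleftrightarrow> (\<exists>Q. one_minus_X ^ n * h = fps_of_poly Q)"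

lemma pole_lt_add: "pole_lt n g \<Longrightarrow> pole_lt n h \<Longrightarrow> pole_lt n (g + h)"
proof (cases n)
  case (Suc k)
  assume "pole_lt n g" "pole_lt n h"
  then obtain P Q where "one_minus_X ^ k * g = fps_of_poly P" "one_minus_X ^ k * h = fps_of_poly Q"
    using Suc by auto
  then have "one_minus_X ^ k * (g + h) = fps_of_poly (P + Q)" by (simp only: distrib_left fps_of_poly_add)
  then show ?thesis using Suc by auto
qed auto

lemma pole_lt_X_power: "pole_lt n h \<Longrightarrow> pole_lt n (fps_X ^ e * h)"
proof (cases n)
  case (Suc k)
  assume "pole_lt n h"
  then obtain Q where "one_minus_X ^ k * h = fps_of_poly Q"
    using Suc by auto
  then have "one_minus_X ^ k * (fps_X ^ e * h) = fps_of_poly (monom 1 e * Q)"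
    by (simp only: fps_of_poly_mult fps_of_poly_monom' mult.left_commute)
  then show ?thesis using Suc by auto
qed auto

lemma pole_lt_Suc_if: "pole_lt n (one_minus_X * h) \<Longrightarrow> pole_lt (Suc n) h"
proof (cases n)
  case 0
  assume "pole_lt n (one_minus_X * h)"
  then have "h = 0" using one_minus_X_nz[where 'a = real] 0 by simp
  then have "one_minus_X ^ n * h = fps_of_poly 0" by simp
  then show ?thesis by (subst pole_lt.simps) blast
next
  case (Suc k)
  assume "pole_lt n (one_minus_X * h)"
  then obtain Q where "one_minus_X ^ k * (one_minus_X * h) = fps_of_poly Q" using Suc by auto
  then have "one_minus_X ^ n * h = fps_of_poly Q" by (simp only: Suc power_Suc2 mult.assoc)
  then show ?thesis by (subst pole_lt.simps) blast
qed

lemma pole_lt_Suc: "pole_lt n h \<Longrightarrow> pole_lt (Suc n) h"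
proof (cases n)
  case (Suc k)
  assume "pole_lt n h"
  then obtain Q where "one_minus_X ^ k * h = fps_of_poly Q" using Suc by auto
  then have "one_minus_X ^ n * h = fps_of_poly ([:1, -1:] * Q)"
    by (simp only: Suc power_Suc mult.assoc fps_of_poly_mult fps_of_poly_one_minus_X)
  then show ?thesis by (subst pole_lt.simps) blast
qed (auto intro: exI[of _ 0])

lemma pole_lt_mono: "pole_lt m h \<Longrightarrow> m \<le> n \<Longrightarrow> pole_lt n h"
  by (rule inc_induct[of m n "\<lambda>k. pole_lt k h \<longrightarrow> pole_lt n h", THEN mp]) (auto dest: pole_lt_Suc simp del: pole_lt.simps)

section \<open>Rationality of the Hilbert series\<close>

definition var :: "'x \<Rightarrow> ('x, 'k::field) mpoly" where
  "var x = Poly_Mapping.single (Poly_Mapping.single x 1) 1"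

lemma var_polys [simp]: "x \<in> X \<Longrightarrow> var x \<in> polys X"
  by (simp add: var_def)

lemma homogeneous_var: "homogeneous 1 (var x)"
  by (simp add: var_def homogeneous_def)

lemma graded_part_subset_if_vars:
  fixes J :: "('x, 'k::field) mpoly set"
  assumes J: "ideal J (poly_ring X)" and vars: "\<And>x. x \<in> X \<Longrightarrow> var x \<in> J" and t: "t > 0"
  shows "graded_part X t \<subseteq> J"
proof
  fix f :: "('x, 'k) mpoly" assume f: "f \<in> graded_part X t"
  have "(\<Sum>m\<in>Poly_Mapping.keys f. Poly_Mapping.single m (Poly_Mapping.lookup f m)) \<in> J"
  proof (rule ideal_sum[OF J])
    fix m assume m: "m \<in> Poly_Mapping.keys f"
    have "m \<noteq> 0" using f m t by (auto simp: graded_part_def homogeneous_def)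
    then obtain x where x: "x \<in> Poly_Mapping.keys m" using keys_eq_empty by blast
    have mX: "Poly_Mapping.keys m \<subseteq> X" using f m by (auto simp: graded_part_def polys_def)
    define n where "n = m - Poly_Mapping.single x 1"
    have "m = n + Poly_Mapping.single x 1"
      using x by (intro poly_mapping_eqI) (auto simp: n_def lookup_add lookup_minus lookup_single when_def in_keys_iff)
    then have "Poly_Mapping.single m c = Poly_Mapping.single n c * var x" for c :: 'k
      by (simp add: var_def mult_single)
    moreover have "Poly_Mapping.keys n \<subseteq> X"
      using mX by (auto simp: n_def in_keys_iff lookup_minus)
    ultimately show "Poly_Mapping.single m (Poly_Mapping.lookup f m) \<in> J"
      using ideal_mult[OF J vars] x mX by auto
  qed
  then show "f \<in> J" by (simp add: sum_monomials)
qed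

text \<open>Only degree \<open>0\<close> can survive in the quotient. Besides starting the
  rationality proof, this shows that a homogeneous ideal with a pole of positive order misses some
  variable.\<close>

lemma hilbert_series_if_vars:
  fixes J :: "('x, 'k::field) mpoly set"
  assumes J: "ideal J (poly_ring X)" and "\<And>x. x \<in> X \<Longrightarrow> var x \<in> J"
  shows "pole_lt 1 (hilbert_series X J)"
proof -
  have "hilbert_fun X J t = 0" if "t > 0" for t
    using graded_part_subset_if_vars[OF assms that] by (simp add: hilbert_fun_def Int_absorb1)
  then have "hilbert_series X J = fps_of_poly [:real (hilbert_fun X J 0):]"
    by (intro fps_ext) (auto simp: hilbert_series_def coeff_pCons split: nat.splits)
  then show ?thesis by (auto simp: One_nat_def)
qed

text \<open>Noetherian induction keeps the argument inside one ring and among ideals. For a variable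
  outside \<open>J\<close>, the ideal \<open>adjoin X J (var x)\<close> is strictly larger. If the
  colon ideal is larger too, both end terms of the exact sequence are covered by induction; if it
  equals \<open>J\<close>, the sequence determines
  \<open>one_minus_X * hilbert_series X J\<close>.\<close>

lemma hilbert_serre:
  assumes X: "finite X"
  shows "hom_ideal X (J :: ('x, 'k::field) mpoly set) \<Longrightarrow> \<exists>n. pole_lt n (hilbert_series X J)"
proof (induction J rule: wf_induct_rule[OF wf_ideals[OF X]])
  case (1 J)
  note J = \<open>hom_ideal X J\<close>
  have I: "ideal J (poly_ring X)" using J by (simp add: hom_ideal_def)
  have IH: "\<exists>n. pole_lt n (hilbert_series X K)" if "hom_ideal X K" "J \<subset> K" for K
    using 1(1)[of K] that I by (simp add: hom_ideal_def)
  show ?case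
  proof (cases "\<forall>x\<in>X. var x \<in> J")
    case True
    then show ?thesis using hilbert_series_if_vars[OF I] by blast
  next
    case False
    then obtain x where x: "x \<in> X" "var x \<notin> J" by blast
    note v = var_polys[OF x(1)] homogeneous_var
    note ex = hilbert_series_exact[OF X J v]
    have "J \<subset> adjoin X J (var x)" using x(2) subset_adjoin in_adjoin[OF I] by blast
    then obtain n where n: "pole_lt n (hilbert_series X (adjoin X J (var x)))"
      using IH hom_ideal_adjoin[OF J v] by blast
    show ?thesis
    proof (cases "colon X J (var x) = J")
      case True
      then have "hilbert_series X (adjoin X J (var x)) = one_minus_X * hilbert_series X J"
        using ex by (simp add: algebra_simps)
      then have "pole_lt (Suc n) (hilbert_series X J)" using n pole_lt_Suc_if by metis
      then show ?thesis by blast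
    next
      case False
      then have "J \<subset> colon X J (var x)" using subset_colon[OF I v(1)] by blast
      then obtain k where k: "pole_lt k (hilbert_series X (colon X J (var x)))"
        using IH hom_ideal_colon[OF J v(2)] by blast
      have "pole_lt (max n k) (hilbert_series X J)"
        unfolding ex using n k by (intro pole_lt_add pole_lt_X_power) (auto elim: pole_lt_mono)
      then show ?thesis by blast
    qed
  qed
qed

section \<open>Chains of homogeneous primes\<close>

text \<open>If neither factor lies in \<open>J\<close>, take the highest component of each outside
  \<open>J\<close>, of degrees \<open>s\<close> and \<open>t\<close>. In degree \<open>s + t\<close>
  of the product every other summand has a factor in \<open>J\<close>, so the product of these two
  components lies in \<open>J\<close>, contrary to the homogeneous case.\<close>

lemma primeideal_if_homogeneous:
  assumes J: "hom_ideal X J" and proper: "J \<noteq> polys X"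
    and prime: "\<And>a b s t. a \<in> polys X \<Longrightarrow> b \<in> polys X \<Longrightarrow> homogeneous s a \<Longrightarrow> homogeneous t b \<Longrightarrow>
      a * b \<in> J \<Longrightarrow> a \<in> J \<or> b \<in> J"
  shows "primeideal J (poly_ring X)"
proof (rule primeidealI)
  show I: "ideal J (poly_ring X)" using J by (simp add: hom_ideal_def)
  have top: "\<exists>s. hcomp s f \<notin> J \<and> (\<forall>i>s. hcomp i f \<in> J)" if "f \<notin> J" for f
  proof -
    obtain n where n: "deg_le n f" using ex_deg_le by blast
    have "\<exists>s. hcomp s f \<notin> J"
    proof (rule ccontr)
      assume "\<not> ?thesis"
      then have "(\<Sum>i\<le>n. hcomp i f) \<in> J" by (intro ideal_sum[OF I]) auto
      then show False using that n by (simp add: sum_hcomp)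
    qed
    moreover have "s \<le> n" if "hcomp s f \<notin> J" for s
    proof (rule ccontr)
      assume "\<not> s \<le> n"
      then have "hcomp s f = 0"
        using n by (intro poly_mapping_eqI) (auto simp: lookup_hcomp when_def deg_le_def in_keys_iff)
      then show False using that ideal_0[OF I] by simp
    qed
    ultimately obtain s where "hcomp s f \<notin> J" "\<And>i. hcomp i f \<notin> J \<Longrightarrow> i \<le> s"
      using Nat.ex_has_greatest_nat[of "\<lambda>s. hcomp s f \<notin> J" _ n] by blast
    then show ?thesis by (metis not_le)
  qed
  fix a b assume a: "a \<in> polys X" and b: "b \<in> polys X" and ab: "a \<otimes>\<^bsub>poly_ring X\<^esub> b \<in> J"
  show "a \<in> J \<or> b \<in> J"
  proof (rule ccontr)
    assume "\<not> (a \<in> J \<or> b \<in> J)"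
    then obtain s t where s: "hcomp s a \<notin> J" "\<And>i. i > s \<Longrightarrow> hcomp i a \<in> J"
      and t: "hcomp t b \<notin> J" "\<And>i. i > t \<Longrightarrow> hcomp i b \<in> J"
      using top by metis
    have "hcomp (s + t) (a * b) \<in> J" using J ab by (simp add: hom_ideal_def)
    moreover have "(\<Sum>i\<in>{..s + t} - {s}. hcomp i a * hcomp (s + t - i) b) \<in> J"
    proof (rule ideal_sum[OF I])
      fix i assume i: "i \<in> {..s + t} - {s}"
      show "hcomp i a * hcomp (s + t - i) b \<in> J"
      proof (cases "i > s")
        case True
        then show ?thesis using s b by (intro ideal_mult_right[OF I]) auto
      next
        case False
        then have "s + t - i > t" using i by auto
        then show ?thesis using t a by (intro ideal_mult[OF I]) auto
      qed
    qed
    moreover have "hcomp (s + t) (a * b) = hcomp s a * hcomp t b + (\<Sum>i\<in>{..s + t} - {s}. hcomp i a * hcomp (s + t - i) b)"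
      unfolding hcomp_mult by (subst sum.remove[of _ s]) auto
    ultimately have "hcomp s a * hcomp t b \<in> J"
      using ideal_diff[OF I, of "hcomp (s + t) (a * b)"] by (metis (no_types, lifting) add_diff_cancel_right')
    then show False using prime[OF _ _ homogeneous_hcomp homogeneous_hcomp] a b s(1) t(1) hcomp_polys by blast
  qed
qed (use cring_poly_ring proper in auto)

definition prime_chain :: "('a, 'm) ring_scheme \<Rightarrow> nat \<Rightarrow> (nat \<Rightarrow> 'a set) \<Rightarrow> bool" where
  "prime_chain R r P \<longleftrightarrow> (\<forall>i\<le>r. primeideal (P i) R) \<and> (\<forall>i<r. P i \<subset> P (Suc i))"

text \<open>An ideal maximal among the homogeneous ideals with a pole of order at least \<open>n\<close> is prime.\<close>

lemma ex_prime_pole: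
  fixes J :: "('x, 'k::field) mpoly set"
  assumes X: "finite X" and J: "hom_ideal X J" "\<not> pole_lt n (hilbert_series X J)"
  obtains K where "hom_ideal X K" and "J \<subseteq> K" and "\<not> pole_lt n (hilbert_series X K)"
    and "primeideal K (poly_ring X)"
proof -
  define A where "A = {K. hom_ideal X K \<and> J \<subseteq> K \<and> \<not> pole_lt n (hilbert_series X K)}"
  have JA: "J \<in> A" using J by (simp add: A_def)
  then obtain K where K: "K \<in> A" and
    "\<forall>L. (L, K) \<in> {(K, J :: ('x, 'k) mpoly set). ideal J (poly_ring X) \<and> ideal K (poly_ring X) \<and> J \<subset> K} \<longrightarrow> L \<notin> A"
    using wf_ideals[OF X, unfolded wf_eq_minimal, rule_format, OF JA] by blast
  then have max: "pole_lt n (hilbert_series X L)" if "hom_ideal X L" "K \<subset> L" for L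
    using that unfolding A_def hom_ideal_def by blast
  have hK: "hom_ideal X K" and JK: "J \<subseteq> K" and nK: "\<not> pole_lt n (hilbert_series X K)"
    using K by (auto simp: A_def)
  have I: "ideal K (poly_ring X)" using hK by (simp add: hom_ideal_def)
  have "primeideal K (poly_ring X)"
  proof (rule primeideal_if_homogeneous[OF hK])
    show "K \<noteq> polys X"
    proof
      assume "K = polys X"
      then have "hilbert_series X K = 0"
        by (intro fps_ext) (simp add: hilbert_series_def hilbert_fun_def graded_part_def Int_absorb1 Collect_mono)
      then have "pole_lt 0 (hilbert_series X K)" by simp
      then show False using nK pole_lt_mono by blast
    qed
    fix a b s t
    assume ab: "a \<in> polys X" "b \<in> polys X" "homogeneous s a" "homogeneous t b" "a * b \<in> K"
    show "a \<in> K \<or> b \<in> K"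
    proof (rule ccontr)
      \<comment> \<open>Adjoining \<open>a\<close> enlarges \<open>K\<close>, and so does the colon
        ideal, which contains \<open>b\<close>. By maximality both have smaller poles, and the exact
        sequence carries this bound over to \<open>K\<close>.\<close>
      assume "\<not> (a \<in> K \<or> b \<in> K)"
      then have "K \<subset> adjoin X K a" "K \<subset> colon X K a"
        using subset_adjoin in_adjoin[OF I] subset_colon[OF I ab(1)] ab(2,5) by (auto simp: colon_def)
      then have "pole_lt n (hilbert_series X (adjoin X K a))" "pole_lt n (hilbert_series X (colon X K a))"
        using max hom_ideal_adjoin[OF hK ab(1,3)] hom_ideal_colon[OF hK ab(3)] by blast+
      then show False
        using nK hilbert_series_exact[OF X hK ab(1,3)] pole_lt_add pole_lt_X_power by metis
    qed
  qed
  then show thesis using that hK JK nK by blast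
qed

lemma ex_prime_chain:
  assumes X: "finite X"
  shows "hom_ideal X (J :: ('x, 'k::field) mpoly set) \<Longrightarrow> \<not> pole_lt n (hilbert_series X J) \<Longrightarrow>
    \<exists>P. prime_chain (poly_ring X) n P \<and> J \<subseteq> P 0"
proof (induction n arbitrary: J)
  case (0 J)
  obtain K where "J \<subseteq> K" "primeideal K (poly_ring X)"
    using ex_prime_pole[OF X 0] by blast
  then show ?case by (intro exI[of _ "\<lambda>_. K"]) (auto simp: prime_chain_def)
next
  case (Suc n J)
  obtain K where K: "hom_ideal X K" "J \<subseteq> K" "\<not> pole_lt (Suc n) (hilbert_series X K)"
    "primeideal K (poly_ring X)"
    using ex_prime_pole[OF X Suc.prems] by blast
  have I: "ideal K (poly_ring X)" using K by (simp add: hom_ideal_def)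
  have "\<exists>x\<in>X. var x \<notin> K"
    using hilbert_series_if_vars[OF I] K(3) pole_lt_mono[of 1 _ "Suc n"] by (auto simp del: pole_lt.simps One_nat_def)
  then obtain x where x: "x \<in> X" "var x \<notin> K" by blast
  note v = var_polys[OF x(1)] homogeneous_var
  \<comment> \<open>As \<open>K\<close> is prime, the variable is a nonzerodivisor modulo
    \<open>K\<close>. The exact sequence then says that adjoining it multiplies the series by
    \<open>one_minus_X\<close>.\<close>
  have "colon X K (var x) = K"
    using subset_colon[OF I v(1)] primeideal.I_prime[OF K(4)] v(1) x(2) by (auto simp: colon_def)
  then have "hilbert_series X (adjoin X K (var x)) = one_minus_X * hilbert_series X K"
    using hilbert_series_exact[OF X K(1) v] by (simp add: algebra_simps)
  then have "\<not> pole_lt n (hilbert_series X (adjoin X K (var x)))" using K(3) pole_lt_Suc_if by metis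
  then obtain P where P: "prime_chain (poly_ring X) n P" "adjoin X K (var x) \<subseteq> P 0"
    using Suc.IH[OF hom_ideal_adjoin[OF K(1) v]] by blast
  have "K \<subset> P 0" using P(2) x(2) subset_adjoin in_adjoin[OF I] by blast
  then show ?case
    using K(2,4) P(1)
    by (intro exI[of _ "\<lambda>i. case i of 0 \<Rightarrow> K | Suc i \<Rightarrow> P i"])
      (auto simp: prime_chain_def split: nat.splits)
qed

section \<open>The length of a chain of primes\<close>

text \<open>Counting by degree at most \<open>t\<close> also measures nonhomogeneous ideals, such as
  the primes of an arbitrary chain.\<close>

definition affine_hilbert_fun :: "'x set \<Rightarrow> ('x, 'k::field) mpoly set \<Rightarrow> nat \<Rightarrow> nat" where
  "affine_hilbert_fun X J t =
    mpoly_vs.dim (filtered_part X t :: ('x, 'k) mpoly set) - mpoly_vs.dim (J \<inter> filtered_part X t)"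

lemma filtered_part_finite_span:
  assumes "finite X"
  obtains T where "filtered_part X t \<subseteq> mpoly_vs.span T" and "finite T"
  using that filtered_part_span finite_imageI[OF finite_monomials_le[OF assms]] by blast

lemma dim_filtered_mono:
  assumes "finite X" and "A \<subseteq> B" and "B \<subseteq> filtered_part X t"
  shows "mpoly_vs.dim A \<le> mpoly_vs.dim B"
  using filtered_part_finite_span[OF assms(1), of t] assms
  by (metis mpoly_vs.dim_mono_finite order_trans)

text \<open>An element of degree at most \<open>Suc t\<close> splits off its top component, and both
  pieces stay in the homogeneous ideal. With the identity as \<open>\<phi>\<close>, the rank formula
  becomes the dimension formula for a sum and an intersection, the latter being zero.\<close>

lemma dim_hom_ideal_filtered:
  fixes J :: "('x, 'k::field) mpoly set"
  assumes X: "finite X" and J: "hom_ideal X J"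
  shows "mpoly_vs.dim (J \<inter> filtered_part X t) = (\<Sum>s\<le>t. mpoly_vs.dim (J \<inter> graded_part X s))"
proof (induction t)
  case 0
  have "filtered_part X 0 = (graded_part X 0 :: ('x, 'k) mpoly set)"
    by (auto simp: filtered_part_def graded_part_def deg_le_def homogeneous_def)
  then show ?case by simp
next
  case (Suc t)
  have I: "ideal J (poly_ring X)" using J by (simp add: hom_ideal_def)
  let ?A = "J \<inter> filtered_part X t" and ?B = "J \<inter> graded_part X (Suc t)"
  obtain T :: "('x, 'k) mpoly set" where T: "filtered_part X t \<subseteq> mpoly_vs.span T" "finite T"
    using filtered_part_finite_span[OF X] by blast
  obtain T' :: "('x, 'k) mpoly set" where T': "graded_part X (Suc t) \<subseteq> mpoly_vs.span T'" "finite T'"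
    using graded_part_finite_span[OF X] by blast
  have "mpoly_vs.dim {j + v |j v. j \<in> ?A \<and> v \<in> ?B} + mpoly_vs.dim {v \<in> ?B. v \<in> ?A}
    = mpoly_vs.dim ?A + mpoly_vs.dim ?B"
  proof (rule mpoly_vs.dim_sum_image_vimage[where \<phi> = "\<lambda>v. v" and T = T' and T' = T])
    show "mpoly_vs.subspace ?A" "mpoly_vs.subspace ?B"
      by (simp_all add: mpoly_vs.subspace_inter subspace_ideal[OF I] subspace_graded_part subspace_filtered_part)
    show "Vector_Spaces.linear scale scale (\<lambda>v :: ('x, 'k) mpoly. v)" by (rule linear_scaleI) auto
  qed (use T T' in auto)
  moreover have "{v \<in> ?B. v \<in> ?A} = {0}"
  proof -
    have "v = 0" if "v \<in> ?B" "v \<in> ?A" for v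
    proof -
      have "Poly_Mapping.keys v = {}"
        using that by (fastforce simp: graded_part_def filtered_part_def homogeneous_def deg_le_def)
      then show ?thesis by simp
    qed
    then show ?thesis
      using ideal_0[OF I] by (auto simp: graded_part_def filtered_part_def)
  qed
  moreover have "mpoly_vs.dim {0 :: ('x, 'k) mpoly} = 0"
    using mpoly_vs.dim_le_card[of "{0 :: ('x, 'k) mpoly}" "{}"] by simp
  moreover have "{j + v |j v. j \<in> ?A \<and> v \<in> ?B} = J \<inter> filtered_part X (Suc t)"
  proof (intro equalityI subsetI)
    fix f assume "f \<in> {j + v |j v. j \<in> ?A \<and> v \<in> ?B}"
    then obtain j v where f: "f = j + v" "j \<in> ?A" "v \<in> ?B" by auto
    have "deg_le (Suc t) v" using f(3) by (auto simp: graded_part_def homogeneous_def deg_le_def)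
    moreover have "deg_le (Suc t) j" using f(2) deg_le_mono[of t j "Suc t"] by (auto simp: filtered_part_def)
    ultimately show "f \<in> J \<inter> filtered_part X (Suc t)"
      using f ideal_add[OF I] by (auto simp: filtered_part_def graded_part_def intro: deg_le_add)
  next
    fix f assume f: "f \<in> J \<inter> filtered_part X (Suc t)"
    then have d: "deg_le (Suc t) f" by (simp add: filtered_part_def)
    define v where "v = hcomp (Suc t) f"
    have v: "v \<in> ?B"
      using f J ideal_subset_polys[OF I] by (auto simp: v_def hom_ideal_def graded_part_def homogeneous_hcomp)
    have "deg_le t (f - v)"
      unfolding deg_le_def
    proof
      fix m assume m: "m \<in> Poly_Mapping.keys (f - v)"
      then have "mon_deg m \<noteq> Suc t" "m \<in> Poly_Mapping.keys f"
        by (auto simp: v_def in_keys_iff lookup_minus lookup_hcomp when_def split: if_splits)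
      then show "mon_deg m \<le> t" using d by (fastforce simp: deg_le_def)
    qed
    then have "f - v \<in> ?A"
      using f v ideal_diff[OF I] ideal_subset_polys[OF I] by (auto simp: filtered_part_def)
    then show "f \<in> {j + v |j v. j \<in> ?A \<and> v \<in> ?B}"
      using v by (intro CollectI exI[of _ "f - v"] exI[of _ v]) auto
  qed
  ultimately show ?case using Suc.IH by simp
qed

lemma affine_hilbert_fun_hom_ideal:
  fixes J :: "('x, 'k::field) mpoly set"
  assumes X: "finite X" and J: "hom_ideal X J"
  shows "affine_hilbert_fun X J t = (\<Sum>s\<le>t. hilbert_fun X J s)"
proof -
  let ?d = "\<lambda>V :: ('x, 'k) mpoly set. mpoly_vs.dim V"
  \<comment> \<open>Taking the whole ring as a homogeneous ideal gives the dimension of the full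
    filtered part by the same formula.\<close>
  have P: "hom_ideal X (polys X :: ('x, 'k) mpoly set)"
    by (auto simp: hom_ideal_def intro: ideal_poly_ringI)
  have "polys X \<inter> filtered_part X t = (filtered_part X t :: ('x, 'k) mpoly set)"
    and "polys X \<inter> graded_part X s = (graded_part X s :: ('x, 'k) mpoly set)" for s
    by (auto simp: filtered_part_def graded_part_def)
  then have "?d (filtered_part X t) = (\<Sum>s\<le>t. ?d (graded_part X s))"
    using dim_hom_ideal_filtered[OF X P, of t] by simp
  moreover have "?d (J \<inter> graded_part X s) \<le> ?d (graded_part X s)" for s
    by (rule dim_graded_mono[OF X]) auto
  ultimately show ?thesis
    by (simp add: affine_hilbert_fun_def hilbert_fun_def dim_hom_ideal_filtered[OF X J] sum_subtractf_nat)
qed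

lemma affine_hilbert_fun_mono:
  assumes "finite X" and "J \<subseteq> P"
  shows "affine_hilbert_fun X P t \<le> affine_hilbert_fun X J t"
  unfolding affine_hilbert_fun_def
  by (intro diff_le_mono2 dim_filtered_mono[OF assms(1), of _ _ t]) (use assms(2) in auto)

text \<open>Multiplication by \<open>f\<close> is injective modulo the prime \<open>P\<close>, and its image modulo \<open>P\<close> lies in \<open>Q/P\<close>.\<close>

lemma affine_hilbert_fun_prime:
  fixes P Q :: "('x, 'k::field) mpoly set"
  assumes X: "finite X" and P: "primeideal P (poly_ring X)" and Q: "ideal Q (poly_ring X)" and "P \<subseteq> Q"
    and f: "f \<in> Q" "f \<notin> P" "deg_le e f"
  shows "affine_hilbert_fun X P t + affine_hilbert_fun X Q (t + e) \<le> affine_hilbert_fun X P (t + e)"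
proof -
  let ?d = "\<lambda>V :: ('x, 'k) mpoly set. mpoly_vs.dim V"
  have I: "ideal P (poly_ring X)" using P by (rule primeideal.axioms)
  have fX: "f \<in> polys X" using f(1) ideal_subset_polys[OF Q] by auto
  let ?U = "{j + f * v |j v. j \<in> P \<inter> filtered_part X (t + e) \<and> v \<in> filtered_part X t}"
  obtain T :: "('x, 'k) mpoly set" where T: "filtered_part X t \<subseteq> mpoly_vs.span T" "finite T"
    using filtered_part_finite_span[OF X] by blast
  obtain T' :: "('x, 'k) mpoly set" where T': "filtered_part X (t + e) \<subseteq> mpoly_vs.span T'" "finite T'"
    using filtered_part_finite_span[OF X] by blast
  have mult: "f * v \<in> filtered_part X (t + e)" if "v \<in> filtered_part X t" for v
    using that fX deg_le_mult[OF f(3), of t v] by (auto simp: filtered_part_def add.commute)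
  have "?d ?U + ?d {v \<in> filtered_part X t. f * v \<in> P \<inter> filtered_part X (t + e)}
    = ?d (P \<inter> filtered_part X (t + e)) + ?d (filtered_part X t)"
  proof (rule mpoly_vs.dim_sum_image_vimage[where T = T and T' = T'])
    show "mpoly_vs.subspace (P \<inter> filtered_part X (t + e))"
      using subspace_ideal[OF I] subspace_filtered_part by (rule mpoly_vs.subspace_inter)
  qed (use T T' subspace_filtered_part linear_mult in auto)
  moreover have "{v \<in> filtered_part X t. f * v \<in> P \<inter> filtered_part X (t + e)} = P \<inter> filtered_part X t"
    using mult primeideal.I_prime[OF P fX] f(2) ideal_mult[OF I _ fX] by (auto simp: filtered_part_def)
  moreover have "?d ?U \<le> ?d (Q \<inter> filtered_part X (t + e))"
  proof (rule dim_filtered_mono[OF X])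
    show "?U \<subseteq> Q \<inter> filtered_part X (t + e)"
    proof
      fix u assume "u \<in> ?U"
      then obtain j v where u: "u = j + f * v" "j \<in> P" "j \<in> filtered_part X (t + e)" "v \<in> filtered_part X t"
        by auto
      have "u \<in> filtered_part X (t + e)"
        unfolding u(1) using u(3) mult[OF u(4)] by (rule mpoly_vs.subspace_add[OF subspace_filtered_part])
      moreover have "u \<in> Q"
        using u \<open>P \<subseteq> Q\<close> f(1) ideal_add[OF Q] ideal_mult_right[OF Q] by (auto simp: filtered_part_def)
      ultimately show "u \<in> Q \<inter> filtered_part X (t + e)" by simp
    qed
  qed auto
  moreover have "?d (Q \<inter> filtered_part X (t + e)) \<le> ?d (filtered_part X (t + e))"
    "?d (P \<inter> filtered_part X t) \<le> ?d (filtered_part X t)"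
    "?d (P \<inter> filtered_part X (t + e)) \<le> ?d (filtered_part X (t + e))"
    by (rule dim_filtered_mono[OF X]; auto)+
  ultimately show ?thesis by (simp add: affine_hilbert_fun_def)
qed

text \<open>The class of \<open>1\<close> is nonzero, and \<open>1\<close> has degree
  \<open>0\<close>. This is the growth of order \<open>0\<close> with which the induction along a
  prime chain starts.\<close>

lemma affine_hilbert_fun_pos:
  fixes P :: "('x, 'k::field) mpoly set"
  assumes X: "finite X" and P: "ideal P (poly_ring X)" "1 \<notin> P"
  shows "affine_hilbert_fun X P t \<ge> 1"
proof -
  let ?d = "\<lambda>V :: ('x, 'k) mpoly set. mpoly_vs.dim V"
  let ?A = "P \<inter> filtered_part X t"
  obtain T :: "('x, 'k) mpoly set" where T: "filtered_part X t \<subseteq> mpoly_vs.span T" "finite T"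
    using filtered_part_finite_span[OF X] by blast
  have one: "1 \<in> filtered_part X t" by (simp add: filtered_part_def deg_le_def)
  obtain B where B: "B \<subseteq> ?A" "mpoly_vs.independent B" "?A \<subseteq> mpoly_vs.span B" "card B = ?d ?A"
    using mpoly_vs.basis_exists by blast
  have sA: "mpoly_vs.subspace ?A"
    using subspace_ideal[OF P(1)] subspace_filtered_part by (rule mpoly_vs.subspace_inter)
  have "mpoly_vs.span B \<subseteq> ?A" using B(1) sA by (rule mpoly_vs.span_minimal)
  then have n1: "1 \<notin> mpoly_vs.span B" using P(2) by auto
  then have "1 \<notin> B" using mpoly_vs.span_base by metis
  have ind: "mpoly_vs.independent (insert 1 B)" using n1 B(2) by (rule mpoly_vs.independent_insertI)
  have sub: "insert 1 B \<subseteq> filtered_part X t" using one B(1) by auto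
  have fin: "finite (insert 1 B)"
    using mpoly_vs.independent_span_bound[OF T(2) ind order_trans[OF sub T(1)]] by simp
  have "card (insert 1 B) = ?d (insert 1 B)" using mpoly_vs.dim_eq_card_independent[OF ind] by simp
  also have "\<dots> \<le> ?d (filtered_part X t)" by (rule dim_filtered_mono[OF X sub order_refl])
  finally show ?thesis using \<open>1 \<notin> B\<close> fin B(4) by (simp add: affine_hilbert_fun_def)
qed

text \<open>Induction from the top of the chain downwards: each step down gains one order of growth.
  An element of the next prime outside the current one gives a recursive inequality, and summing it
  turns growth like \<open>j choose i\<close> into growth like
  \<open>j choose Suc i\<close>.\<close>

lemma prime_chain_growth:
  fixes P :: "nat \<Rightarrow> ('x, 'k::field) mpoly set"
  assumes X: "finite X" and chain: "prime_chain (poly_ring X) r P"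
  shows "\<exists>e\<ge>1. \<forall>j. j choose r \<le> affine_hilbert_fun X (P 0) (e * j)"
proof -
  have P: "primeideal (P i) (poly_ring X)" if "i \<le> r" for i
    using chain that by (simp add: prime_chain_def)
  have str: "P i \<subset> P (Suc i)" if "i < r" for i
    using chain that by (simp add: prime_chain_def)
  have I: "ideal (P i) (poly_ring X)" if "i \<le> r" for i using P[OF that] by (rule primeideal.axioms)
  have "\<forall>i. \<exists>f e. i < r \<longrightarrow> f \<in> P (Suc i) \<and> f \<notin> P i \<and> deg_le e f"
    using str ex_deg_le by (metis psubset_imp_ex_mem DiffE)
  then obtain f e where f: "\<And>i. i < r \<Longrightarrow> f i \<in> P (Suc i) \<and> f i \<notin> P i \<and> deg_le (e i) (f i)" by metis
  \<comment> \<open>A common degree bound for the separating elements lets all steps of the chain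
    use the same spacing \<open>E\<close>. The successor keeps it positive, so that
    \<open>E * j\<close> tends to infinity with \<open>j\<close>.\<close>
  define E where "E = Suc (\<Sum>i<r. e i)"
  have fE: "deg_le E (f i)" if "i < r" for i
  proof (rule deg_le_mono)
    show "deg_le (e i) (f i)" using f that by blast
    have "e i \<le> (\<Sum>i<r. e i)" using that by (intro member_le_sum) auto
    then show "e i \<le> E" by (simp add: E_def)
  qed
  have grow: "j choose i \<le> affine_hilbert_fun X (P (r - i)) (E * j)" if "i \<le> r" for i j
    using that
  proof (induction i arbitrary: j)
    case 0
    have "1 \<notin> P r"
      using primeideal.I_notcarr[OF P[of r]] ideal_eq_polys_iff[OF I[of r]] by auto
    then show ?case using affine_hilbert_fun_pos[OF X I[of r], of "E * j"] by simp
  next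
    case (Suc i)
    define k where "k = r - Suc i"
    have k: "k < r" "Suc k = r - i" using Suc.prems by (auto simp: k_def)
    have IH: "j choose i \<le> affine_hilbert_fun X (P (Suc k)) (E * j)" for j
      using Suc.IH[of j] Suc.prems k(2) by simp
    show ?case
    proof (induction j)
      case 0
      then show ?case by simp
    next
      case (Suc j)
      \<comment> \<open>Pascal's rule, with \<open>j choose i\<close> enlarged to
        \<open>Suc j choose i\<close>: the recursive inequality evaluates the larger prime at
        \<open>E * Suc j\<close>.\<close>
      have "Suc j choose Suc i \<le> (j choose Suc i) + (Suc j choose i)"
        by (cases i) simp_all
      also have "\<dots> \<le> affine_hilbert_fun X (P k) (E * j) + affine_hilbert_fun X (P (Suc k)) (E * Suc j)"
        using Suc.IH IH[of "Suc j"] by (intro add_mono) (auto simp: k_def)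
      also have "E * Suc j = E * j + E" by simp
      also have "affine_hilbert_fun X (P k) (E * j) + affine_hilbert_fun X (P (Suc k)) (E * j + E)
        \<le> affine_hilbert_fun X (P k) (E * j + E)"
        using k f[OF k(1)] fE[OF k(1)] str[OF k(1)] by (intro affine_hilbert_fun_prime[OF X P I]) auto
      finally show ?case by (simp add: k_def add.commute)
    qed
  qed
  have "E \<ge> 1" by (simp add: E_def)
  then show ?thesis using grow[of r] by auto
qed

text \<open>As a function of \<open>j\<close>, the left side is a polynomial of degree
  \<open>r\<close> with positive leading coefficient. If \<open>d < r\<close>, subtracting the right
  side would not change the leading term, and the difference would be positive for large
  \<open>j\<close>.\<close>

lemma degree_bound_if_binomial_le:
  assumes p: "degree p \<le> d" and e: "e \<ge> 1"
    and le: "\<forall>\<^sub>F j in sequentially. real (j choose r) \<le> poly p (real (e * j))"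
  shows "r \<le> d"
proof (rule ccontr)
  assume "\<not> r \<le> d"
  then have rd: "d < r" by simp
  \<comment> \<open>The substitution by \<open>- r\<close> makes the value at \<open>j\<close> equal
    to \<open>j choose r\<close> once \<open>j \<ge> r\<close>.\<close>
  define q where "q = pcompose (binom_poly r) [:- real r, 1:]"
  define g where "g = q - pcompose p [:0, real e:]"
  have dq: "degree q = r" by (simp add: q_def degree_pcompose degree_binom_poly)
  have "lead_coeff q = lead_coeff (binom_poly r)"
    unfolding q_def by (subst lead_coeff_comp) auto
  then have cq: "coeff q r = 1 / fact r" by (simp add: dq degree_binom_poly lead_coeff_binom_poly)
  have "degree (pcompose p [:0, real e:]) < r"
    using p rd e by (simp add: degree_pcompose)
  then have cg: "coeff g r = 1 / fact r" and "degree g = r"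
    using cq dq degree_add_eq_left[of "- pcompose p [:0, real e:]" q] by (simp_all add: g_def coeff_eq_0)
  then have "lead_coeff g > 0" by simp
  then obtain n where n: "\<And>x. x \<ge> n \<Longrightarrow> poly g x \<ge> lead_coeff g" using poly_pinfty_gt_lc[of g] by blast
  obtain N where N: "\<And>j. j \<ge> N \<Longrightarrow> real (j choose r) \<le> poly p (real (e * j))"
    using le by (auto simp: eventually_sequentially)
  define j where "j = max (max N r) (nat \<lceil>n\<rceil>)"
  have j: "j \<ge> N" "j \<ge> r" "real j \<ge> n" by (auto simp: j_def) linarith
  have "poly q (real j) = poly (binom_poly r) (real (j - r))"
    using j(2) by (simp add: q_def poly_pcompose of_nat_diff)
  also have "\<dots> = real (j choose r)" using j(2) by (simp only: poly_binom_poly le_add_diff_inverse2)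
  finally have "poly g (real j) = real (j choose r) - poly p (real (e * j))"
    by (simp add: g_def poly_pcompose mult.commute)
  then show False using N[OF j(1)] n[OF j(3)] \<open>lead_coeff g > 0\<close> by simp
qed

lemma prime_chain_le:
  fixes P :: "nat \<Rightarrow> ('x, 'k::field) mpoly set"
  assumes X: "finite X" and J: "hom_ideal X J"
    and h: "one_minus_X ^ d * hilbert_series X J = fps_of_poly Q"
    and P: "prime_chain (poly_ring X) r P" and JP: "J \<subseteq> P 0"
  shows "r \<le> d"
proof -
  \<comment> \<open>Partial sums of the Hilbert function: one more factor \<open>one_minus_X\<close>
    in the denominator, so the coefficients are eventually given by a polynomial of degree at most
    \<open>d\<close>. It dominates the affine Hilbert function of \<open>P 0\<close> because
    \<open>J \<subseteq> P 0\<close>.\<close>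
  define C where "C = Abs_fps (\<lambda>t. real (affine_hilbert_fun X J t))"
  have "one_minus_X * C = hilbert_series X J"
  proof (rule fps_ext)
    fix t show "fps_nth (one_minus_X * C) t = fps_nth (hilbert_series X J) t"
      by (cases t) (simp_all add: one_minus_X_mult_nth C_def hilbert_series_def affine_hilbert_fun_hom_ideal[OF X J])
  qed
  then have "one_minus_X ^ Suc d * C = fps_of_poly Q"
    using h by (simp only: power_Suc2 mult.assoc)
  then obtain p where p: "degree p \<le> d" "\<forall>\<^sub>F t in sequentially. poly p (real t) = fps_nth C t"
    using eventually_poly_if_rational by blast
  obtain e where e: "e \<ge> 1" "\<And>j. j choose r \<le> affine_hilbert_fun X (P 0) (e * j)"
    using prime_chain_growth[OF X P] by blast
  obtain N where N: "\<And>t. t \<ge> N \<Longrightarrow> poly p (real t) = fps_nth C t"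
    using p(2) by (auto simp: eventually_sequentially)
  have "real (j choose r) \<le> poly p (real (e * j))" if "j \<ge> N" for j
  proof -
    have "j choose r \<le> affine_hilbert_fun X J (e * j)"
      using e(2)[of j] affine_hilbert_fun_mono[OF X JP, of "e * j"] by linarith
    moreover have "e * j \<ge> N" using that e(1) by (metis le_trans mult_le_mono1 nat_mult_1)
    ultimately show ?thesis using N[of "e * j"] by (simp add: C_def del: of_nat_mult)
  qed
  then show ?thesis
    using degree_bound_if_binomial_le[OF p(1) e(1)] by (auto simp: eventually_sequentially)
qed

section \<open>Krull dimension of a quotient\<close>

context cring
begin

text \<open>Elements with the same coset differ by an element of \<open>J\<close>, hence of
  \<open>P\<close>; so membership in \<open>P\<close> depends only on the coset.\<close>

lemma rcos_mem_image_iff: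
  assumes J: "ideal J R" and P: "ideal P R" "J \<subseteq> P" and x: "x \<in> carrier R"
  shows "J +> x \<in> (+>) J ` P \<longleftrightarrow> x \<in> P"
proof
  assume "J +> x \<in> (+>) J ` P"
  then obtain y where y: "y \<in> P" "J +> x = J +> y" by auto
  have "x \<in> J +> y" using y(2) ideal.rcos_const_imp_mem abelian_subgroup.a_rcos_self
    abelian_subgroupI3[OF ideal.axioms(1)[OF J] is_abelian_group] x by metis
  then obtain j where "j \<in> J" "x = j \<oplus> y" by (auto simp: a_r_coset_def')
  then show "x \<in> P" using y P additive_subgroup.a_closed[OF ideal.axioms(1)[OF P(1)]] by auto
qed auto

text \<open>The correspondence of primes, by preimages in one direction and images in the other. The
  condition \<open>J \<subseteq> P 0\<close> is enough because the chain increases.\<close>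

lemma quotient_prime_chain_iff:
  assumes J: "ideal J R"
  shows "(\<exists>P. prime_chain (R Quot J) r P) \<longleftrightarrow>
    (\<exists>P. prime_chain R r P \<and> J \<subseteq> P 0)"
    (is "?L \<longleftrightarrow> ?R")
proof
  assume ?L
  then obtain P where P: "\<And>i. i \<le> r \<Longrightarrow> primeideal (P i) (R Quot J)" "\<And>i. i < r \<Longrightarrow> P i \<subset> P (Suc i)"
    unfolding prime_chain_def by blast
  define Q where "Q i = {x \<in> carrier R. J +> x \<in> P i}" for i
  have prime: "primeideal (Q i) R" if "i \<le> r" for i
    unfolding Q_def
    by (rule ring_hom_ring.primeideal_vimage[OF ideal.rcos_ring_hom_ring[OF J] is_cring P(1)[OF that]])
  have "J \<subseteq> Q 0"
  proof
    fix x assume x: "x \<in> J"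
    have xc: "x \<in> carrier R" using x additive_subgroup.a_Hcarr[OF ideal.axioms(1)[OF J]] by auto
    have "J +> x = J" using x ideal.quotient_is_ring ideal.Icarr J
      by (metis abelian_subgroup.a_rcos_const abelian_subgroupI3 ideal.axioms(1) is_abelian_group)
    moreover have "J \<in> P 0"
      using additive_subgroup.zero_closed[OF ideal.axioms(1)[OF primeideal.axioms(1)[OF P(1)[of 0]]]]
      by (simp add: FactRing_def)
    ultimately show "x \<in> Q 0" using xc by (simp add: Q_def)
  qed
  moreover have "Q i \<subset> Q (Suc i)" if i: "i < r" for i
  proof -
    obtain A where A: "A \<in> P (Suc i)" "A \<notin> P i" using P(2)[OF i] by blast
    have "A \<in> carrier (R Quot J)"
      using A(1) additive_subgroup.a_Hcarr[OF ideal.axioms(1)[OF primeideal.axioms(1)[OF P(1)[of "Suc i"]]]] i by auto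
    then obtain x where "x \<in> carrier R" "A = J +> x" by (auto simp: FactRing_simps)
    then have "x \<in> Q (Suc i)" "x \<notin> Q i" using A by (auto simp: Q_def)
    then show ?thesis using P(2)[OF i] by (auto simp: Q_def)
  qed
  ultimately show ?R using prime unfolding prime_chain_def by blast
next
  assume ?R
  then obtain P where P: "\<And>i. i \<le> r \<Longrightarrow> primeideal (P i) R" "J \<subseteq> P 0" "\<And>i. i < r \<Longrightarrow> P i \<subset> P (Suc i)"
    unfolding prime_chain_def by blast
  have JP: "J \<subseteq> P i" if "i \<le> r" for i
    using that
  proof (induction i)
    case (Suc i)
    then show ?case using P(3)[of i] by auto
  qed (use P(2) in simp)
  have I: "ideal (P i) R" if "i \<le> r" for i using P(1)[OF that] by (rule primeideal.axioms)
  note mem = rcos_mem_image_iff[OF J I JP]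
  define Q where "Q i = (+>) J ` P i" for i
  have prime: "primeideal (Q i) (R Quot J)" if i: "i \<le> r" for i
  proof (rule primeidealI)
    show "ideal (Q i) (R Quot J)" unfolding Q_def by (rule ring_ideal_imp_quot_ideal[OF J I[OF i]])
    show "cring (R Quot J)" by (rule ideal.quotient_is_cring[OF J is_cring])
    have "\<one> \<notin> P i"
      using ideal.one_imp_carrier[OF I[OF i]] primeideal.I_notcarr[OF P(1)[OF i]] by auto
    then have "J +> \<one> \<notin> Q i" using mem[OF i i one_closed] by (simp add: Q_def)
    moreover have "J +> \<one> \<in> carrier (R Quot J)" by (auto simp: FactRing_simps)
    ultimately show "carrier (R Quot J) \<noteq> Q i" by blast
    fix A B assume AB: "A \<in> carrier (R Quot J)" "B \<in> carrier (R Quot J)" "A \<otimes>\<^bsub>R Quot J\<^esub> B \<in> Q i"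
    then obtain x y where xy: "x \<in> carrier R" "A = J +> x" "y \<in> carrier R" "B = J +> y"
      by (auto simp: FactRing_simps)
    then have "J +> (x \<otimes> y) \<in> Q i"
      using AB(3) ideal.rcoset_mult_add[OF J] by (simp add: FactRing_def)
    then have "x \<otimes> y \<in> P i" using mem[OF i i] xy by (simp add: Q_def)
    then have "x \<in> P i \<or> y \<in> P i" using primeideal.I_prime[OF P(1)[OF i]] xy by blast
    then show "A \<in> Q i \<or> B \<in> Q i" using xy by (auto simp: Q_def)
  qed
  moreover have "Q i \<subset> Q (Suc i)" if i: "i < r" for i
  proof -
    obtain x where x: "x \<in> P (Suc i)" "x \<notin> P i" using P(3)[OF i] by blast
    have xc: "x \<in> carrier R"
      using x(1) additive_subgroup.a_Hcarr[OF ideal.axioms(1)[OF I[of "Suc i"]]] i by auto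
    then have "J +> x \<in> Q (Suc i)" "J +> x \<notin> Q i"
      using mem[OF _ _ xc, of i] mem[OF _ _ xc, of "Suc i"] x i by (auto simp: Q_def)
    then show ?thesis using P(3)[OF i] by (auto simp: Q_def)
  qed
  ultimately show ?L unfolding prime_chain_def by blast
qed

end

section \<open>Dimension and multiplicity from the Hilbert series\<close>

lemma krull_dim_eqI:
  assumes "\<exists>P. prime_chain R d P" and "\<And>r P. prime_chain R r P \<Longrightarrow> r \<le> d"
  shows "krull_dim R = enat d"
  unfolding krull_dim_def prime_chain_def[symmetric]
proof (rule Sup_eqI)
  fix y assume "y \<in> {enat r |r. \<exists>P. prime_chain R r P}"
  then show "y \<le> enat d" using assms(2) by auto
qed (use assms(1) in blast)

text \<open>A numerator that does not vanish at \<open>1\<close> means that the pole has order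
  exactly \<open>d\<close>: otherwise \<open>1 - X\<close> would divide it. The chain built from the
  pole and the bound on all chains then meet at \<open>d\<close>.\<close>

lemma
  fixes J :: "('x, 'k::field) mpoly set"
  assumes X: "finite X" and J: "hom_ideal X J"
    and h: "one_minus_X ^ d * hilbert_series X J = fps_of_poly Q" and Q: "poly Q 1 \<noteq> 0"
  shows ex_prime_chain_dim: "\<exists>P. prime_chain (poly_ring X) d P \<and> J \<subseteq> P 0"
    and dim_quot_eq: "dim_quot X J = d"
proof -
  interpret cring "poly_ring X :: ('x, 'k) mpoly ring" by (rule cring_poly_ring)
  have I: "ideal J (poly_ring X)" using J by (simp add: hom_ideal_def)
  have "\<not> pole_lt d (hilbert_series X J)"
  proof (cases d)
    case 0
    then have "hilbert_series X J \<noteq> 0" using h Q by auto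
    then show ?thesis using 0 by simp
  next
    case (Suc e)
    show ?thesis
    proof
      assume "pole_lt d (hilbert_series X J)"
      then obtain P where "one_minus_X ^ e * hilbert_series X J = fps_of_poly P" using Suc by auto
      then have "fps_of_poly Q = fps_of_poly ([:1, -1:] * P)"
        using h by (simp only: Suc power_Suc mult.assoc fps_of_poly_mult fps_of_poly_one_minus_X)
      then have "Q = [:1, -1:] * P" by (simp only: fps_of_poly_eq_iff)
      then show False using Q by simp
    qed
  qed
  then show chain: "\<exists>P. prime_chain (poly_ring X) d P \<and> J \<subseteq> P 0"
    by (rule ex_prime_chain[OF X J])
  have "krull_dim (poly_ring X Quot J) = enat d"
  proof (rule krull_dim_eqI)
    show "\<exists>P. prime_chain (poly_ring X Quot J) d P"
      by (rule iffD2[OF quotient_prime_chain_iff[OF I] chain])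
    fix r P assume "prime_chain (poly_ring X Quot J) r P"
    then obtain P' where "prime_chain (poly_ring X) r P'" "J \<subseteq> P' 0"
      using iffD1[OF quotient_prime_chain_iff[OF I, of r]] by blast
    then show "r \<le> d" by (rule prime_chain_le[OF X J h])
  qed
  then show "dim_quot X J = d" by (simp add: dim_quot_def)
qed

text \<open>For \<open>d = 0\<close> the numerator is the Hilbert series itself, and its value at
  \<open>1\<close> is the total dimension. For \<open>d = Suc k\<close> the Hilbert polynomial has
  leading coefficient \<open>poly Q 1 / fact k\<close>, and the factorial in the definition of
  multiplicity cancels the denominator. Positivity is recorded for the upper bound
  inequality.\<close>

lemma multiplicity_eq:
  fixes J :: "('x, 'k::field) mpoly set"
  assumes X: "finite X" and J: "hom_ideal X J"
    and h: "one_minus_X ^ d * hilbert_series X J = fps_of_poly Q" and Q: "poly Q 1 \<noteq> 0"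
  shows "multiplicity X J = poly Q 1" and "poly Q 1 > 0"
proof -
  note dim = dim_quot_eq[OF assms]
  have "multiplicity X J = poly Q 1 \<and> poly Q 1 > 0"
  proof (cases d)
    case 0
    have c: "coeff Q t = real (hilbert_fun X J t)" for t
    proof -
      have "fps_nth (hilbert_series X J) t = fps_nth (fps_of_poly Q) t" using h 0 by simp
      then show ?thesis by (simp add: hilbert_series_def)
    qed
    have "poly Q 1 = (\<Sum>t\<le>degree Q. real (hilbert_fun X J t))" by (simp add: poly_altdef c)
    also have "\<dots> = (\<Sum>t | hilbert_fun X J t \<noteq> 0. real (hilbert_fun X J t))"
    proof (rule sum.mono_neutral_right)
      show "{t. hilbert_fun X J t \<noteq> 0} \<subseteq> {..degree Q}" using c by (auto intro: le_degree)
    qed auto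
    finally have "poly Q 1 = real (\<Sum>t | hilbert_fun X J t \<noteq> 0. hilbert_fun X J t)" by simp
    moreover from this have "poly Q 1 \<ge> 0" by (simp only: of_nat_0_le_iff)
    ultimately show ?thesis using 0 dim Q by (simp add: multiplicity_def)
  next
    case (Suc k)
    obtain p where p: "degree p \<le> k" "coeff p k = poly Q 1 / fact k"
      "\<forall>\<^sub>F t in sequentially. poly p (real t) = fps_nth (hilbert_series X J) t"
      using eventually_poly_if_rational[of k] h Suc by blast
    have hp: "hilbert_poly X J = p"
      unfolding hilbert_poly_def
    proof (rule the_equality)
      show "\<forall>\<^sub>F t in sequentially. poly p (real t) = real (hilbert_fun X J t)"
        using p(3) by (simp add: hilbert_series_def)
      fix q assume "\<forall>\<^sub>F t in sequentially. poly q (real t) = real (hilbert_fun X J t)"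
      with p(3) have "\<forall>\<^sub>F t in sequentially. poly q (real t) = poly p (real t)"
        by eventually_elim (simp add: hilbert_series_def)
      then show "q = p" by (rule poly_eq_if_eventually_eq)
    qed
    have "coeff p k \<noteq> 0" using p(2) Q by simp
    then have "degree p = k" using p(1) le_degree by (metis le_antisym)
    then have lc: "lead_coeff p = poly Q 1 / fact k" using p(2) by simp
    then have mult: "multiplicity X J = poly Q 1"
      using dim Suc hp by (simp add: multiplicity_def)
    \<comment> \<open>Otherwise the polynomial would eventually be negative, but its values at large
      integers are dimensions.\<close>
    have "\<not> lead_coeff p < 0"
    proof
      assume "lead_coeff p < 0"
      then have "lead_coeff (- p) > 0" by simp
      then obtain n where n: "\<And>x. x \<ge> n \<Longrightarrow> poly (- p) x \<ge> lead_coeff (- p)"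
        using poly_pinfty_gt_lc[of "- p"] by blast
      obtain N where N: "\<And>t. t \<ge> N \<Longrightarrow> poly p (real t) = fps_nth (hilbert_series X J) t"
        using p(3) by (auto simp: eventually_sequentially)
      define j where "j = max N (nat \<lceil>n\<rceil>)"
      have j: "j \<ge> N" "real j \<ge> n" by (auto simp: j_def) linarith
      have "poly p (real j) \<ge> 0" using N[OF j(1)] by (simp add: hilbert_series_def)
      then show False using n[OF j(2)] \<open>lead_coeff (- p) > 0\<close> by simp
    qed
    then have "poly Q 1 \<ge> 0" using fact_gt_zero[of k, where 'a = real]
      by (simp add: lc zero_le_divide_iff not_less)
    then have "poly Q 1 > 0" using Q by simp
    then show ?thesis using mult by simp
  qed
  then show "multiplicity X J = poly Q 1" "poly Q 1 > 0" by auto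
qed

text \<open>Properness enters through degree \<open>0\<close>: as \<open>1\<close> is not in
  \<open>J\<close>, the Hilbert function is nonzero there, so the series does not vanish.\<close>

lemma ex_hilbert_numerator:
  fixes J :: "('x, 'k::field) mpoly set"
  assumes X: "finite X" and J: "hom_ideal X J" and "J \<noteq> polys X"
  obtains d Q where "one_minus_X ^ d * hilbert_series X J = fps_of_poly Q" and "poly Q 1 \<noteq> 0"
proof -
  have I: "ideal J (poly_ring X)" using J by (simp add: hom_ideal_def)
  have "1 \<notin> J" using assms(3) ideal_eq_polys_iff[OF I] by blast
  then have "affine_hilbert_fun X J 0 \<ge> 1" using affine_hilbert_fun_pos[OF X I] by blast
  then have "hilbert_fun X J 0 \<noteq> 0" by (simp add: affine_hilbert_fun_hom_ideal[OF X J])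
  then have nz: "hilbert_series X J \<noteq> 0" by (auto simp: hilbert_series_def fps_eq_iff)
  obtain n where "pole_lt n (hilbert_series X J)" using hilbert_serre[OF X J] by blast
  \<comment> \<open>The clause of \<open>pole_lt\<close> at \<open>0\<close> provides no numerator,
    so the order is raised to a successor.\<close>
  then have "pole_lt (Suc n) (hilbert_series X J)" by (rule pole_lt_Suc)
  then obtain P where P: "one_minus_X ^ n * hilbert_series X J = fps_of_poly P" by auto
  show thesis using pole_cancel[OF P nz] that by (auto simp: hilbert_series_def)
qed

text \<open>Every prime contains \<open>{0}\<close>, so the results about chains above the zero
  ideal speak about all chains of the ring. The dimension is left as a pole order, the form in which
  it adds up under tensor products.\<close>

lemma krull_dim_poly_ring:
  assumes X: "finite X"
    and h: "one_minus_X ^ n * hilbert_series X ({0} :: ('x, 'k::field) mpoly set) = fps_of_poly Q" and Q: "poly Q 1 \<noteq> 0"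
  shows "krull_dim (poly_ring X :: ('x, 'k) mpoly ring) = enat n"
proof (rule krull_dim_eqI)
  show "\<exists>P. prime_chain (poly_ring X :: ('x, 'k) mpoly ring) n P"
    using ex_prime_chain_dim[OF X hom_ideal_zero h Q] by blast
  fix r and P :: "nat \<Rightarrow> ('x, 'k) mpoly set"
  assume P: "prime_chain (poly_ring X) r P"
  then have "ideal (P 0) (poly_ring X)" by (auto simp: prime_chain_def intro: primeideal.axioms)
  then have "{0} \<subseteq> P 0" using ideal_0 by auto
  then show "r \<le> n" by (rule prime_chain_le[OF X hom_ideal_zero h P])
qed

text \<open>A chain above \<open>J\<close> is also a chain above \<open>{0}\<close>. This ensures
  that the truncated subtraction in \<open>codim\<close> is a true difference.\<close>

lemma dim_le_dim_zero:
  fixes J :: "('x, 'k::field) mpoly set"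
  assumes X: "finite X" and J: "hom_ideal X J"
    and h: "one_minus_X ^ d * hilbert_series X J = fps_of_poly Q" and Q: "poly Q 1 \<noteq> 0"
    and h0: "one_minus_X ^ n * hilbert_series X ({0} :: ('x, 'k) mpoly set) = fps_of_poly Q0"
  shows "d \<le> n"
proof -
  obtain P :: "nat \<Rightarrow> ('x, 'k) mpoly set" where P: "prime_chain (poly_ring X) d P"
    using ex_prime_chain_dim[OF X J h Q] by blast
  then have "ideal (P 0) (poly_ring X)" by (auto simp: prime_chain_def intro: primeideal.axioms)
  then have "{0} \<subseteq> P 0" using ideal_0 by auto
  then show ?thesis by (rule prime_chain_le[OF X hom_ideal_zero h0 P])
qed

section \<open>Renaming variables\<close>

lemma rename_mon_sum:
  assumes "finite A" and "Poly_Mapping.keys m \<subseteq> A"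
  shows "rename_mon g m = (\<Sum>x\<in>A. Poly_Mapping.single (g x) (Poly_Mapping.lookup m x))"
  unfolding rename_mon_def using assms by (intro sum.mono_neutral_left) (auto simp: in_keys_iff)

lemma rename_mon_add: "rename_mon g (m + n) = rename_mon g m + rename_mon g n"
proof -
  let ?A = "Poly_Mapping.keys m \<union> Poly_Mapping.keys n"
  have "rename_mon g k = (\<Sum>x\<in>?A. Poly_Mapping.single (g x) (Poly_Mapping.lookup k x))"
    if "Poly_Mapping.keys k \<subseteq> ?A" for k
    using that by (intro rename_mon_sum) auto
  then show ?thesis by (simp add: keys_add_nat lookup_add single_add sum.distrib)
qed

lemma mon_deg_sum_distrib: "mon_deg (sum f A) = (\<Sum>a\<in>A. mon_deg (f a))"
  by (induction A rule: infinite_finite_induct) (auto simp: mon_deg_add)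

lemma mon_deg_rename_mon [simp]: "mon_deg (rename_mon g m) = mon_deg m"
  by (simp add: rename_mon_def mon_deg_sum_distrib) (simp add: mon_deg_def)

lemma lookup_rename_mon:
  assumes "inj g"
  shows "Poly_Mapping.lookup (rename_mon g m) (g x) = Poly_Mapping.lookup m x"
proof -
  have "Poly_Mapping.lookup (rename_mon g m) (g x) =
    (\<Sum>y\<in>Poly_Mapping.keys m. if y = x then Poly_Mapping.lookup m x else 0)"
    using assms by (auto simp: rename_mon_def lookup_sum lookup_single when_def inj_eq intro!: sum.cong)
  then show ?thesis by (simp add: sum.delta in_keys_iff)
qed

lemma lookup_rename_mon_notin:
  "y \<notin> g ` Poly_Mapping.keys m \<Longrightarrow> Poly_Mapping.lookup (rename_mon g m) y = 0"
  by (auto simp: rename_mon_def lookup_sum lookup_single when_def)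

lemma keys_rename_mon: "Poly_Mapping.keys (rename_mon g m) \<subseteq> g ` Poly_Mapping.keys m"
  using lookup_rename_mon_notin[of _ g m] by (metis in_keys_iff subsetI)

lemma rename_sum:
  assumes "finite A" and "Poly_Mapping.keys f \<subseteq> A"
  shows "rename g f = (\<Sum>m\<in>A. Poly_Mapping.single (rename_mon g m) (Poly_Mapping.lookup f m))"
  unfolding rename_def using assms by (intro sum.mono_neutral_left) (auto simp: in_keys_iff)

lemma rename_add: "rename g (f + h) = rename g f + rename g h"
proof -
  let ?A = "Poly_Mapping.keys f \<union> Poly_Mapping.keys h"
  let ?r = "\<lambda>k. \<Sum>m\<in>?A. Poly_Mapping.single (rename_mon g m) (Poly_Mapping.lookup k m)"
  have "rename g f = ?r f" "rename g h = ?r h" "rename g (f + h) = ?r (f + h)"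
    using keys_add[of f h] by (auto intro!: rename_sum)
  then show ?thesis by (simp add: lookup_add single_add sum.distrib)
qed

lemma rename_single [simp]: "rename g (Poly_Mapping.single m c) = Poly_Mapping.single (rename_mon g m) c"
  by (subst rename_sum[of "{m}"]) auto

lemma rename_0 [simp]: "rename g 0 = 0"
  by (simp add: rename_def)

lemma rename_1 [simp]: "rename g 1 = 1"
  by (simp flip: single_one add: rename_mon_def)

lemma rename_sum_distrib: "rename g (sum f A) = (\<Sum>a\<in>A. rename g (f a))"
  by (induction A rule: infinite_finite_induct) (auto simp: rename_add)

lemma rename_mult: "rename g (f * h) = rename g f * rename g h"
proof -
  let ?s = "\<lambda>f. (\<Sum>m\<in>Poly_Mapping.keys f. Poly_Mapping.single m (Poly_Mapping.lookup f m))"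
  have "rename g (?s f * ?s h) = rename g (?s f) * rename g (?s h)"
    by (simp add: sum_product rename_sum_distrib mult_single rename_mon_add)
  then show ?thesis by (simp only: sum_monomials)
qed

lemma rename_scale: "rename g (scale c f) = scale c (rename g f)"
  by (simp add: scale_def rename_mult) (simp add: rename_mon_def)

lemma linear_rename: "Vector_Spaces.linear scale scale (rename g)"
  by (rule linear_scaleI) (simp_all add: rename_add rename_scale)

lemma keys_rename: "Poly_Mapping.keys (rename g f) \<subseteq> rename_mon g ` Poly_Mapping.keys f"
proof
  fix n assume n: "n \<in> Poly_Mapping.keys (rename g f)"
  show "n \<in> rename_mon g ` Poly_Mapping.keys f"
  proof (rule ccontr)
    assume "n \<notin> rename_mon g ` Poly_Mapping.keys f"
    then have "Poly_Mapping.lookup (rename g f) n = 0"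
      by (auto simp: rename_def lookup_sum lookup_single when_def intro!: sum.neutral)
    then show False using n by (simp add: in_keys_iff)
  qed
qed

lemma rename_polys: "f \<in> polys X \<Longrightarrow> g ` X \<subseteq> Z \<Longrightarrow> rename g f \<in> polys Z"
  using keys_rename[of g f] keys_rename_mon[of g] by (fastforce simp: polys_def)

lemma rename_homogeneous: "homogeneous t f \<Longrightarrow> homogeneous t (rename g f)"
  using keys_rename[of g f] by (fastforce simp: homogeneous_def)

lemma hcomp_single: "hcomp t (Poly_Mapping.single m c) = (if mon_deg m = t then Poly_Mapping.single m c else 0)"
  by (rule poly_mapping_eqI) (auto simp: lookup_hcomp lookup_single when_def)

lemma hcomp_rename: "hcomp t (rename g f) = rename g (hcomp t f)"
proof -
  have "rename g (hcomp t f) =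
    (\<Sum>m\<in>Poly_Mapping.keys f. Poly_Mapping.single (rename_mon g m) (Poly_Mapping.lookup (hcomp t f) m))"
    by (rule rename_sum) (auto simp: keys_hcomp)
  also have "\<dots> = hcomp t (rename g f)"
    unfolding rename_def by (auto simp: hcomp_sum hcomp_single lookup_hcomp when_def intro!: sum.cong)
  finally show ?thesis by simp
qed

section \<open>The Hilbert series of a tensor product\<close>

lemma linear_image_span:
  assumes "Vector_Spaces.linear scale scale \<phi>" and "f \<in> mpoly_vs.span A"
  shows "\<phi> f \<in> mpoly_vs.span (\<phi> ` A)"
proof -
  interpret Vector_Spaces.linear scale scale \<phi> by (rule assms(1))
  show ?thesis using assms(2) span_image by auto
qed

lemma span_mult:
  assumes "f \<in> mpoly_vs.span A" and "g \<in> mpoly_vs.span B"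
  shows "f * g \<in> mpoly_vs.span {a * b |a b. a \<in> A \<and> b \<in> B}"
proof -
  let ?S = "mpoly_vs.span {a * b |a b. a \<in> A \<and> b \<in> B}"
  have ab: "a * g \<in> ?S" if a: "a \<in> A" for a
  proof -
    have "B \<subseteq> {g. a * g \<in> ?S}" using a by (auto intro: mpoly_vs.span_base)
    moreover have "mpoly_vs.subspace {g. a * g \<in> ?S}"
      by (auto simp: mpoly_vs.subspace_def distrib_left mult_scale_right
          intro: mpoly_vs.span_add mpoly_vs.span_scale mpoly_vs.span_zero)
    ultimately have "mpoly_vs.span B \<subseteq> {g. a * g \<in> ?S}" by (rule mpoly_vs.span_minimal)
    then show ?thesis using assms(2) by auto
  qed
  have "A \<subseteq> {f. f * g \<in> ?S}" using ab by auto
  moreover have "mpoly_vs.subspace {f. f * g \<in> ?S}"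
    by (auto simp: mpoly_vs.subspace_def distrib_right mult_scale_left
        intro: mpoly_vs.span_add mpoly_vs.span_scale mpoly_vs.span_zero)
  ultimately have "mpoly_vs.span A \<subseteq> {f. f * g \<in> ?S}" by (rule mpoly_vs.span_minimal)
  then show ?thesis using assms(1) by auto
qed

text \<open>A basis chosen inside \<open>B\<close> has \<open>dim V\<close> elements and therefore
  exhausts \<open>B\<close>. This turns a count of products of basis elements into their
  independence.\<close>

lemma (in vector_space) independent_if_card_le_dim:
  assumes "B \<subseteq> V" and "V \<subseteq> span B" and "finite B" and "card B \<le> dim V"
  shows "independent B"
proof -
  obtain C where C: "C \<subseteq> B" "independent C" "B \<subseteq> span C"
    using maximal_independent_subset by blast
  have "V \<subseteq> span C" using assms(2) span_minimal[OF C(3) subspace_span] by auto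
  then have "card C = dim V" using basis_card_eq_dim[of C V] C(1,2) assms(1) by auto
  then have "C = B" using assms(3,4) C(1) card_seteq by metis
  then show ?thesis using C(2) by simp
qed

section \<open>Pure tensors and the ideal of a tensor product\<close>

definition tens :: "('x, 'k::field) mpoly \<Rightarrow> ('y, 'k) mpoly \<Rightarrow> ('x + 'y, 'k) mpoly" where
  "tens f g = rename Inl f * rename Inr g"

lemma tens_polys: "f \<in> polys X \<Longrightarrow> g \<in> polys Y \<Longrightarrow> tens f g \<in> polys (X <+> Y)"
  unfolding tens_def by (intro polys_mult rename_polys) auto

lemma tens_mult: "tens f g * tens f' g' = tens (f * f') (g * g')"
  by (simp add: tens_def rename_mult ac_simps)

lemma tens_single:
  "tens (Poly_Mapping.single m c) (Poly_Mapping.single n d) =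
    Poly_Mapping.single (rename_mon Inl m + rename_mon Inr n) (c * d)"
  by (simp add: tens_def mult_single)

lemma hcomp_tens: "hcomp t (tens f g) = (\<Sum>i\<le>t. tens (hcomp i f) (hcomp (t - i) g))"
  by (simp add: tens_def hcomp_mult hcomp_rename)

lemma span_tens:
  assumes "f \<in> mpoly_vs.span A" and "g \<in> mpoly_vs.span B"
  shows "tens f g \<in> mpoly_vs.span {tens a b |a b. a \<in> A \<and> b \<in> B}"
proof -
  have "rename Inl f \<in> mpoly_vs.span (rename Inl ` A)" "rename Inr g \<in> mpoly_vs.span (rename Inr ` B)"
    using assms by (auto intro: linear_image_span[OF linear_rename])
  then have "tens f g \<in> mpoly_vs.span {a * b |a b. a \<in> rename Inl ` A \<and> b \<in> rename Inr ` B}"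
    unfolding tens_def by (rule span_mult)
  also have "{a * b |a b. a \<in> rename Inl ` A \<and> b \<in> rename Inr ` B} = {tens a b |a b. a \<in> A \<and> b \<in> B}"
    by (auto simp: tens_def)
  finally show ?thesis .
qed

lemma monomial_Plus:
  fixes m :: "'x + 'y \<Rightarrow>\<^sub>0 nat"
  assumes "Poly_Mapping.keys m \<subseteq> X <+> Y"
  obtains m1 m2 where "m = rename_mon Inl m1 + rename_mon Inr m2"
    and "Poly_Mapping.keys m1 \<subseteq> X" and "Poly_Mapping.keys m2 \<subseteq> Y"
proof -
  define m1 where "m1 = Poly_Mapping.map_key Inl m"
  define m2 where "m2 = Poly_Mapping.map_key Inr m"
  have l: "Poly_Mapping.lookup m1 x = Poly_Mapping.lookup m (Inl x)"
    "Poly_Mapping.lookup m2 y = Poly_Mapping.lookup m (Inr y)" for x y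
    by (simp_all add: m1_def m2_def map_key.rep_eq)
  have "m = rename_mon Inl m1 + rename_mon Inr m2"
  proof (rule poly_mapping_eqI)
    fix z show "Poly_Mapping.lookup m z = Poly_Mapping.lookup (rename_mon Inl m1 + rename_mon Inr m2) z"
    proof (cases z)
      case (Inl x)
      have "Poly_Mapping.lookup (rename_mon Inr m2) z = 0"
        using Inl by (intro lookup_rename_mon_notin) auto
      then show ?thesis using Inl by (simp add: lookup_add lookup_rename_mon l)
    next
      case (Inr y)
      have "Poly_Mapping.lookup (rename_mon Inl m1) z = 0"
        using Inr by (intro lookup_rename_mon_notin) auto
      then show ?thesis using Inr by (simp add: lookup_add lookup_rename_mon l)
    qed
  qed
  moreover have "Inl ` Poly_Mapping.keys m1 \<subseteq> Poly_Mapping.keys m" "Inr ` Poly_Mapping.keys m2 \<subseteq> Poly_Mapping.keys m"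
    by (auto simp: in_keys_iff l)
  then have "Poly_Mapping.keys m1 \<subseteq> X" "Poly_Mapping.keys m2 \<subseteq> Y"
    using assms by blast+
  ultimately show thesis using that by blast
qed

lemma card_monomials_Plus:
  assumes "finite X" and "finite Y"
  shows "card (monomials (X <+> Y) t) = (\<Sum>a\<le>t. card (monomials X a) * card (monomials Y (t - a)))"
proof -
  \<comment> \<open>The index \<open>a\<close> is the degree of the first monomial; carrying it
    along makes \<open>D\<close> a disjoint sum whose cardinality is the claimed
    convolution.\<close>
  define D where "D = (SIGMA a:{..t}. monomials X a \<times> monomials Y (t - a))"
  define \<phi> :: "nat \<times> ('a \<Rightarrow>\<^sub>0 nat) \<times> ('b \<Rightarrow>\<^sub>0 nat) \<Rightarrow> _"
    where "\<phi> = (\<lambda>(a, m, n). rename_mon Inl m + rename_mon Inr n)"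
  have "bij_betw \<phi> D (monomials (X <+> Y) t)"
  proof (rule bij_betw_imageI)
    have lk: "Poly_Mapping.lookup (rename_mon Inl m + rename_mon Inr n) (Inl x) = Poly_Mapping.lookup m x"
      "Poly_Mapping.lookup (rename_mon Inl m + rename_mon Inr n) (Inr y) = Poly_Mapping.lookup n y"
      for m :: "'a \<Rightarrow>\<^sub>0 nat" and n :: "'b \<Rightarrow>\<^sub>0 nat" and x y
      by (simp_all add: lookup_add lookup_rename_mon lookup_rename_mon_notin image_iff)
    show "inj_on \<phi> D"
    proof (rule inj_onI, clarsimp simp: D_def \<phi>_def monomials_def)
      fix m m' :: "'a \<Rightarrow>\<^sub>0 nat" and n n' :: "'b \<Rightarrow>\<^sub>0 nat"
      assume "rename_mon Inl m + rename_mon Inr n = rename_mon Inl m' + rename_mon Inr n'"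
      then have "m = m'" "n = n'" using lk by (metis poly_mapping_eqI)+
      then show "mon_deg m = mon_deg m' \<and> m = m' \<and> n = n'" by simp
    qed
    show "\<phi> ` D = monomials (X <+> Y) t"
    proof (intro equalityI subsetI)
      fix m assume "m \<in> \<phi> ` D"
      then show "m \<in> monomials (X <+> Y) t"
        using keys_rename_mon[of "Inl :: 'a \<Rightarrow> 'a + 'b"] keys_rename_mon[of "Inr :: 'b \<Rightarrow> 'a + 'b"]
        by (fastforce simp: D_def \<phi>_def monomials_def mon_deg_add keys_add_nat)
    next
      fix m assume m: "m \<in> monomials (X <+> Y) t"
      then have "Poly_Mapping.keys m \<subseteq> X <+> Y" by (simp add: monomials_def)
      then obtain m1 m2 where m12: "m = rename_mon Inl m1 + rename_mon Inr m2"
        "Poly_Mapping.keys m1 \<subseteq> X" "Poly_Mapping.keys m2 \<subseteq> Y"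
        by (rule monomial_Plus)
      then have "(mon_deg m1, m1, m2) \<in> D" using m by (auto simp: D_def monomials_def mon_deg_add)
      then show "m \<in> \<phi> ` D" using m12 by (force simp: \<phi>_def)
    qed
  qed
  then have "card (monomials (X <+> Y) t) = card D" using bij_betw_same_card by metis
  then show ?thesis using finite_monomials[OF assms(1)] finite_monomials[OF assms(2)]
    by (simp add: D_def card_SigmaI card_cartesian_product)
qed

text \<open>\<open>B\<close> is a basis of the degree \<open>t\<close> part of \<open>J\<close> and
  \<open>C\<close> completes it to one of the whole graded part, so \<open>C\<close> represents a
  basis of the quotient in degree \<open>t\<close>.\<close>

lemma ex_adapted_basis:
  fixes J :: "('x, 'k::field) mpoly set"
  assumes X: "finite X"
  shows "\<exists>B C. finite (B \<union> C) \<and> B \<subseteq> J \<and> B \<union> C \<subseteq> graded_part X t \<and> B \<inter> C = {} \<and>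
    J \<inter> graded_part X t \<subseteq> mpoly_vs.span B \<and> graded_part X t \<subseteq> mpoly_vs.span (B \<union> C) \<and>
    card (B \<union> C) = mpoly_vs.dim (graded_part X t :: ('x, 'k) mpoly set) \<and> card C = hilbert_fun X J t"
proof -
  obtain B where B: "B \<subseteq> J \<inter> graded_part X t" "mpoly_vs.independent B" "J \<inter> graded_part X t \<subseteq> mpoly_vs.span B"
    "card B = mpoly_vs.dim (J \<inter> graded_part X t)"
    using mpoly_vs.basis_exists by blast
  then obtain E where E: "B \<subseteq> E" "E \<subseteq> graded_part X t" "mpoly_vs.independent E" "graded_part X t \<subseteq> mpoly_vs.span E"
    using mpoly_vs.maximal_independent_subset_extend[of B "graded_part X t"] by blast
  obtain T :: "('x, 'k) mpoly set" where T: "graded_part X t \<subseteq> mpoly_vs.span T" "finite T"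
    using graded_part_finite_span[OF X] by blast
  have fin: "finite E"
    using mpoly_vs.independent_span_bound[OF T(2) E(3) order_trans[OF E(2) T(1)]] by simp
  have cE: "card E = mpoly_vs.dim (graded_part X t :: ('x, 'k) mpoly set)"
    using E by (intro mpoly_vs.basis_card_eq_dim)
  have "card (E - B) = card E - card B" using E(1) fin by (intro card_Diff_subset) (auto intro: finite_subset)
  then have "card (E - B) = hilbert_fun X J t" by (simp add: cE B(4) hilbert_fun_def)
  moreover have "B \<union> (E - B) = E" using E(1) by auto
  ultimately show ?thesis
    using B E fin cE by (intro exI[of _ B] exI[of _ "E - B"]) auto
qed

lemma ideal_tensor_ideal:
  fixes I :: "('x, 'k::field) mpoly set" and I' :: "('y, 'k) mpoly set"
  assumes "I \<subseteq> polys X" and "I' \<subseteq> polys Y"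
  shows "ideal (tensor_ideal X Y I I') (poly_ring (X <+> Y))"
    and "rename Inl ` I \<union> rename Inr ` I' \<subseteq> tensor_ideal X Y I I'"
proof -
  interpret cring "poly_ring (X <+> Y) :: ('x + 'y, 'k) mpoly ring" by (rule cring_poly_ring)
  have sub: "rename Inl ` I \<union> rename Inr ` I' \<subseteq> polys (X <+> Y)"
    using assms by (auto intro!: rename_polys)
  show "ideal (tensor_ideal X Y I I') (poly_ring (X <+> Y))"
    unfolding tensor_ideal_def by (rule genideal_ideal[OF sub])
  show "rename Inl ` I \<union> rename Inr ` I' \<subseteq> tensor_ideal X Y I I'"
    unfolding tensor_ideal_def by (rule genideal_self[OF sub])
qed

lemma polys_Plus_span:
  "polys (X <+> Y) \<subseteq> mpoly_vs.span {tens f g |f g. f \<in> polys X \<and> g \<in> polys Y}"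
proof
  fix h :: "('a + 'b, 'c) mpoly" assume h: "h \<in> polys (X <+> Y)"
  have "(\<lambda>m. Poly_Mapping.single m 1) ` Poly_Mapping.keys h \<subseteq> {tens f g |f g. f \<in> polys X \<and> g \<in> polys Y}"
  proof clarify
    fix m assume "m \<in> Poly_Mapping.keys h"
    then have "Poly_Mapping.keys m \<subseteq> X <+> Y" using h by (auto simp: polys_def)
    then obtain m1 m2 where "m = rename_mon Inl m1 + rename_mon Inr m2"
      "Poly_Mapping.keys m1 \<subseteq> X" "Poly_Mapping.keys m2 \<subseteq> Y"
      by (rule monomial_Plus)
    then show "\<exists>f g. Poly_Mapping.single m 1 = tens f g \<and> f \<in> polys X \<and> g \<in> polys Y"
      by (intro exI[of _ "Poly_Mapping.single m1 1"] exI[of _ "Poly_Mapping.single m2 1"]) (simp add: tens_single)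
  qed
  then show "h \<in> mpoly_vs.span {tens f g |f g. f \<in> polys X \<and> g \<in> polys Y}"
    using in_span_monomials[of h "Poly_Mapping.keys h"] mpoly_vs.span_mono by blast
qed

lemma tens_in_tensor_ideal:
  assumes I: "ideal I (poly_ring X)" "ideal I' (poly_ring Y)"
    and f: "f \<in> polys X" "g \<in> polys Y" "f \<in> I \<or> g \<in> I'"
  shows "tens f g \<in> tensor_ideal X Y I I'"
proof -
  note J = ideal_tensor_ideal[OF ideal_subset_polys[OF I(1)] ideal_subset_polys[OF I(2)]]
  have "rename Inl f \<in> polys (X <+> Y)" "rename Inr g \<in> polys (X <+> Y)"
    using f by (auto intro!: rename_polys)
  then show ?thesis
    unfolding tens_def using f(3) J(2) ideal_mult[OF J(1)] ideal_mult_right[OF J(1)] by blast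
qed

text \<open>The description of the ideal as \<open>I \<otimes> S' + S \<otimes> I'\<close>. Pure
  tensors multiply factor by factor, so the span is already an ideal, and it contains the
  generators. Linear arguments can then be checked on pure tensors.\<close>

lemma tensor_ideal_eq_span:
  fixes I :: "('x, 'k::field) mpoly set" and I' :: "('y, 'k) mpoly set"
  assumes I: "ideal I (poly_ring X)" "ideal I' (poly_ring Y)"
  shows "tensor_ideal X Y I I' =
    mpoly_vs.span {tens f g |f g. f \<in> polys X \<and> g \<in> polys Y \<and> (f \<in> I \<or> g \<in> I')}"
    (is "?J = mpoly_vs.span ?T")
proof
  interpret cring "poly_ring (X <+> Y) :: ('x + 'y, 'k) mpoly ring" by (rule cring_poly_ring)
  note sub = ideal_subset_polys[OF I(1)] ideal_subset_polys[OF I(2)]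
  note J = ideal_tensor_ideal[OF sub]
  show "mpoly_vs.span ?T \<subseteq> ?J"
    using tens_in_tensor_ideal[OF I] by (intro mpoly_vs.span_minimal subspace_ideal[OF J(1)]) auto
  have TJ: "mpoly_vs.span ?T \<subseteq> polys (X <+> Y)"
    using tens_polys by (intro mpoly_vs.span_minimal subspace_polys) auto
  have "ideal (mpoly_vs.span ?T) (poly_ring (X <+> Y))"
  proof (rule ideal_poly_ringI[OF TJ mpoly_vs.span_zero mpoly_vs.span_add])
    show "h * u \<in> mpoly_vs.span ?T" if u: "u \<in> mpoly_vs.span ?T" and h: "h \<in> polys (X <+> Y)" for u h
    proof -
      have "h \<in> mpoly_vs.span {tens f g |f g. f \<in> polys X \<and> g \<in> polys Y}"
        using h polys_Plus_span by blast
      then have "h * u \<in> mpoly_vs.span {a * b |a b. a \<in> {tens f g |f g. f \<in> polys X \<and> g \<in> polys Y} \<and> b \<in> ?T}"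
        using u by (rule span_mult)
      moreover have "{a * b |a b. a \<in> {tens f g |f g. f \<in> polys X \<and> g \<in> polys Y} \<and> b \<in> ?T} \<subseteq> ?T"
      proof clarify
        fix f f' :: "('x, 'k) mpoly" and g g' :: "('y, 'k) mpoly"
        assume *: "f \<in> polys X" "g \<in> polys Y" "f' \<in> polys X" "g' \<in> polys Y" "f' \<in> I \<or> g' \<in> I'"
        then have "f * f' \<in> I \<or> g * g' \<in> I'" using ideal_mult[OF I(1)] ideal_mult[OF I(2)] by blast
        then show "\<exists>fa ga. tens f g * tens f' g' = tens fa ga \<and> fa \<in> polys X \<and> ga \<in> polys Y \<and> (fa \<in> I \<or> ga \<in> I')"
          using * by (intro exI[of _ "f * f'"] exI[of _ "g * g'"]) (simp add: tens_mult)
      qed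
      ultimately show ?thesis using mpoly_vs.span_mono by blast
    qed
  qed
  moreover have "rename Inl ` I \<union> rename Inr ` I' \<subseteq> mpoly_vs.span ?T"
  proof -
    have "rename Inl f \<in> ?T" if "f \<in> I" for f
      using that sub by (intro CollectI exI[of _ f] exI[of _ 1]) (auto simp: tens_def)
    moreover have "rename Inr g \<in> ?T" if "g \<in> I'" for g
      using that sub by (intro CollectI exI[of _ 1] exI[of _ g]) (auto simp: tens_def)
    ultimately show ?thesis using mpoly_vs.span_superset by blast
  qed
  ultimately show "?J \<subseteq> mpoly_vs.span ?T"
    unfolding tensor_ideal_def by (rule genideal_minimal)
qed

lemma hcomp_span: "u \<in> mpoly_vs.span T \<Longrightarrow> hcomp t u \<in> mpoly_vs.span (hcomp t ` T)"
  by (rule linear_image_span[OF linear_hcomp])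

text \<open>A component of a pure tensor is a sum of pure tensors of components, and a factor in a
  homogeneous ideal keeps its components there.\<close>

lemma hom_ideal_tensor_ideal:
  assumes I: "hom_ideal X I" "hom_ideal Y I'"
  shows "hom_ideal (X <+> Y) (tensor_ideal X Y I I')"
proof -
  have I0: "ideal I (poly_ring X)" "ideal I' (poly_ring Y)" using I by (auto simp: hom_ideal_def)
  note J = ideal_tensor_ideal(1)[OF ideal_subset_polys[OF I0(1)] ideal_subset_polys[OF I0(2)]]
  have "hcomp t u \<in> tensor_ideal X Y I I'" if u: "u \<in> tensor_ideal X Y I I'" for u t
  proof -
    let ?T = "{tens f g |f g. f \<in> polys X \<and> g \<in> polys Y \<and> (f \<in> I \<or> g \<in> I')}"
    have "hcomp t ` ?T \<subseteq> tensor_ideal X Y I I'"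
    proof clarify
      fix f g assume fg: "f \<in> polys X" "g \<in> polys Y" "f \<in> I \<or> g \<in> I'"
      then show "hcomp t (tens f g) \<in> tensor_ideal X Y I I'"
        unfolding hcomp_tens using I
        by (intro ideal_sum[OF J] tens_in_tensor_ideal[OF I0]) (auto simp: hom_ideal_def)
    qed
    then have "mpoly_vs.span (hcomp t ` ?T) \<subseteq> tensor_ideal X Y I I'"
      by (intro mpoly_vs.span_minimal subspace_ideal[OF J])
    then show ?thesis using hcomp_span[of u ?T t] u tensor_ideal_eq_span[OF I0] by auto
  qed
  then show ?thesis using J by (auto simp: hom_ideal_def)
qed

text \<open>
  Products of bases adapted to the two ideals span the graded part, and by counting monomials there are only
  as many of them as its dimension, so they are a basis. No coefficients have to be compared.
\<close>

lemma hilbert_fun_tensor_ideal: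
  fixes I :: "('x, 'k::field) mpoly set" and I' :: "('y, 'k) mpoly set"
  assumes X: "finite X" "finite Y" and I: "hom_ideal X I" "hom_ideal Y I'"
  shows "hilbert_fun (X <+> Y) (tensor_ideal X Y I I') t = (\<Sum>a\<le>t. hilbert_fun X I a * hilbert_fun Y I' (t - a))"
proof -
  let ?J = "tensor_ideal X Y I I'"
  have I0: "ideal I (poly_ring X)" "ideal I' (poly_ring Y)" using I by (auto simp: hom_ideal_def)
  obtain B C where BC: "\<And>a. finite (B a \<union> C a)" "\<And>a. B a \<subseteq> I" "\<And>a. B a \<union> C a \<subseteq> graded_part X a"
    "\<And>a. B a \<inter> C a = {}" "\<And>a. I \<inter> graded_part X a \<subseteq> mpoly_vs.span (B a)"
    "\<And>a. graded_part X a \<subseteq> mpoly_vs.span (B a \<union> C a)"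
    "\<And>a. card (B a \<union> C a) = mpoly_vs.dim (graded_part X a :: ('x, 'k) mpoly set)"
    "\<And>a. card (C a) = hilbert_fun X I a"
    using ex_adapted_basis[OF X(1), of I] by metis
  obtain B' C' where BC': "\<And>a. finite (B' a \<union> C' a)" "\<And>a. B' a \<subseteq> I'" "\<And>a. B' a \<union> C' a \<subseteq> graded_part Y a"
    "\<And>a. B' a \<inter> C' a = {}" "\<And>a. I' \<inter> graded_part Y a \<subseteq> mpoly_vs.span (B' a)"
    "\<And>a. graded_part Y a \<subseteq> mpoly_vs.span (B' a \<union> C' a)"
    "\<And>a. card (B' a \<union> C' a) = mpoly_vs.dim (graded_part Y a :: ('y, 'k) mpoly set)"
    "\<And>a. card (C' a) = hilbert_fun Y I' a"
    using ex_adapted_basis[OF X(2), of I'] by metis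
  define E where "E a = B a \<union> C a" for a
  define E' where "E' a = B' a \<union> C' a" for a
  \<comment> \<open>\<open>D\<close> indexes all products of basis elements of total degree
    \<open>t\<close>, and \<open>DC\<close> those with neither factor from the bases of the ideals.
    The latter will represent a basis of the quotient, the remaining ones a basis of the
    ideal.\<close>
  define D where "D = (SIGMA a:{..t}. E a \<times> E' (t - a))"
  define DC where "DC = (SIGMA a:{..t}. C a \<times> C' (t - a))"
  define \<tau> :: "nat \<times> ('x, 'k) mpoly \<times> ('y, 'k) mpoly \<Rightarrow> ('x + 'y, 'k) mpoly"
    where "\<tau> = (\<lambda>(a, e, e'). tens e e')"
  let ?G = "graded_part (X <+> Y) t :: ('x + 'y, 'k) mpoly set"
  have fin: "finite D" using BC(1) BC'(1) by (simp add: D_def E_def E'_def)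
  have DCD: "DC \<subseteq> D" by (auto simp: D_def DC_def E_def E'_def)
  have cardD: "card D = mpoly_vs.dim ?G"
    using BC(1,7) BC'(1,7)
    by (simp add: D_def E_def E'_def dim_graded_part card_monomials_Plus[OF X])
  have cardDC: "card DC = (\<Sum>a\<le>t. hilbert_fun X I a * hilbert_fun Y I' (t - a))"
    using BC(1,8) BC'(1,8) by (simp add: DC_def)
  have tens_E: "tens f g \<in> mpoly_vs.span (\<tau> ` (Sigma {a} (\<lambda>_. U \<times> V)))"
    if "f \<in> mpoly_vs.span U" "g \<in> mpoly_vs.span V" for f g U V and a :: nat
  proof -
    have "{tens x y |x y. x \<in> U \<and> y \<in> V} = \<tau> ` (Sigma {a} (\<lambda>_. U \<times> V))"
      by (force simp: \<tau>_def)
    then show ?thesis using span_tens[OF that] by simp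
  qed
  have "\<tau> ` D \<subseteq> ?G"
  proof clarify
    fix a e e' assume "(a, e, e') \<in> D"
    then have "a \<le> t" "e \<in> graded_part X a" "e' \<in> graded_part Y (t - a)"
      using BC(3) BC'(3) unfolding D_def E_def E'_def by blast+
    then show "\<tau> (a, e, e') \<in> ?G"
      using tens_polys[of e X e' Y] homogeneous_mult[OF rename_homogeneous rename_homogeneous, of a e "t - a" e' Inl Inr]
      by (simp add: \<tau>_def graded_part_def tens_def)
  qed
  moreover have "?G \<subseteq> mpoly_vs.span (\<tau> ` D)"
  proof -
    have "Poly_Mapping.single m 1 \<in> mpoly_vs.span (\<tau> ` D)" if m: "m \<in> monomials (X <+> Y) t" for m
    proof -
      have "Poly_Mapping.keys m \<subseteq> X <+> Y" using m by (simp add: monomials_def)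
      then obtain m1 m2 where m12: "m = rename_mon Inl m1 + rename_mon Inr m2"
        "Poly_Mapping.keys m1 \<subseteq> X" "Poly_Mapping.keys m2 \<subseteq> Y"
        by (rule monomial_Plus)
      let ?a = "mon_deg m1"
      have a: "?a \<le> t" "mon_deg m2 = t - ?a" using m m12 by (auto simp: monomials_def mon_deg_add)
      have "Poly_Mapping.single m1 1 \<in> graded_part X ?a" "Poly_Mapping.single m2 1 \<in> graded_part Y (t - ?a)"
        using m12 a by (auto simp: graded_part_def homogeneous_def)
      then have "tens (Poly_Mapping.single m1 1) (Poly_Mapping.single m2 1) \<in>
          mpoly_vs.span (\<tau> ` (Sigma {?a} (\<lambda>_. E ?a \<times> E' (t - ?a))))"
        using BC(6) BC'(6) unfolding E_def E'_def by (intro tens_E) blast+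
      moreover have "Sigma {?a} (\<lambda>_. E ?a \<times> E' (t - ?a)) \<subseteq> D" using a by (auto simp: D_def)
      ultimately show ?thesis
        using mpoly_vs.span_mono[OF image_mono, of _ D \<tau>] m12(1) by (auto simp: tens_single)
    qed
    then have "mpoly_vs.span ((\<lambda>m. Poly_Mapping.single m 1) ` monomials (X <+> Y) t) \<subseteq> mpoly_vs.span (\<tau> ` D)"
      by (intro mpoly_vs.span_minimal mpoly_vs.subspace_span) auto
    then show ?thesis using graded_part_span by blast
  qed
  ultimately have GD: "\<tau> ` D \<subseteq> ?G" "?G \<subseteq> mpoly_vs.span (\<tau> ` D)" by blast+
  \<comment> \<open>The products span, so at least \<open>card D\<close> of them are distinct. Hence
    none coincide, and they are independent.\<close>
  have "mpoly_vs.dim ?G \<le> card (\<tau> ` D)" using mpoly_vs.dim_le_card[OF GD(2)] fin by simp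
  then have "card (\<tau> ` D) = card D" using cardD card_image_le[OF fin, of \<tau>] by simp
  then have inj: "inj_on \<tau> D" using fin eq_card_imp_inj_on by blast
  have ind: "mpoly_vs.independent (\<tau> ` D)"
    using mpoly_vs.independent_if_card_le_dim[OF GD] fin \<open>card (\<tau> ` D) = card D\<close> cardD by simp
  \<comment> \<open>Outside \<open>DC\<close> at least one factor belongs to its ideal, so these
    products lie in \<open>?J\<close>; the task is to show that they span its degree
    \<open>t\<close> part.\<close>
  have "mpoly_vs.dim (?J \<inter> ?G) = card (\<tau> ` (D - DC))"
  proof (rule mpoly_vs.dim_unique)
    show "\<tau> ` (D - DC) \<subseteq> ?J \<inter> ?G"
    proof clarify
      fix a e e' assume d: "(a, e, e') \<in> D" "(a, e, e') \<notin> DC"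
      then have "e \<in> I \<or> e' \<in> I'" using BC(2) BC'(2) unfolding D_def DC_def E_def E'_def by blast
      moreover have "e \<in> polys X" "e' \<in> polys Y"
        using d BC(3) BC'(3) unfolding D_def E_def E'_def graded_part_def by blast+
      ultimately have "\<tau> (a, e, e') \<in> ?J" using tens_in_tensor_ideal[OF I0] by (simp add: \<tau>_def)
      then show "\<tau> (a, e, e') \<in> ?J \<inter> ?G" using GD(1) d(1) by blast
    qed
    show "?J \<inter> ?G \<subseteq> mpoly_vs.span (\<tau> ` (D - DC))"
    proof
      \<comment> \<open>Since \<open>u\<close> is its own component of degree \<open>t\<close>, it
        suffices to expand the components of the pure tensors spanning \<open>?J\<close>. A factor
        in an ideal is expanded in the basis of that ideal only, which avoids
        \<open>DC\<close>.\<close>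
      fix u assume u: "u \<in> ?J \<inter> ?G"
      let ?T = "{tens f g |f g. f \<in> polys X \<and> g \<in> polys Y \<and> (f \<in> I \<or> g \<in> I')}"
      have "hcomp t ` ?T \<subseteq> mpoly_vs.span (\<tau> ` (D - DC))"
      proof clarify
        fix f g assume fg: "f \<in> polys X" "g \<in> polys Y" "f \<in> I \<or> g \<in> I'"
        have "tens (hcomp a f) (hcomp (t - a) g) \<in> mpoly_vs.span (\<tau> ` (D - DC))" if a: "a \<le> t" for a
        proof -
          have f: "hcomp a f \<in> graded_part X a" and g: "hcomp (t - a) g \<in> graded_part Y (t - a)"
            using fg by (auto simp: graded_part_def homogeneous_hcomp)
          from fg(3) show ?thesis
          proof
            assume "f \<in> I"
            then have "hcomp a f \<in> I \<inter> graded_part X a" using I(1) f by (auto simp: hom_ideal_def)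
            then have "hcomp a f \<in> mpoly_vs.span (B a)" using BC(5) by blast
            moreover have "hcomp (t - a) g \<in> mpoly_vs.span (E' (t - a))" using g BC'(6) unfolding E'_def by blast
            ultimately have "tens (hcomp a f) (hcomp (t - a) g) \<in>
              mpoly_vs.span (\<tau> ` (Sigma {a} (\<lambda>_. B a \<times> E' (t - a))))" by (rule tens_E)
            moreover have "Sigma {a} (\<lambda>_. B a \<times> E' (t - a)) \<subseteq> D - DC"
              using a BC(4)[of a] by (auto simp: D_def DC_def E_def)
            ultimately show ?thesis using mpoly_vs.span_mono[OF image_mono] by blast
          next
            assume "g \<in> I'"
            then have "hcomp (t - a) g \<in> I' \<inter> graded_part Y (t - a)" using I(2) g by (auto simp: hom_ideal_def)
            then have "hcomp (t - a) g \<in> mpoly_vs.span (B' (t - a))" using BC'(5) by blast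
            moreover have "hcomp a f \<in> mpoly_vs.span (E a)" using f BC(6) unfolding E_def by blast
            ultimately have "tens (hcomp a f) (hcomp (t - a) g) \<in>
              mpoly_vs.span (\<tau> ` (Sigma {a} (\<lambda>_. E a \<times> B' (t - a))))" by (intro tens_E)
            moreover have "Sigma {a} (\<lambda>_. E a \<times> B' (t - a)) \<subseteq> D - DC"
              using a BC'(4)[of "t - a"] by (auto simp: D_def DC_def E'_def)
            ultimately show ?thesis using mpoly_vs.span_mono[OF image_mono] by blast
          qed
        qed
        then show "hcomp t (tens f g) \<in> mpoly_vs.span (\<tau> ` (D - DC))"
          unfolding hcomp_tens by (intro mpoly_vs.span_sum) auto
      qed
      then have "mpoly_vs.span (hcomp t ` ?T) \<subseteq> mpoly_vs.span (\<tau> ` (D - DC))"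
        by (intro mpoly_vs.span_minimal mpoly_vs.subspace_span)
      moreover have "hcomp t u \<in> mpoly_vs.span (hcomp t ` ?T)"
        using u tensor_ideal_eq_span[OF I0] by (intro hcomp_span) auto
      moreover have "hcomp t u = u" using u hcomp_homogeneous[of t u t] by (simp add: graded_part_def)
      ultimately show "u \<in> mpoly_vs.span (\<tau> ` (D - DC))" by auto
    qed
    show "mpoly_vs.independent (\<tau> ` (D - DC))"
      using ind by (rule mpoly_vs.independent_mono) auto
  qed simp
  also have "\<dots> = card D - card DC"
    using inj_on_subset[OF inj, of "D - DC"] DCD fin
    by (simp add: card_image card_Diff_subset finite_subset)
  finally have "hilbert_fun (X <+> Y) ?J t = card D - (card D - card DC)"
    by (simp add: hilbert_fun_def cardD)
  also have "\<dots> = card DC" using card_mono[OF fin DCD] by simp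
  finally show ?thesis using cardDC by simp
qed

lemma hilbert_series_tensor_ideal:
  assumes "finite X" "finite Y" and "hom_ideal X I" "hom_ideal Y I'"
  shows "hilbert_series (X <+> Y) (tensor_ideal X Y I I') = hilbert_series X I * hilbert_series Y I'"
  by (rule fps_ext)
    (simp add: hilbert_series_def hilbert_fun_tensor_ideal[OF assms] fps_mult_nth atLeast0AtMost)

section \<open>Shifts in a tensor product\<close>

text \<open>The data of a resolution on which extremal shifts depend, in a form that passes directly
  to \<open>tensor_complex\<close>.\<close>

definition positively_shifted :: "('x, 'k, 'b) graded_complex \<Rightarrow> bool" where
  "positively_shifted F \<longleftrightarrow> (\<forall>i. finite (basis F i)) \<and> (\<forall>i\<ge>1. \<forall>b\<in>basis F i. shift F i b > 0) \<and>
    (\<exists>b. basis F 0 = {b} \<and> shift F 0 b = 0)"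

lemma positively_shifted_resolution: "graded_free_resolution X I F \<Longrightarrow> positively_shifted F"
  unfolding graded_free_resolution_def positively_shifted_def
  by (elim conjE exE) (intro conjI exI; assumption)

lemma shift_pos: "positively_shifted F \<Longrightarrow> i \<ge> 1 \<Longrightarrow> b \<in> basis F i \<Longrightarrow> 0 < shift F i b"
  by (simp add: positively_shifted_def)

text \<open>\<open>betti\<close> is a cardinality, so finiteness of the basis ensures that every
  occurring shift has a nonzero value.\<close>

lemma betti_support:
  assumes "positively_shifted F"
  shows "{j. betti F i j \<noteq> 0} = shift F i ` basis F i"
proof -
  have "finite (basis F i)" using assms by (simp add: positively_shifted_def)
  then show ?thesis by (auto simp: betti_def)
qed

lemma min_shift_eq:
  assumes F: "positively_shifted F" and "basis F i \<noteq> {}"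
  obtains b where "b \<in> basis F i" and "min_shift F i = enat (shift F i b)"
proof -
  let ?S = "enat ` shift F i ` basis F i"
  have fin: "finite ?S" using F by (simp add: positively_shifted_def)
  have "min_shift F i = Min ?S"
    unfolding min_shift_def betti_support[OF F] using fin assms(2) by (intro Min_Inf[symmetric]) auto
  moreover have "Min ?S \<in> ?S" using fin assms(2) by (intro Min_in) auto
  ultimately show thesis using that by auto
qed

lemma max_shift_eq:
  assumes F: "positively_shifted F" and "basis F i \<noteq> {}"
  obtains b where "b \<in> basis F i" and "max_shift F i = enat (shift F i b)"
proof -
  let ?S = "enat ` shift F i ` basis F i"
  have fin: "finite ?S" using F by (simp add: positively_shifted_def)
  have "max_shift F i = Max ?S"
    unfolding max_shift_def betti_support[OF F] using fin assms(2) by (intro Max_Sup[symmetric]) auto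
  moreover have "Max ?S \<in> ?S" using fin assms(2) by (intro Max_in) auto
  ultimately show thesis using that by auto
qed

lemma min_shift_empty: "basis F i = {} \<Longrightarrow> min_shift F i = \<infinity>"
  by (simp add: min_shift_def betti_def top_enat_def)

lemma max_shift_empty: "basis F i = {} \<Longrightarrow> max_shift F i = 0"
  by (simp add: max_shift_def betti_def bot_enat_def)

lemma min_shift_le: "positively_shifted F \<Longrightarrow> b \<in> basis F i \<Longrightarrow> min_shift F i \<le> enat (shift F i b)"
  unfolding min_shift_def betti_support by (auto intro: INF_lower)

lemma max_shift_ge: "positively_shifted F \<Longrightarrow> b \<in> basis F i \<Longrightarrow> enat (shift F i b) \<le> max_shift F i"
  unfolding max_shift_def betti_support by (auto intro: SUP_upper)

text \<open>These values start the later induction: with one index \<open>0\<close>, a shift of the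
  tensor product is compared with a shift of the other factor alone.\<close>

lemma min_shift_0: "positively_shifted F \<Longrightarrow> min_shift F 0 = 0"
  and max_shift_0: "positively_shifted F \<Longrightarrow> max_shift F 0 = 0"
proof -
  assume F: "positively_shifted F"
  then obtain b where b: "basis F 0 = {b}" "shift F 0 b = 0" by (auto simp: positively_shifted_def)
  show "min_shift F 0 = 0" using min_shift_eq[OF F, of 0] b by (auto simp: zero_enat_def)
  show "max_shift F 0 = 0" using max_shift_eq[OF F, of 0] b by (auto simp: zero_enat_def)
qed

lemma min_shift_nz: "positively_shifted F \<Longrightarrow> i \<ge> 1 \<Longrightarrow> min_shift F i \<noteq> 0"
proof -
  assume F: "positively_shifted F" and i: "i \<ge> 1"
  show ?thesis
  proof (cases "basis F i = {}")
    case True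
    then show ?thesis by (simp add: min_shift_empty)
  next
    case False
    then obtain b where "b \<in> basis F i" "min_shift F i = enat (shift F i b)"
      using min_shift_eq[OF F] by blast
    then show ?thesis using F i by (auto simp: positively_shifted_def zero_enat_def)
  qed
qed

lemma basis_tensor: "basis (tensor_complex F G) i = {(p, b, b'). p \<le> i \<and> b \<in> basis F p \<and> b' \<in> basis G (i - p)}"
  and shift_tensor: "shift (tensor_complex F G) i (p, b, b') = shift F p b + shift G (i - p) b'"
  by (simp_all add: tensor_complex_def)

lemma positively_shifted_tensor:
  assumes F: "positively_shifted F" and G: "positively_shifted G"
  shows "positively_shifted (tensor_complex F G)"
  unfolding positively_shifted_def
proof (intro conjI allI impI ballI)
  fix i
  have "basis (tensor_complex F G) i = (\<Union>p\<in>{..i}. \<Union>b\<in>basis F p. \<Union>b'\<in>basis G (i - p). {(p, b, b')})"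
    by (auto simp: basis_tensor)
  then show "finite (basis (tensor_complex F G) i)"
    using F G by (simp add: positively_shifted_def)
next
  fix i x assume i: "1 \<le> i" and "x \<in> basis (tensor_complex F G) i"
  then obtain p b b' where x: "x = (p, b, b')" "p \<le> i" "b \<in> basis F p" "b' \<in> basis G (i - p)"
    by (auto simp: basis_tensor)
  have "p \<ge> 1 \<or> i - p \<ge> 1" using i by auto
  then have "0 < shift F p b \<or> 0 < shift G (i - p) b'"
    using shift_pos[OF F, of p b] shift_pos[OF G, of "i - p" b'] x by auto
  then show "0 < shift (tensor_complex F G) i x"
    using x by (auto simp: shift_tensor)
next
  obtain b b' where "basis F 0 = {b}" "shift F 0 b = 0" "basis G 0 = {b'}" "shift G 0 b' = 0"
    using F G by (auto simp: positively_shifted_def)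
  then show "\<exists>x. basis (tensor_complex F G) 0 = {x} \<and> shift (tensor_complex F G) 0 x = 0"
    by (intro exI[of _ "(0, b, b')"]) (auto simp: basis_tensor shift_tensor)
qed

lemma min_shift_tensor_le:
  assumes F: "positively_shifted F" and G: "positively_shifted G"
  shows "min_shift (tensor_complex F G) (p + q) \<le> min_shift F p + min_shift G q"
proof (cases "basis F p = {} \<or> basis G q = {}")
  case True
  then show ?thesis by (auto simp: min_shift_empty)
next
  case False
  then obtain b b' where b: "b \<in> basis F p" "min_shift F p = enat (shift F p b)"
    "b' \<in> basis G q" "min_shift G q = enat (shift G q b')"
    using min_shift_eq[OF F] min_shift_eq[OF G] by metis
  have "min_shift (tensor_complex F G) (p + q) \<le> enat (shift (tensor_complex F G) (p + q) (p, b, b'))"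
    by (rule min_shift_le[OF positively_shifted_tensor[OF F G]]) (use b in \<open>simp add: basis_tensor\<close>)
  then show ?thesis using b by (simp add: shift_tensor)
qed

text \<open>The largest shift of a zero module is \<open>0\<close>, so the inequality can fail when
  one module vanishes: the other may have a positive shift while no basis element of the tensor
  product arises from the pair. For smallest shifts the value \<open>\<infinity>\<close> makes that
  case trivial.\<close>

lemma max_shift_tensor_ge:
  assumes F: "positively_shifted F" and G: "positively_shifted G"
    and "basis F p \<noteq> {}" and "basis G q \<noteq> {}"
  shows "max_shift F p + max_shift G q \<le> max_shift (tensor_complex F G) (p + q)"
proof -
  obtain b b' where b: "b \<in> basis F p" "max_shift F p = enat (shift F p b)"
    "b' \<in> basis G q" "max_shift G q = enat (shift G q b')"
    using max_shift_eq[OF F] max_shift_eq[OF G] assms(3,4) by metis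
  have "enat (shift (tensor_complex F G) (p + q) (p, b, b')) \<le> max_shift (tensor_complex F G) (p + q)"
    by (rule max_shift_ge[OF positively_shifted_tensor[OF F G]]) (use b in \<open>simp add: basis_tensor\<close>)
  then show ?thesis using b by (simp add: shift_tensor)
qed

section \<open>The inequalities for products\<close>

lemma binomial_prod_Suc_Suc:
  fixes m m' :: "nat \<Rightarrow> real"
  shows "real ((Suc p + Suc q) choose Suc p) * (\<Prod>i=1..Suc p. m i) * (\<Prod>i=1..Suc q. m' i)
    = (real ((p + Suc q) choose p) * (\<Prod>i=1..p. m i) * (\<Prod>i=1..Suc q. m' i)) * m (Suc p)
    + (real ((Suc p + q) choose Suc p) * (\<Prod>i=1..Suc p. m i) * (\<Prod>i=1..q. m' i)) * m' (Suc q)"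
  by (simp add: algebra_simps)

text \<open>The last factor is bounded by \<open>m p + m' q\<close>. The product of the others is
  compared with \<open>(p - 1, q)\<close> for the first summand and with \<open>(p, q - 1)\<close>
  for the second, and Pascal's rule adds the two results.\<close>

lemma prod_le_binomial_prod:
  fixes m m' n :: "nat \<Rightarrow> real"
  assumes nn: "\<And>i. i \<le> c + c' \<Longrightarrow> 0 \<le> n i" and 0: "m 0 = 0" "m' 0 = 0"
    and le: "\<And>p q. p \<le> c \<Longrightarrow> q \<le> c' \<Longrightarrow> n (p + q) \<le> m p + m' q"
  shows "p \<le> c \<Longrightarrow> q \<le> c' \<Longrightarrow>
    (\<Prod>i=1..p + q. n i) \<le> real ((p + q) choose p) * (\<Prod>i=1..p. m i) * (\<Prod>i=1..q. m' i)"
proof (induction "p + q" arbitrary: p q)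
  case 0
  then show ?case by simp
next
  case (Suc k)
  show ?case
  proof (cases p)
    case 0
    have "(\<Prod>i=1..q. n i) \<le> (\<Prod>i=1..q. m' i)"
      using nn le[of 0] Suc.prems assms(2) 0 by (intro prod_mono) auto
    then show ?thesis using 0 by simp
  next
    case p: (Suc p')
    show ?thesis
    proof (cases q)
      case 0
      have "(\<Prod>i=1..p. n i) \<le> (\<Prod>i=1..p. m i)"
        using nn le[of _ 0] Suc.prems assms(3) 0 by (intro prod_mono) auto
      then show ?thesis using 0 by simp
    next
      case q: (Suc q')
      let ?R = "\<Prod>i=1..p' + q. n i"
      let ?L = "\<lambda>p q. real ((p + q) choose p) * (\<Prod>i=1..p. m i) * (\<Prod>i=1..q. m' i)"
      have R: "?R \<ge> 0" using nn Suc.prems p by (intro prod_nonneg) auto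
      \<comment> \<open>Only \<open>n\<close> is assumed nonnegative; comparing it with the index
        pairs \<open>(p, 0)\<close> and \<open>(0, q)\<close> gives the same for \<open>m p\<close>
        and \<open>m' q\<close>.\<close>
      have mp: "0 \<le> m p" using le[of p 0] nn[of p] Suc.prems assms(3) by auto
      have mq: "0 \<le> m' q" using le[of 0 q] nn[of q] Suc.prems assms(2) by auto
      have "(\<Prod>i=1..p + q. n i) = ?R * n (p + q)" using p by simp
      also have "\<dots> \<le> ?R * (m p + m' q)" using le Suc.prems R by (intro mult_left_mono) auto
      also have "\<dots> = ?R * m p + ?R * m' q" by (simp add: distrib_left)
      also have "\<dots> \<le> ?L p' q * m p + ?L p q' * m' q"
      proof (rule add_mono)
        show "?R * m p \<le> ?L p' q * m p"
          using Suc.hyps(1)[of p' q] Suc.hyps(2) Suc.prems p mp by (intro mult_right_mono) auto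
        \<comment> \<open>Both uses of the induction hypothesis concern the same product
          \<open>?R\<close>.\<close>
        have "p' + q = p + q'" using p q by simp
        then show "?R * m' q \<le> ?L p q' * m' q"
          using Suc.hyps(1)[of p q'] Suc.hyps(2) Suc.prems q mq by (intro mult_right_mono) auto
      qed
      also have "\<dots> = ?L p q" using binomial_prod_Suc_Suc[of p' q' m m'] p q by simp
      finally show ?thesis .
    qed
  qed
qed

lemma binomial_prod_le_prod:
  fixes m m' n :: "nat \<Rightarrow> real"
  assumes nn: "\<And>i. i \<le> c \<Longrightarrow> 0 \<le> m i" "\<And>i. i \<le> c' \<Longrightarrow> 0 \<le> m' i" and 0: "m 0 = 0" "m' 0 = 0"
    and le: "\<And>p q. p \<le> c \<Longrightarrow> q \<le> c' \<Longrightarrow> m p + m' q \<le> n (p + q)"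
  shows "p \<le> c \<Longrightarrow> q \<le> c' \<Longrightarrow>
    real ((p + q) choose p) * (\<Prod>i=1..p. m i) * (\<Prod>i=1..q. m' i) \<le> (\<Prod>i=1..p + q. n i)"
proof (induction "p + q" arbitrary: p q)
  case 0
  then show ?case by simp
next
  case (Suc k)
  show ?case
  proof (cases p)
    case 0
    have "(\<Prod>i=1..q. m' i) \<le> (\<Prod>i=1..q. n i)"
      using nn le[of 0] Suc.prems assms(3) 0 by (intro prod_mono) auto
    then show ?thesis using 0 by simp
  next
    case p: (Suc p')
    show ?thesis
    proof (cases q)
      case 0
      have "(\<Prod>i=1..p. m i) \<le> (\<Prod>i=1..p. n i)"
        using nn le[of _ 0] Suc.prems assms(4) 0 by (intro prod_mono) auto
      then show ?thesis using 0 by simp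
    next
      case q: (Suc q')
      let ?R = "\<Prod>i=1..p' + q. n i"
      let ?L = "\<lambda>p q. real ((p + q) choose p) * (\<Prod>i=1..p. m i) * (\<Prod>i=1..q. m' i)"
      have mp: "0 \<le> m p" using nn Suc.prems by auto
      have mq: "0 \<le> m' q" using nn Suc.prems by auto
      have IH: "?L p' q \<le> ?R" using Suc.hyps(1)[of p' q] Suc.hyps(2) Suc.prems p by auto
      have "0 \<le> ?L p' q" using nn Suc.prems p by (intro mult_nonneg_nonneg prod_nonneg) auto
      \<comment> \<open>The sign of this product of values of \<open>n\<close> follows from the
        nonnegative lower bound that the induction hypothesis provides.\<close>
      then have R: "?R \<ge> 0" using IH by linarith
      have "?L p q = ?L p' q * m p + ?L p q' * m' q" using binomial_prod_Suc_Suc[of p' q' m m'] p q by simp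
      also have "\<dots> \<le> ?R * m p + ?R * m' q"
      proof (rule add_mono)
        show "?L p' q * m p \<le> ?R * m p" using IH mp by (rule mult_right_mono)
        have "p' + q = p + q'" using p q by simp
        then show "?L p q' * m' q \<le> ?R * m' q"
          using Suc.hyps(1)[of p q'] Suc.hyps(2) Suc.prems q mq by (intro mult_right_mono) auto
      qed
      also have "\<dots> = ?R * (m p + m' q)" by (simp add: distrib_left)
      also have "\<dots> \<le> ?R * n (p + q)" using le Suc.prems R by (intro mult_left_mono) auto
      also have "\<dots> = (\<Prod>i=1..p + q. n i)" using p by simp
      finally show ?thesis .
    qed
  qed
qed

text \<open>The origin of the binomial coefficient: it turns the two separate factorials into the
  factorial of the sum of the codimensions.\<close>

lemma fact_add_divide:
  "(1 / fact c * a) * (1 / fact c' * b) = 1 / fact (c + c') * (real ((c + c') choose c) * a * b)" for a b :: real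
  by (simp add: binomial_fact field_simps)

section \<open>From extended natural numbers to real inequalities\<close>

lemma prod_enat: "(\<Prod>i\<in>A. enat (f i)) = enat (\<Prod>i\<in>A. f i)"
  by (induction A rule: infinite_finite_induct) (auto simp: one_enat_def)

lemma prod_enat_nz: "(\<And>i. i \<in> A \<Longrightarrow> f i \<noteq> 0) \<Longrightarrow> (\<Prod>i\<in>A. f i :: enat) \<noteq> 0"
  by (induction A rule: infinite_finite_induct) (auto simp: imult_is_0)

text \<open>In \<open>enat\<close> the product of \<open>0\<close> and \<open>\<infinity>\<close> is
  \<open>0\<close>, so the other factors must be nonzero.\<close>

lemma prod_enat_eq_infinity:
  assumes "finite A" and "a \<in> A" and "f a = \<infinity>" and "\<And>i. i \<in> A \<Longrightarrow> f i \<noteq> 0"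
  shows "(\<Prod>i\<in>A. f i :: enat) = \<infinity>"
  using assms prod_enat_nz[of "A - {a}" f] by (subst prod.remove[of A a]) (auto simp: imult_is_infinity)

lemma ereal_prod_enat:
  "ereal r * ereal_of_enat (\<Prod>i\<in>A. enat (f i)) = ereal (r * (\<Prod>i\<in>A. real (f i)))"
  by (simp add: prod_enat)

text \<open>One infinite factor makes the whole product infinite, the others being nonzero by
  positivity of the shifts, and no real number bounds that from above. The lower bound inequality
  thus shows that these modules are nonzero.\<close>

lemma min_shift_finite:
  assumes H: "positively_shifted H" and i: "i \<le> d"
    and le: "ereal r \<ge> ereal (1 / fact d) * ereal_of_enat (\<Prod>i=1..d. min_shift H i)"
  shows "min_shift H i \<noteq> \<infinity>"
proof
  assume inf: "min_shift H i = \<infinity>"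
  then have "i \<ge> 1" using min_shift_0[OF H] by (cases i) auto
  then have "(\<Prod>i=1..d. min_shift H i) = \<infinity>"
    using inf i min_shift_nz[OF H] by (intro prod_enat_eq_infinity[of _ i]) auto
  then show False using le by simp
qed

lemma max_shift_finite:
  assumes H: "positively_shifted H"
  shows "max_shift H i \<noteq> \<infinity>"
proof (cases "basis H i = {}")
  case True
  then show ?thesis by (simp add: max_shift_empty)
next
  case False
  then show ?thesis using max_shift_eq[OF H] by (metis enat.distinct(1))
qed

lemma basis_nonempty_if_upper_bound:
  assumes H: "positively_shifted H" and i: "i \<le> d" and r: "r > 0"
    and le: "ereal r \<le> ereal (1 / fact d) * ereal_of_enat (\<Prod>i=1..d. max_shift H i)"
  shows "basis H i \<noteq> {}"
proof
  assume emp: "basis H i = {}"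
  then have "i \<ge> 1" using H by (cases i) (auto simp: positively_shifted_def)
  then have "(\<Prod>i=1..d. max_shift H i) = 0" using max_shift_empty[OF emp] i by (intro prod_zero) auto
  then show False using le r by simp
qed

lemma lower_bound_tensor:
  assumes F: "positively_shifted F" and G: "positively_shifted G"
    and eF: "ereal e \<ge> ereal (1 / fact c) * ereal_of_enat (\<Prod>i=1..c. min_shift F i)"
    and eG: "ereal e' \<ge> ereal (1 / fact c') * ereal_of_enat (\<Prod>i=1..c'. min_shift G i)"
  shows "ereal (e * e') \<ge> ereal (1 / fact (c + c')) *
    ereal_of_enat (\<Prod>i=1..c + c'. min_shift (tensor_complex F G) i)"
proof -
  define m where "m i = the_enat (min_shift F i)" for i
  define m' where "m' i = the_enat (min_shift G i)" for i
  define n where "n i = the_enat (min_shift (tensor_complex F G) i)" for i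
  have m: "min_shift F i = enat (m i)" if "i \<le> c" for i
    using min_shift_finite[OF F that eF] by (auto simp: m_def)
  have m': "min_shift G i = enat (m' i)" if "i \<le> c'" for i
    using min_shift_finite[OF G that eG] by (auto simp: m'_def)
  have le: "min_shift (tensor_complex F G) (p + q) \<le> enat (m p + m' q)" if "p \<le> c" "q \<le> c'" for p q
    using min_shift_tensor_le[OF F G, of p q] m[OF that(1)] m'[OF that(2)] by simp
  have n: "min_shift (tensor_complex F G) i = enat (n i)" if i: "i \<le> c + c'" for i
  proof -
    \<comment> \<open>Any splitting of \<open>i\<close> into an index up to \<open>c\<close> and one
      up to \<open>c'\<close> bounds the shift by a finite value; \<open>min i c\<close> gives such
      a splitting.\<close>
    have "min_shift (tensor_complex F G) i \<le> enat (m (min i c) + m' (i - min i c))"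
      using le[of "min i c" "i - min i c"] i by simp
    then show ?thesis by (cases "min_shift (tensor_complex F G) i") (auto simp: n_def)
  qed
  have nle: "n (p + q) \<le> m p + m' q" if "p \<le> c" "q \<le> c'" for p q
    using le[OF that] n[of "p + q"] that by simp
  have m0: "m 0 = 0" "m' 0 = 0" using min_shift_0[OF F] min_shift_0[OF G] by (auto simp: m_def m'_def zero_enat_def)
  let ?A = "\<Prod>i=1..c. real (m i)" and ?B = "\<Prod>i=1..c'. real (m' i)"
  have "(\<Prod>i=1..c. min_shift F i) = (\<Prod>i=1..c. enat (m i))" using m by (intro prod.cong) auto
  then have e: "e \<ge> 1 / fact c * ?A" using eF by (simp only: ereal_prod_enat ereal_less_eq)
  have "(\<Prod>i=1..c'. min_shift G i) = (\<Prod>i=1..c'. enat (m' i))" using m' by (intro prod.cong) auto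
  then have e': "e' \<ge> 1 / fact c' * ?B" using eG by (simp only: ereal_prod_enat ereal_less_eq)
  have nn: "(\<Prod>i=1..c + c'. min_shift (tensor_complex F G) i) = (\<Prod>i=1..c + c'. enat (n i))"
    using n by (intro prod.cong) auto
  have "(\<Prod>i=1..c + c'. real (n i)) \<le> real ((c + c') choose c) * ?A * ?B"
  proof (rule prod_le_binomial_prod[where c = c and c' = c'])
    fix p q assume "p \<le> c" "q \<le> c'"
    then show "real (n (p + q)) \<le> real (m p) + real (m' q)" using nle by (metis of_nat_add of_nat_mono)
  qed (use m0 in auto)
  then have "1 / fact (c + c') * (\<Prod>i=1..c + c'. real (n i)) \<le> 1 / fact (c + c') * (real ((c + c') choose c) * ?A * ?B)"
    by (intro mult_left_mono) auto
  also have "\<dots> = (1 / fact c * ?A) * (1 / fact c' * ?B)" by (rule fact_add_divide[symmetric])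
  also have "\<dots> \<le> e * e'"
  proof (intro mult_mono e e')
    have "0 \<le> 1 / fact c * ?A" by (intro mult_nonneg_nonneg prod_nonneg) auto
    then show "0 \<le> e" using e by linarith
    show "0 \<le> 1 / fact c' * ?B" by (intro mult_nonneg_nonneg prod_nonneg) auto
  qed
  finally show ?thesis unfolding nn ereal_prod_enat by simp
qed

lemma upper_bound_tensor:
  assumes F: "positively_shifted F" and G: "positively_shifted G" and pos: "e > 0" "e' > 0"
    and eF: "ereal e \<le> ereal (1 / fact c) * ereal_of_enat (\<Prod>i=1..c. max_shift F i)"
    and eG: "ereal e' \<le> ereal (1 / fact c') * ereal_of_enat (\<Prod>i=1..c'. max_shift G i)"
  shows "ereal (e * e') \<le> ereal (1 / fact (c + c')) *
    ereal_of_enat (\<Prod>i=1..c + c'. max_shift (tensor_complex F G) i)"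
proof -
  define m where "m i = the_enat (max_shift F i)" for i
  define m' where "m' i = the_enat (max_shift G i)" for i
  define n where "n i = the_enat (max_shift (tensor_complex F G) i)" for i
  have m: "max_shift F i = enat (m i)" for i using max_shift_finite[OF F, of i] by (auto simp: m_def)
  have m': "max_shift G i = enat (m' i)" for i using max_shift_finite[OF G, of i] by (auto simp: m'_def)
  have n: "max_shift (tensor_complex F G) i = enat (n i)" for i
    using max_shift_finite[OF positively_shifted_tensor[OF F G], of i] by (auto simp: n_def)
  have le: "m p + m' q \<le> n (p + q)" if "p \<le> c" "q \<le> c'" for p q
    using max_shift_tensor_ge[OF F G basis_nonempty_if_upper_bound[OF F that(1) pos(1) eF] basis_nonempty_if_upper_bound[OF G that(2) pos(2) eG]] by (simp add: m m' n)
  have m0: "m 0 = 0" "m' 0 = 0" using max_shift_0[OF F] max_shift_0[OF G] by (auto simp: m_def m'_def zero_enat_def)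
  let ?A = "\<Prod>i=1..c. real (m i)" and ?B = "\<Prod>i=1..c'. real (m' i)"
  have e: "e \<le> 1 / fact c * ?A" using eF by (simp only: m ereal_prod_enat ereal_less_eq)
  have e': "e' \<le> 1 / fact c' * ?B" using eG by (simp only: m' ereal_prod_enat ereal_less_eq)
  \<comment> \<open>Positivity of the multiplicities serves again, for multiplying the two
    inequalities.\<close>
  have "e * e' \<le> (1 / fact c * ?A) * (1 / fact c' * ?B)"
    using pos e by (intro mult_mono e e') auto
  also have "\<dots> = 1 / fact (c + c') * (real ((c + c') choose c) * ?A * ?B)" by (rule fact_add_divide)
  also have "\<dots> \<le> 1 / fact (c + c') * (\<Prod>i=1..c + c'. real (n i))"
  proof (rule mult_left_mono)
    show "real ((c + c') choose c) * ?A * ?B \<le> (\<Prod>i=1..c + c'. real (n i))"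
    proof (rule binomial_prod_le_prod[where c = c and c' = c'])
      fix p q assume "p \<le> c" "q \<le> c'"
      then show "real (m p) + real (m' q) \<le> real (n (p + q))" using le by (metis of_nat_add of_nat_mono)
    qed (use m0 in auto)
  qed auto
  finally show ?thesis unfolding n ereal_prod_enat by simp
qed

section \<open>Codimension and multiplicity of a tensor product\<close>

text \<open>This specializes the product formula for Hilbert series to the polynomial rings
  themselves, whose dimensions also enter the codimensions.\<close>

lemma tensor_ideal_zero: "tensor_ideal X Y {0} {0} = {0}"
proof -
  interpret cring "poly_ring (X <+> Y) :: ('a + 'b, 'c) mpoly ring" by (rule cring_poly_ring)
  show ?thesis using genideal_zero by (simp add: tensor_ideal_def)
qed

lemma codim_multiplicity:
  fixes J :: "('x, 'k::field) mpoly set"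
  assumes X: "finite X" and J: "hom_ideal X J"
    and h: "one_minus_X ^ d * hilbert_series X J = fps_of_poly Q" and Q: "poly Q 1 \<noteq> 0"
    and h0: "one_minus_X ^ n * hilbert_series X ({0} :: ('x, 'k) mpoly set) = fps_of_poly Q0" and Q0: "poly Q0 1 \<noteq> 0"
  shows "codim X J = n - d" and "d \<le> n" and "multiplicity X J = poly Q 1" and "poly Q 1 > 0"
proof -
  show "codim X J = n - d"
    by (simp add: codim_def krull_dim_poly_ring[OF X h0 Q0] dim_quot_eq[OF X J h Q])
  show "d \<le> n" by (rule dim_le_dim_zero[OF X J h Q h0])
  show "multiplicity X J = poly Q 1" "poly Q 1 > 0" by (rule multiplicity_eq[OF X J h Q])+
qed

lemma numerator_mult:
  assumes "one_minus_X ^ d * g = fps_of_poly P" and "one_minus_X ^ d' * h = fps_of_poly (Q :: real poly)"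
  shows "one_minus_X ^ (d + d') * (g * h) = fps_of_poly (P * Q)"
proof -
  have "one_minus_X ^ (d + d') * (g * h) = (one_minus_X ^ d * g) * (one_minus_X ^ d' * h)"
    by (simp only: power_add ac_simps)
  then show ?thesis by (simp only: assms fps_of_poly_mult)
qed

text \<open>Numerators multiply and pole orders add, both for the given ideals and for the zero
  ideals. As \<open>d \<le> n\<close> and \<open>d' \<le> n'\<close>, the difference
  \<open>(n + n') - (d + d')\<close> splits into the two codimensions, and evaluating the numerators
  at \<open>1\<close> gives the multiplicities.\<close>

lemma codim_multiplicity_tensor:
  fixes I :: "('x, 'k::field) mpoly set" and I' :: "('y, 'k) mpoly set"
  assumes X: "finite X" and Y: "finite Y" and I: "hom_ideal X I" "I \<noteq> polys X" and I': "hom_ideal Y I'" "I' \<noteq> polys Y"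
  shows "codim (X <+> Y) (tensor_ideal X Y I I') = codim X I + codim Y I'"
    and "multiplicity (X <+> Y) (tensor_ideal X Y I I') = multiplicity X I * multiplicity Y I'"
    and "multiplicity X I > 0" and "multiplicity Y I' > 0"
proof -
  have XY: "finite (X <+> Y)" using X Y by simp
  have nz: "{0} \<noteq> (polys X :: ('x, 'k) mpoly set)" "{0} \<noteq> (polys Y :: ('y, 'k) mpoly set)"
    using polys_1[of X] polys_1[of Y] by (metis singletonD zero_neq_one)+
  obtain d Q where h: "one_minus_X ^ d * hilbert_series X I = fps_of_poly Q" "poly Q 1 \<noteq> 0"
    using ex_hilbert_numerator[OF X I] by blast
  obtain d' Q' where h': "one_minus_X ^ d' * hilbert_series Y I' = fps_of_poly Q'" "poly Q' 1 \<noteq> 0"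
    using ex_hilbert_numerator[OF Y I'] by blast
  obtain n P where z: "one_minus_X ^ n * hilbert_series X ({0} :: ('x, 'k) mpoly set) = fps_of_poly P" "poly P 1 \<noteq> 0"
    using ex_hilbert_numerator[OF X hom_ideal_zero nz(1)] by blast
  obtain n' P' where z': "one_minus_X ^ n' * hilbert_series Y ({0} :: ('y, 'k) mpoly set) = fps_of_poly P'" "poly P' 1 \<noteq> 0"
    using ex_hilbert_numerator[OF Y hom_ideal_zero nz(2)] by blast
  note series = hilbert_series_tensor_ideal[OF X Y]
  have H: "one_minus_X ^ (d + d') * hilbert_series (X <+> Y) (tensor_ideal X Y I I') = fps_of_poly (Q * Q')"
    "poly (Q * Q') 1 \<noteq> 0"
    unfolding series[OF I(1) I'(1)] using numerator_mult[OF h(1) h'(1)] h(2) h'(2) by simp_all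
  have Z: "one_minus_X ^ (n + n') * hilbert_series (X <+> Y) ({0} :: ('x + 'y, 'k) mpoly set) = fps_of_poly (P * P')"
    "poly (P * P') 1 \<noteq> 0"
    using numerator_mult[OF z(1) z'(1)] z(2) z'(2)
    by (simp_all add: series[OF hom_ideal_zero hom_ideal_zero, unfolded tensor_ideal_zero])
  note X = codim_multiplicity[OF X I(1) h z] and Y = codim_multiplicity[OF Y I'(1) h' z']
    and XY = codim_multiplicity[OF XY hom_ideal_tensor_ideal[OF I(1) I'(1)] H Z]
  show "codim (X <+> Y) (tensor_ideal X Y I I') = codim X I + codim Y I'"
    using X(1,2) Y(1,2) XY(1) by simp
  show "multiplicity (X <+> Y) (tensor_ideal X Y I I') = multiplicity X I * multiplicity Y I'"
    using X(3) Y(3) XY(3) by simp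
  show "multiplicity X I > 0" "multiplicity Y I' > 0" using X(3,4) Y(3,4) by simp_all
qed

theorem theorem3p1:
  fixes X :: "'x set" and Y :: "'y set"
    and I :: "('x, 'k::field) mpoly set" and I' :: "('y, 'k) mpoly set"
    and F :: "('x, 'k, 'b) graded_complex" and F' :: "('y, 'k, 'c) graded_complex"
  assumes "finite X" and "finite Y"
    and "proper_ideal X I" and "homogeneous_ideal X I"
    and "proper_ideal Y I'" and "homogeneous_ideal Y I'"
    and "graded_free_resolution X I F" and "graded_free_resolution Y I' F'"
  shows "(lower_bound_inequality X I F \<and> lower_bound_inequality Y I' F' \<longrightarrow>
           lower_bound_inequality (X <+> Y) (tensor_ideal X Y I I') (tensor_complex F F')) \<and>
         (upper_bound_inequality X I F \<and> upper_bound_inequality Y I' F' \<longrightarrow>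
           upper_bound_inequality (X <+> Y) (tensor_ideal X Y I I') (tensor_complex F F'))"
proof -
  have I: "hom_ideal X I" "I \<noteq> polys X" and I': "hom_ideal Y I'" "I' \<noteq> polys Y"
    using assms(3-6) hom_ideal_if_homogeneous_ideal by (auto simp: proper_ideal_def)
  note invariants = codim_multiplicity_tensor[OF assms(1,2) I I']
  have F: "positively_shifted F" "positively_shifted F'"
    using assms(7,8) by (auto intro: positively_shifted_resolution)
  show ?thesis
    unfolding lower_bound_inequality_def upper_bound_inequality_def invariants(1,2)
    using lower_bound_tensor[OF F] upper_bound_tensor[OF F invariants(3,4)] by blast
qed

end
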